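(* For any formula $A$ of $\mathcal{L}^\omega_*$, $$\mathrm{IL}^{\omega}_*+\mathrm{AC}^{\omega}_*+\mathrm{IP}^*_{\not\exists}\vdash A\leftrightarrow A^{HR}.$$
   Context: Fix a first-order language $\mathcal{L}$ with at least one constant symbol. Types: $G$; $\sigma\to\tau$; $\sigma^*$. Constants: function symbols of $\mathcal{L}$; $\Pi_{\sigma,\tau}:\sigma\to\tau\to\sigma$; $\Sigma_{\rho,\sigma,\tau}:(\rho\to\sigma\to\tau)\to(\rho\to\sigma)\to\rho\to\tau$; $\mathfrak{s}_\sigma:\sigma\to\sigma^*$; $\cup_\sigma:\sigma^*\to\sigma^*\to\sigma^*$; $\bigcup_{\sigma,\tau}:\sigma^*\to(\sigma\to\tau^* )\to\tau^*$. Terms: constants, typed variables, applications. Atomic formulas: $\bot$, $t=_\rho q$, $t\in_\rho q$ ($q:\rho^*$), $R(t_1,\dots,t_n)$. Formulas of $\mathcal{L}^\omega_*$: closed under $\lor,\land,\to,\forall x,\exists x$ and bounded quantifiers $\forall x\in t,\exists x\in t$. A formula is $\exists$-free if it contains no unbounded $\exists x$. $\mathrm{IL}^{\omega}_*$ is intuitionistic predicate logic in all finite types with: $x=x$; $x=y\land A\to A'$ ($A$ atomic); $\forall x\in t\,A\leftrightarrow\forall x(x\in t\to A)$; $\exists x\in t\,A\leftrightarrow\exists x(x\in t\land A)$; $\Sigma xyz=xz(yz)$; $\Pi xy=x$; $w\in\mathfrak{s}x\leftrightarrow w=x$; $w\in\cup xy\leftrightarrow w\in x\lor w\in y$; $z\in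 x\land w\in yz\to w\in\bigcup xy$; $\bigcup(\mathfrak{s}x)y=yx$; $\bigcup(\cup xy)z=\cup(\bigcup xz)(\bigcup yz)$. $\mathrm{AC}^{\omega}_*$: $\forall x^\rho\exists y^\sigma A(x,y)\to\exists f^{\rho\to\sigma^*}\forall x\exists y\in fx\,A(x,y)$. $\mathrm{IP}^*_{\not\exists}$: $(B(x)\to\exists y\,A(y))\to\exists w(B(x)\to\exists y\in w\,A(y))$ for $\exists$-free $B$. The translation $A^{HR}\equiv\exists\underline{x}\,A_{HR}(\underline{x})$ ($A_{HR}$ $\exists$-free) is defined by: atomic $A$: $A^{HR}:\equiv A_{HR}:\equiv A$; $(A\lor B)^{HR}:\equiv\exists\underline{x},\underline{u}(A_{HR}(\underline{x})\lor B_{HR}(\underline{u}))$; $(A\land B)^{HR}:\equiv\exists\underline{x},\underline{u}(A_{HR}(\underline{x})\land B_{HR}(\underline{u}))$; $(A\to B)^{HR}:\equiv\exists\underline{U}\forall\underline{x}(A_{HR}(\underline{x})\to B_{HR}(\underline{U}\underline{x}))$; $(\exists zA(z))^{HR}:\equiv\exists Z,\underline{x}\,\exists z\in Z\,A_{HR}(z,\underline{x})$; $(\forall zA(z))^{HR}:\equiv\exists\underline{X}\forall z\,A_{HR}(z,\underline{X}z)$; $(\exists z\in t\,A(z))^{HR}:\equiv\exists\underline{x}\exists z\in t\,A_{HR}(z,\underline{x})$; $(\forall z\in t\,A(z))^{HR}:\equiv\exists\underline{x}\forall z\in t\,A_{HR}(z,\underline{x})$, where $A^{HR}\equiv\exists\underline{x}A_{HR}(\underline{x})$,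 $B^{HR}\equiv\exists\underline{u}B_{HR}(\underline{u})$. *)

theory Defs
  imports Main
begin

text \<open>
  A first-order language is given by its (possibly empty) families of function and relation
  symbols: a symbol belongs to the language iff it has an arity. Equality is a logical symbol.
\<close>

record ('f, 'r) lang =
  funs :: "'f \<Rightarrow> nat option"
  rels :: "'r \<Rightarrow> nat option"

datatype ty = G | Fun ty ty (infixr "\<rightarrow>" 65) | Star ty

datatype 'f con =
    Fn 'f
  | PiC ty ty
  | SigmaC ty ty ty
  | SingC ty
  | UnC ty
  | BigUnC ty ty

primrec con_type :: "('f, 'r) lang \<Rightarrow> 'f con \<Rightarrow> ty option" where
  "con_type L (Fn f) = map_option (\<lambda>n. ((\<rightarrow>) G ^^ n) G) (funs L f)"
| "con_type L (PiC \<sigma> \<tau>) = Some (\<sigma> \<rightarrow> \<tau> \<rightarrow> \<sigma>)"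
| "con_type L (SigmaC \<rho> \<sigma> \<tau>) = Some ((\<rho> \<rightarrow> \<sigma> \<rightarrow> \<tau>) \<rightarrow> (\<rho> \<rightarrow> \<sigma>) \<rightarrow> \<rho> \<rightarrow> \<tau>)"
| "con_type L (SingC \<sigma>) = Some (\<sigma> \<rightarrow> Star \<sigma>)"
| "con_type L (UnC \<sigma>) = Some (Star \<sigma> \<rightarrow> Star \<sigma> \<rightarrow> Star \<sigma>)"
| "con_type L (BigUnC \<sigma> \<tau>) = Some (Star \<sigma> \<rightarrow> (\<sigma> \<rightarrow> Star \<tau>) \<rightarrow> Star \<tau>)"

text \<open>
  Variables are de Bruijn indices. Terms and formulas are considered in a context, the list of
  the types of their free variables, index \<open>0\<close> coming first.
\<close>

datatype 'f tm = Var nat | Con "'f con" | App "'f tm" "'f tm" (infixl "\<bullet>" 100)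

primrec has_type :: "('f, 'r) lang \<Rightarrow> ty list \<Rightarrow> 'f tm \<Rightarrow> ty \<Rightarrow> bool" where
  "has_type L \<Gamma> (Var i) \<tau> \<longleftrightarrow> i < length \<Gamma> \<and> \<Gamma> ! i = \<tau>"
| "has_type L \<Gamma> (Con c) \<tau> \<longleftrightarrow> con_type L c = Some \<tau>"
| "has_type L \<Gamma> (t \<bullet> u) \<tau> \<longleftrightarrow> (\<exists>\<sigma>. has_type L \<Gamma> t (\<sigma> \<rightarrow> \<tau>) \<and> has_type L \<Gamma> u \<sigma>)"

text \<open>
  The four quantifiers bind index \<open>0\<close> of their body; the bounding term of \<open>BAll\<close> and \<open>BEx\<close>
  is outside the scope of the binder.
\<close>

datatype ('f, 'r) fm =
    Bot
  | Eq ty "'f tm" "'f tm"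
  | Mem ty "'f tm" "'f tm"
  | Rel 'r "'f tm list"
  | Or "('f, 'r) fm" "('f, 'r) fm"
  | And "('f, 'r) fm" "('f, 'r) fm"
  | Imp "('f, 'r) fm" "('f, 'r) fm"
  | All ty "('f, 'r) fm"
  | Ex ty "('f, 'r) fm"
  | BAll ty "'f tm" "('f, 'r) fm"
  | BEx ty "'f tm" "('f, 'r) fm"

abbreviation Iff :: "('f, 'r) fm \<Rightarrow> ('f, 'r) fm \<Rightarrow> ('f, 'r) fm" where
  "Iff A B \<equiv> And (Imp A B) (Imp B A)"

primrec wf_fm :: "('f, 'r) lang \<Rightarrow> ty list \<Rightarrow> ('f, 'r) fm \<Rightarrow> bool" where
  "wf_fm L \<Gamma> Bot \<longleftrightarrow> True"
| "wf_fm L \<Gamma> (Eq \<rho> t q) \<longleftrightarrow> has_type L \<Gamma> t \<rho> \<and> has_type L \<Gamma> q \<rho>"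
| "wf_fm L \<Gamma> (Mem \<rho> t q) \<longleftrightarrow> has_type L \<Gamma> t \<rho> \<and> has_type L \<Gamma> q (Star \<rho>)"
| "wf_fm L \<Gamma> (Rel R ts) \<longleftrightarrow> rels L R = Some (length ts) \<and> (\<forall>t\<in>set ts. has_type L \<Gamma> t G)"
| "wf_fm L \<Gamma> (Or A B) \<longleftrightarrow> wf_fm L \<Gamma> A \<and> wf_fm L \<Gamma> B"
| "wf_fm L \<Gamma> (And A B) \<longleftrightarrow> wf_fm L \<Gamma> A \<and> wf_fm L \<Gamma> B"
| "wf_fm L \<Gamma> (Imp A B) \<longleftrightarrow> wf_fm L \<Gamma> A \<and> wf_fm L \<Gamma> B"
| "wf_fm L \<Gamma> (All \<rho> A) \<longleftrightarrow> wf_fm L (\<rho> # \<Gamma>) A"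
| "wf_fm L \<Gamma> (Ex \<rho> A) \<longleftrightarrow> wf_fm L (\<rho> # \<Gamma>) A"
| "wf_fm L \<Gamma> (BAll \<rho> t A) \<longleftrightarrow> has_type L \<Gamma> t (Star \<rho>) \<and> wf_fm L (\<rho> # \<Gamma>) A"
| "wf_fm L \<Gamma> (BEx \<rho> t A) \<longleftrightarrow> has_type L \<Gamma> t (Star \<rho>) \<and> wf_fm L (\<rho> # \<Gamma>) A"

primrec atomic :: "('f, 'r) fm \<Rightarrow> bool" where
  "atomic Bot \<longleftrightarrow> True"
| "atomic (Eq \<rho> t q) \<longleftrightarrow> True"
| "atomic (Mem \<rho> t q) \<longleftrightarrow> True"
| "atomic (Rel R ts) \<longleftrightarrow> True"
| "atomic (Or A B) \<longleftrightarrow> False"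
| "atomic (And A B) \<longleftrightarrow> False"
| "atomic (Imp A B) \<longleftrightarrow> False"
| "atomic (All \<rho> A) \<longleftrightarrow> False"
| "atomic (Ex \<rho> A) \<longleftrightarrow> False"
| "atomic (BAll \<rho> t A) \<longleftrightarrow> False"
| "atomic (BEx \<rho> t A) \<longleftrightarrow> False"

primrec ex_free :: "('f, 'r) fm \<Rightarrow> bool" where
  "ex_free Bot \<longleftrightarrow> True"
| "ex_free (Eq \<rho> t q) \<longleftrightarrow> True"
| "ex_free (Mem \<rho> t q) \<longleftrightarrow> True"
| "ex_free (Rel R ts) \<longleftrightarrow> True"
| "ex_free (Or A B) \<longleftrightarrow> ex_free A \<and> ex_free B"
| "ex_free (And A B) \<longleftrightarrow> ex_free A \<and> ex_free B"
| "ex_free (Imp A B) \<longleftrightarrow> ex_free A \<and> ex_free B"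
| "ex_free (All \<rho> A) \<longleftrightarrow> ex_free A"
| "ex_free (Ex \<rho> A) \<longleftrightarrow> False"
| "ex_free (BAll \<rho> t A) \<longleftrightarrow> ex_free A"
| "ex_free (BEx \<rho> t A) \<longleftrightarrow> ex_free A"

text \<open>Simultaneous substitution; renamings and shifts are the special case of variables.\<close>

primrec subst_tm :: "(nat \<Rightarrow> 'f tm) \<Rightarrow> 'f tm \<Rightarrow> 'f tm" where
  "subst_tm \<theta> (Var i) = \<theta> i"
| "subst_tm \<theta> (Con c) = Con c"
| "subst_tm \<theta> (t \<bullet> u) = subst_tm \<theta> t \<bullet> subst_tm \<theta> u"

definition up :: "(nat \<Rightarrow> 'f tm) \<Rightarrow> nat \<Rightarrow> 'f tm" where
  "up \<theta> i = (case i of 0 \<Rightarrow> Var 0 | Suc j \<Rightarrow> subst_tm (\<lambda>k. Var (Suc k)) (\<theta> j))"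

primrec subst :: "(nat \<Rightarrow> 'f tm) \<Rightarrow> ('f, 'r) fm \<Rightarrow> ('f, 'r) fm" where
  "subst \<theta> Bot = Bot"
| "subst \<theta> (Eq \<rho> t q) = Eq \<rho> (subst_tm \<theta> t) (subst_tm \<theta> q)"
| "subst \<theta> (Mem \<rho> t q) = Mem \<rho> (subst_tm \<theta> t) (subst_tm \<theta> q)"
| "subst \<theta> (Rel R ts) = Rel R (map (subst_tm \<theta>) ts)"
| "subst \<theta> (Or A B) = Or (subst \<theta> A) (subst \<theta> B)"
| "subst \<theta> (And A B) = And (subst \<theta> A) (subst \<theta> B)"
| "subst \<theta> (Imp A B) = Imp (subst \<theta> A) (subst \<theta> B)"
| "subst \<theta> (All \<rho> A) = All \<rho> (subst (up \<theta>) A)"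
| "subst \<theta> (Ex \<rho> A) = Ex \<rho> (subst (up \<theta>) A)"
| "subst \<theta> (BAll \<rho> t A) = BAll \<rho> (subst_tm \<theta> t) (subst (up \<theta>) A)"
| "subst \<theta> (BEx \<rho> t A) = BEx \<rho> (subst_tm \<theta> t) (subst (up \<theta>) A)"

text \<open>\<open>shift k d\<close> makes room for \<open>d\<close> new variables behind the first \<open>k\<close> ones.\<close>

definition shift_var :: "nat \<Rightarrow> nat \<Rightarrow> nat \<Rightarrow> 'f tm" where
  "shift_var k d i = (if i < k then Var i else Var (i + d))"

abbreviation shift_tm :: "nat \<Rightarrow> nat \<Rightarrow> 'f tm \<Rightarrow> 'f tm" where
  "shift_tm k d \<equiv> subst_tm (shift_var k d)"

abbreviation shift :: "nat \<Rightarrow> nat \<Rightarrow> ('f, 'r) fm \<Rightarrow> ('f, 'r) fm" where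
  "shift k d \<equiv> subst (shift_var k d)"

definition inst_var :: "'f tm \<Rightarrow> nat \<Rightarrow> 'f tm" where
  "inst_var t i = (case i of 0 \<Rightarrow> t | Suc j \<Rightarrow> Var j)"

abbreviation inst :: "'f tm \<Rightarrow> ('f, 'r) fm \<Rightarrow> ('f, 'r) fm" where
  "inst t \<equiv> subst (inst_var t)"

text \<open>
  Axioms are stated for arbitrary terms of the appropriate types in place of the displayed
  variables. In \<open>eq_subst\<close>, index \<open>0\<close> of \<open>A\<close> marks the occurrences that are replaced.
\<close>

inductive IL_axiom :: "('f, 'r) lang \<Rightarrow> ty list \<Rightarrow> ('f, 'r) fm \<Rightarrow> bool" for L \<Gamma> where
  eq_refl: "has_type L \<Gamma> x \<rho> \<Longrightarrow> IL_axiom L \<Gamma> (Eq \<rho> x x)"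
| eq_subst: "has_type L \<Gamma> x \<rho> \<Longrightarrow> has_type L \<Gamma> y \<rho> \<Longrightarrow> wf_fm L (\<rho> # \<Gamma>) A \<Longrightarrow> atomic A \<Longrightarrow>
    IL_axiom L \<Gamma> (Imp (And (Eq \<rho> x y) (inst x A)) (inst y A))"
| ball: "wf_fm L \<Gamma> (BAll \<rho> t A) \<Longrightarrow>
    IL_axiom L \<Gamma> (Iff (BAll \<rho> t A) (All \<rho> (Imp (Mem \<rho> (Var 0) (shift_tm 0 1 t)) A)))"
| bex: "wf_fm L \<Gamma> (BEx \<rho> t A) \<Longrightarrow>
    IL_axiom L \<Gamma> (Iff (BEx \<rho> t A) (Ex \<rho> (And (Mem \<rho> (Var 0) (shift_tm 0 1 t)) A)))"
| sigma: "has_type L \<Gamma> x (\<rho> \<rightarrow> \<sigma> \<rightarrow> \<tau>) \<Longrightarrow> has_type L \<Gamma> y (\<rho> \<rightarrow> \<sigma>) \<Longrightarrow> has_type L \<Gamma> z \<rho> \<Longrightarrow>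
    IL_axiom L \<Gamma> (Eq \<tau> (Con (SigmaC \<rho> \<sigma> \<tau>) \<bullet> x \<bullet> y \<bullet> z) (x \<bullet> z \<bullet> (y \<bullet> z)))"
| pi: "has_type L \<Gamma> x \<sigma> \<Longrightarrow> has_type L \<Gamma> y \<tau> \<Longrightarrow>
    IL_axiom L \<Gamma> (Eq \<sigma> (Con (PiC \<sigma> \<tau>) \<bullet> x \<bullet> y) x)"
| sing: "has_type L \<Gamma> w \<sigma> \<Longrightarrow> has_type L \<Gamma> x \<sigma> \<Longrightarrow>
    IL_axiom L \<Gamma> (Iff (Mem \<sigma> w (Con (SingC \<sigma>) \<bullet> x)) (Eq \<sigma> w x))"
| un: "has_type L \<Gamma> w \<sigma> \<Longrightarrow> has_type L \<Gamma> x (Star \<sigma>) \<Longrightarrow> has_type L \<Gamma> y (Star \<sigma>) \<Longrightarrow>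
    IL_axiom L \<Gamma> (Iff (Mem \<sigma> w (Con (UnC \<sigma>) \<bullet> x \<bullet> y)) (Or (Mem \<sigma> w x) (Mem \<sigma> w y)))"
| bigun: "has_type L \<Gamma> z \<sigma> \<Longrightarrow> has_type L \<Gamma> x (Star \<sigma>) \<Longrightarrow> has_type L \<Gamma> w \<tau> \<Longrightarrow>
    has_type L \<Gamma> y (\<sigma> \<rightarrow> Star \<tau>) \<Longrightarrow>
    IL_axiom L \<Gamma> (Imp (And (Mem \<sigma> z x) (Mem \<tau> w (y \<bullet> z))) (Mem \<tau> w (Con (BigUnC \<sigma> \<tau>) \<bullet> x \<bullet> y)))"
| bigun_sing: "has_type L \<Gamma> x \<sigma> \<Longrightarrow> has_type L \<Gamma> y (\<sigma> \<rightarrow> Star \<tau>) \<Longrightarrow>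
    IL_axiom L \<Gamma> (Eq (Star \<tau>) (Con (BigUnC \<sigma> \<tau>) \<bullet> (Con (SingC \<sigma>) \<bullet> x) \<bullet> y) (y \<bullet> x))"
| bigun_un: "has_type L \<Gamma> x (Star \<sigma>) \<Longrightarrow> has_type L \<Gamma> y (Star \<sigma>) \<Longrightarrow>
    has_type L \<Gamma> z (\<sigma> \<rightarrow> Star \<tau>) \<Longrightarrow>
    IL_axiom L \<Gamma> (Eq (Star \<tau>)
      (Con (BigUnC \<sigma> \<tau>) \<bullet> (Con (UnC \<sigma>) \<bullet> x \<bullet> y) \<bullet> z)
      (Con (UnC \<tau>) \<bullet> (Con (BigUnC \<sigma> \<tau>) \<bullet> x \<bullet> z) \<bullet> (Con (BigUnC \<sigma> \<tau>) \<bullet> y \<bullet> z)))"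

text \<open>
  Natural deduction for \<open>IL\<close> extended by additional axioms \<open>T\<close> (formulas in context): \<open>A\<close> is
  derivable in context \<open>\<Gamma>\<close> from the open assumptions \<open>\<Delta>\<close>.
\<close>

inductive IL_deriv ::
  "('f, 'r) lang \<Rightarrow> (ty list \<times> ('f, 'r) fm) set \<Rightarrow> ty list \<Rightarrow> ('f, 'r) fm set \<Rightarrow> ('f, 'r) fm \<Rightarrow> bool"
  for L T where
  axI: "IL_axiom L \<Gamma> A \<Longrightarrow> IL_deriv L T \<Gamma> \<Delta> A"
| extI: "(\<Gamma>, A) \<in> T \<Longrightarrow> IL_deriv L T \<Gamma> \<Delta> A"
| hyp: "A \<in> \<Delta> \<Longrightarrow> wf_fm L \<Gamma> A \<Longrightarrow> IL_deriv L T \<Gamma> \<Delta> A"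
| botE: "IL_deriv L T \<Gamma> \<Delta> Bot \<Longrightarrow> wf_fm L \<Gamma> A \<Longrightarrow> IL_deriv L T \<Gamma> \<Delta> A"
| orI1: "IL_deriv L T \<Gamma> \<Delta> A \<Longrightarrow> wf_fm L \<Gamma> B \<Longrightarrow> IL_deriv L T \<Gamma> \<Delta> (Or A B)"
| orI2: "IL_deriv L T \<Gamma> \<Delta> B \<Longrightarrow> wf_fm L \<Gamma> A \<Longrightarrow> IL_deriv L T \<Gamma> \<Delta> (Or A B)"
| orE: "IL_deriv L T \<Gamma> \<Delta> (Or A B) \<Longrightarrow> IL_deriv L T \<Gamma> (insert A \<Delta>) C \<Longrightarrow>
    IL_deriv L T \<Gamma> (insert B \<Delta>) C \<Longrightarrow> IL_deriv L T \<Gamma> \<Delta> C"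
| andI: "IL_deriv L T \<Gamma> \<Delta> A \<Longrightarrow> IL_deriv L T \<Gamma> \<Delta> B \<Longrightarrow> IL_deriv L T \<Gamma> \<Delta> (And A B)"
| andE1: "IL_deriv L T \<Gamma> \<Delta> (And A B) \<Longrightarrow> IL_deriv L T \<Gamma> \<Delta> A"
| andE2: "IL_deriv L T \<Gamma> \<Delta> (And A B) \<Longrightarrow> IL_deriv L T \<Gamma> \<Delta> B"
| impI: "wf_fm L \<Gamma> A \<Longrightarrow> IL_deriv L T \<Gamma> (insert A \<Delta>) B \<Longrightarrow> IL_deriv L T \<Gamma> \<Delta> (Imp A B)"
| impE: "IL_deriv L T \<Gamma> \<Delta> (Imp A B) \<Longrightarrow> IL_deriv L T \<Gamma> \<Delta> A \<Longrightarrow> IL_deriv L T \<Gamma> \<Delta> B"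
| allI: "IL_deriv L T (\<rho> # \<Gamma>) (shift 0 1 ` \<Delta>) A \<Longrightarrow> IL_deriv L T \<Gamma> \<Delta> (All \<rho> A)"
| allE: "IL_deriv L T \<Gamma> \<Delta> (All \<rho> A) \<Longrightarrow> has_type L \<Gamma> t \<rho> \<Longrightarrow> IL_deriv L T \<Gamma> \<Delta> (inst t A)"
| exI: "wf_fm L (\<rho> # \<Gamma>) A \<Longrightarrow> has_type L \<Gamma> t \<rho> \<Longrightarrow> IL_deriv L T \<Gamma> \<Delta> (inst t A) \<Longrightarrow>
    IL_deriv L T \<Gamma> \<Delta> (Ex \<rho> A)"
| exE: "IL_deriv L T \<Gamma> \<Delta> (Ex \<rho> A) \<Longrightarrow>
    IL_deriv L T (\<rho> # \<Gamma>) (insert A (shift 0 1 ` \<Delta>)) (shift 0 1 C) \<Longrightarrow> wf_fm L \<Gamma> C \<Longrightarrow>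
    IL_deriv L T \<Gamma> \<Delta> C"

text \<open>
  In \<open>AC\<close>, \<open>A\<close> lives in the context \<open>y, x, \<Gamma>\<close> and is moved to \<open>y, x, f, \<Gamma>\<close>. In \<open>IP\<close>, \<open>A\<close> lives in
  \<open>y, \<Gamma>\<close> and is moved to \<open>y, w, \<Gamma>\<close>. The variables of \<open>\<Gamma>\<close> are parameters.
\<close>

definition AC :: "('f, 'r) lang \<Rightarrow> (ty list \<times> ('f, 'r) fm) set" where
  "AC L = {(\<Gamma>, Imp (All \<rho> (Ex \<sigma> A))
                  (Ex (\<rho> \<rightarrow> Star \<sigma>) (All \<rho> (BEx \<sigma> (Var 1 \<bullet> Var 0) (shift 2 1 A)))))
           | \<Gamma> \<rho> \<sigma> A. wf_fm L (\<sigma> # \<rho> # \<Gamma>) A}"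

definition IP :: "('f, 'r) lang \<Rightarrow> (ty list \<times> ('f, 'r) fm) set" where
  "IP L = {(\<Gamma>, Imp (Imp B (Ex \<sigma> A))
                  (Ex (Star \<sigma>) (Imp (shift 0 1 B) (BEx \<sigma> (Var 0) (shift 1 1 A)))))
           | \<Gamma> \<sigma> A B. wf_fm L \<Gamma> B \<and> ex_free B \<and> wf_fm L (\<sigma> # \<Gamma>) A}"

text \<open>
  \<open>HR A = (xs, A\<^sub>H\<^sub>R)\<close>, where \<open>xs\<close> lists the types of the witnessing tuple, innermost quantifier
  first: if \<open>A\<close> lives in the context \<open>\<Gamma>\<close>, then \<open>A\<^sub>H\<^sub>R\<close> lives in \<open>xs @ \<Gamma>\<close>. A displayed tuple
  \<open>x\<^sub>1, \<dots>, x\<^sub>n\<close> thus consists of the variables \<open>n - 1, \<dots>, 0\<close>.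

  The contexts of the matrices are, in the order of the equations below: \<open>us @ xs @ \<Gamma>\<close> (for
  disjunction and conjunction), \<open>xs @ Us @ \<Gamma>\<close> under the prefix \<open>\<forall>xs\<close>, \<open>z # Xs @ \<Gamma>\<close>,
  \<open>z # xs @ Z # \<Gamma>\<close>, and \<open>z # xs @ \<Gamma>\<close> (for both bounded quantifiers), whereas the recursive
  call on the body of a quantifier yields \<open>xs @ z # \<Gamma>\<close>.
\<close>

definition Alls :: "ty list \<Rightarrow> ('f, 'r) fm \<Rightarrow> ('f, 'r) fm" where
  "Alls = fold All"

definition Exs :: "ty list \<Rightarrow> ('f, 'r) fm \<Rightarrow> ('f, 'r) fm" where
  "Exs = fold Ex"

definition Arrows :: "ty list \<Rightarrow> ty \<Rightarrow> ty" where
  "Arrows = fold (\<rightarrow>)"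

definition app_vars :: "'f tm \<Rightarrow> nat \<Rightarrow> 'f tm" where
  "app_vars t n = foldl (\<bullet>) t (map Var (rev [0..<n]))"

primrec HR :: "('f, 'r) fm \<Rightarrow> ty list \<times> ('f, 'r) fm" where
  "HR Bot = ([], Bot)"
| "HR (Eq \<rho> t q) = ([], Eq \<rho> t q)"
| "HR (Mem \<rho> t q) = ([], Mem \<rho> t q)"
| "HR (Rel R ts) = ([], Rel R ts)"
| "HR (Or A B) = (case (HR A, HR B) of ((xs, A'), (us, B')) \<Rightarrow>
     (us @ xs, Or (shift 0 (length us) A') (shift (length us) (length xs) B')))"
| "HR (And A B) = (case (HR A, HR B) of ((xs, A'), (us, B')) \<Rightarrow>
     (us @ xs, And (shift 0 (length us) A') (shift (length us) (length xs) B')))"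
| "HR (Imp A B) = (case (HR A, HR B) of ((xs, A'), (us, B')) \<Rightarrow>
     let n = length xs; m = length us in
     (map (Arrows xs) us,
      Alls xs (Imp (shift n m A')
        (subst (\<lambda>i. if i < m then app_vars (Var (n + i)) n else Var (n + i)) B'))))"
| "HR (All \<rho> A) = (case HR A of (xs, A') \<Rightarrow> let n = length xs in
     (map ((\<rightarrow>) \<rho>) xs,
      All \<rho> (subst (\<lambda>i. if i < n then Var (Suc i) \<bullet> Var 0
                        else if i = n then Var 0 else Var i) A')))"
| "HR (Ex \<rho> A) = (case HR A of (xs, A') \<Rightarrow> let n = length xs in
     (xs @ [Star \<rho>],
      BEx \<rho> (Var n) (subst (\<lambda>i. if i = n then Var 0 else Var (Suc i)) A')))"
| "HR (BAll \<rho> t A) = (case HR A of (xs, A') \<Rightarrow> let n = length xs in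
     (xs, BAll \<rho> (shift_tm 0 n t)
       (subst (\<lambda>i. if i < n then Var (Suc i) else if i = n then Var 0 else Var i) A')))"
| "HR (BEx \<rho> t A) = (case HR A of (xs, A') \<Rightarrow> let n = length xs in
     (xs, BEx \<rho> (shift_tm 0 n t)
       (subst (\<lambda>i. if i < n then Var (Suc i) else if i = n then Var 0 else Var i) A')))"

definition HR_fm :: "('f, 'r) fm \<Rightarrow> ('f, 'r) fm" where
  "HR_fm A = (case HR A of (xs, A') \<Rightarrow> Exs xs A')"

end

theory Submission
  imports Defs
begin

text \<open>
  All witnesses of the translation have types \<open>\<rho>\<^sub>1 \<rightarrow> \<dots> \<rightarrow> \<rho>\<^sub>k \<rightarrow> \<sigma>*\<close>, and \<open>A\<^sub>H\<^sub>R\<close> is monotone in its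
  witnesses with respect to pointwise inclusion. At such a type a finite set of candidate witnesses
  can be replaced by its pointwise union, which is definable from \<open>\<Union>\<close> by combinatory completeness.
  Hence the Herbrand forms of choice and independence of premise, which only provide finite sets of
  candidates, yield exact witnesses when applied to \<open>A\<^sub>H\<^sub>R\<close>; the same union makes a witness of a
  bounded universal quantifier uniform. With this, each clause of the translation is a prenexing
  equivalence, and the result follows by induction on the formula. The constant symbol is needed for
  disjunction: the witnesses of the other disjunct are arbitrary inhabitants of their types.
\<close>

section \<open>Substitution calculus\<close>

text \<open>Witnesses are created only by an unbounded \<open>\<exists>z\<close>, as the bound
  \<open>Z\<close> of a new \<open>\<exists>z \<in> Z\<close>; so they have star type and stand
  where enlarging them preserves derivability. The other clauses copy witnesses or give them further
  arguments. In an implication the witnesses of the premise are universally quantified, and the new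
  ones occur in the conclusion alone. This is why both the type condition and monotonicity survive
  every clause. The membership axiom for \<open>\<Union>\<close> says that the union is an upper
  bound of the family, and monotonicity asks for no more. No axiom turns mutual inclusion into
  equality, and equals are replaced in atomic formulas only, so a witness cannot be exchanged for a
  larger one by rewriting. Monotonicity is therefore a statement about pairs of substitutions,
  quantified over contexts and assumptions so that it passes under binders and discharged
  hypotheses. For this reason derivability is first shown to be closed under typed
  substitution.\<close>

lemma shift_var_0 [simp]: "shift_var 0 d = (\<lambda>i. Var (i + d))"
  by (auto simp: shift_var_def)

lemma up_0 [simp]: "up \<theta> 0 = Var 0"
  by (simp add: up_def)

lemma up_Suc [simp]: "up \<theta> (Suc i) = subst_tm (\<lambda>k. Var (Suc k)) (\<theta> i)"
  by (simp add: up_def)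

lemma inst_var_0 [simp]: "inst_var t 0 = t"
  by (simp add: inst_var_def)

lemma inst_var_Suc [simp]: "inst_var t (Suc i) = Var i"
  by (simp add: inst_var_def)

lemma subst_tm_subst_tm [simp]:
  "subst_tm \<theta> (subst_tm \<theta>' t) = subst_tm (\<lambda>i. subst_tm \<theta> (\<theta>' i)) t"
  by (induction t) auto

lemma subst_tm_Var [simp]: "subst_tm Var t = t"
  by (induction t) auto

lemma subst_tm_cong: "(\<And>i. \<theta> i = \<theta>' i) \<Longrightarrow> subst_tm \<theta> t = subst_tm \<theta>' t"
  by (induction t) auto

lemma up_Var [simp]: "up Var = Var"
proof
  show "up Var i = Var i" for i by (cases i) auto
qed

lemma up_comp: "(\<lambda>i. subst_tm (up \<theta>) (up \<theta>' i)) = up (\<lambda>i. subst_tm \<theta> (\<theta>' i))"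
proof
  show "subst_tm (up \<theta>) (up \<theta>' i) = up (\<lambda>i. subst_tm \<theta> (\<theta>' i)) i" for i by (cases i) auto
qed

text \<open>Nested substitutions are normalised to a single one, so that equations between shifted,
  renamed and instantiated formulas reduce to comparing index maps pointwise.\<close>

lemma subst_subst [simp]: "subst \<theta> (subst \<theta>' A) = subst (\<lambda>i. subst_tm \<theta> (\<theta>' i)) A"
  by (induction A arbitrary: \<theta> \<theta>') (auto simp: up_comp)

lemma subst_Var [simp]: "subst Var A = A"
  by (induction A) (auto simp: map_idI)

lemma subst_cong: "(\<And>i. \<theta> i = \<theta>' i) \<Longrightarrow> subst \<theta> A = subst \<theta>' A"
  by (rule arg_cong[where f = "\<lambda>\<theta>. subst \<theta> A"]) (rule ext)

lemma atomic_subst [simp]: "atomic (subst \<theta> A) = atomic A"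
  by (cases A) auto

lemma ex_free_subst [simp]: "ex_free (subst \<theta> A) = ex_free A"
  by (induction A arbitrary: \<theta>) auto

section \<open>Typing of substitutions\<close>

definition typed_subst ::
  "('f, 'r) lang \<Rightarrow> ty list \<Rightarrow> ty list \<Rightarrow> (nat \<Rightarrow> 'f tm) \<Rightarrow> bool" where
  "typed_subst L \<Gamma> \<Gamma>' \<theta> \<longleftrightarrow> (\<forall>i < length \<Gamma>. has_type L \<Gamma>' (\<theta> i) (\<Gamma> ! i))"

lemma has_type_subst:
  "has_type L \<Gamma> t \<tau> \<Longrightarrow> typed_subst L \<Gamma> \<Gamma>' \<theta> \<Longrightarrow> has_type L \<Gamma>' (subst_tm \<theta> t) \<tau>"
  by (induction t arbitrary: \<tau>) (auto simp: typed_subst_def)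

lemma typed_subst_shift [simp]: "typed_subst L \<Gamma> (\<rho> # \<Gamma>) (\<lambda>i. Var (Suc i))"
  by (auto simp: typed_subst_def)

lemma typed_subst_shift_append: "n = length xs \<Longrightarrow> typed_subst L \<Gamma> (xs @ \<Gamma>) (\<lambda>i. Var (i + n))"
  by (auto simp: typed_subst_def nth_append)

lemma typed_subst_Cons:
  "typed_subst L (\<rho> # \<Gamma>) \<Gamma>' \<theta> \<longleftrightarrow> has_type L \<Gamma>' (\<theta> 0) \<rho> \<and> typed_subst L \<Gamma> \<Gamma>' (\<lambda>i. \<theta> (Suc i))"
  by (auto simp: typed_subst_def nth_Cons split: nat.splits)

lemma typed_subst_append:
  "typed_subst L (xs @ \<Gamma>) \<Gamma>' \<theta> \<longleftrightarrow>
     typed_subst L xs \<Gamma>' \<theta> \<and> typed_subst L \<Gamma> \<Gamma>' (\<lambda>i. \<theta> (i + length xs))"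
  by (induction xs arbitrary: \<theta>) (auto simp: typed_subst_Cons, simp add: typed_subst_def)

lemma typed_subst_up:
  "typed_subst L \<Gamma> \<Gamma>' \<theta> \<Longrightarrow> typed_subst L (\<rho> # \<Gamma>) (\<rho> # \<Gamma>') (up \<theta>)"
  by (auto simp: typed_subst_Cons) (auto simp: typed_subst_def intro: has_type_subst)

lemma typed_subst_inst: "has_type L \<Gamma> t \<rho> \<Longrightarrow> typed_subst L (\<rho> # \<Gamma>) \<Gamma> (inst_var t)"
  by (auto simp: typed_subst_Cons) (auto simp: typed_subst_def)

lemma typed_subst_comp:
  "typed_subst L \<Gamma> \<Gamma>' \<theta> \<Longrightarrow> typed_subst L \<Gamma>' \<Gamma>'' \<theta>' \<Longrightarrow>
   typed_subst L \<Gamma> \<Gamma>'' (\<lambda>i. subst_tm \<theta>' (\<theta> i))"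
  by (auto simp: typed_subst_def intro: has_type_subst[unfolded typed_subst_def])

lemma wf_subst: "wf_fm L \<Gamma> A \<Longrightarrow> typed_subst L \<Gamma> \<Gamma>' \<theta> \<Longrightarrow> wf_fm L \<Gamma>' (subst \<theta> A)"
proof (induction A arbitrary: \<Gamma> \<Gamma>' \<theta>)
  case (All \<rho> A)
  then show ?case using typed_subst_up by fastforce
next
  case (Ex \<rho> A)
  then show ?case using typed_subst_up by fastforce
next
  case (BAll \<rho> t A)
  then show ?case using typed_subst_up by (fastforce intro: has_type_subst)
next
  case (BEx \<rho> t A)
  then show ?case using typed_subst_up by (fastforce intro: has_type_subst)
qed (auto intro: has_type_subst)

lemma has_type_shift: "has_type L \<Gamma> t \<tau> \<Longrightarrow> has_type L (\<rho> # \<Gamma>) (subst_tm (\<lambda>i. Var (Suc i)) t) \<tau>"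
  by (rule has_type_subst[OF _ typed_subst_shift])

lemma wf_shift: "wf_fm L \<Gamma> A \<Longrightarrow> wf_fm L (\<rho> # \<Gamma>) (subst (\<lambda>i. Var (Suc i)) A)"
  by (rule wf_subst[OF _ typed_subst_shift])

lemma IL_axiom_wf: "IL_axiom L \<Gamma> A \<Longrightarrow> wf_fm L \<Gamma> A"
  by (induction rule: IL_axiom.induct)
    (auto intro!: has_type_shift wf_subst[OF _ typed_subst_inst])

lemma subst_inst: "subst \<theta> (inst t A) = inst (subst_tm \<theta> t) (subst (up \<theta>) A)"
proof -
  have "subst_tm \<theta> (inst_var t i) = subst_tm (inst_var (subst_tm \<theta> t)) (up \<theta> i)" for i
    by (cases i) auto
  then show ?thesis by (simp only: subst_subst)
qed

text \<open>Holds because the axioms are schemes over arbitrary terms. Only the replacement axiom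
  and the axioms for bounded quantifiers involve a body with an extra index, and there
  \<open>up \<theta>\<close> acts on the body.\<close>

lemma IL_axiom_subst:
  assumes "IL_axiom L \<Gamma> A" and \<theta>: "typed_subst L \<Gamma> \<Gamma>' \<theta>"
  shows "IL_axiom L \<Gamma>' (subst \<theta> A)"
  using assms(1)
proof cases
  case (eq_subst x \<rho> y A)
  then show ?thesis
    using \<theta> IL_axiom.eq_subst[of L \<Gamma>' "subst_tm \<theta> x" \<rho> "subst_tm \<theta> y" "subst (up \<theta>) A"]
    by (simp only: subst.simps subst_inst atomic_subst has_type_subst wf_subst typed_subst_up)
next
  case (ball \<rho> t A)
  have "wf_fm L \<Gamma>' (BAll \<rho> (subst_tm \<theta> t) (subst (up \<theta>) A))"
    using wf_subst[OF ball(2) \<theta>] by simp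
  from IL_axiom.ball[OF this] show ?thesis by (simp add: ball)
next
  case (bex \<rho> t A)
  have "wf_fm L \<Gamma>' (BEx \<rho> (subst_tm \<theta> t) (subst (up \<theta>) A))"
    using wf_subst[OF bex(2) \<theta>] by simp
  from IL_axiom.bex[OF this] show ?thesis by (simp add: bex)
qed (auto intro!: IL_axiom.intros intro: has_type_subst[OF _ \<theta>])

section \<open>Derived rules\<close>

text \<open>The additional axioms stay abstract. Closure under typed substitution is what the
  substitution lemma for derivations asks of them; choice and independence of premise satisfy it
  because their free variables are parameters.\<close>

locale il_theory =
  fixes L :: "('f, 'r) lang" and T :: "(ty list \<times> ('f, 'r) fm) set"
  assumes T_wf: "(\<Gamma>, A) \<in> T \<Longrightarrow> wf_fm L \<Gamma> A"
    and T_subst: "(\<Gamma>, A) \<in> T \<Longrightarrow> typed_subst L \<Gamma> \<Gamma>' \<theta> \<Longrightarrow> (\<Gamma>', subst \<theta> A) \<in> T"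
begin

abbreviation deriv :: "ty list \<Rightarrow> ('f, 'r) fm set \<Rightarrow> ('f, 'r) fm \<Rightarrow> bool" ("_ \<parallel> _ \<turnstile> _" [61, 61, 61] 60)
  where "\<Gamma> \<parallel> \<Delta> \<turnstile> A \<equiv> IL_deriv L T \<Gamma> \<Delta> A"

lemma deriv_wf: "\<Gamma> \<parallel> \<Delta> \<turnstile> A \<Longrightarrow> wf_fm L \<Gamma> A"
  by (induction rule: IL_deriv.induct) (auto intro: IL_axiom_wf T_wf wf_subst typed_subst_inst)

lemma deriv_weaken: "\<Gamma> \<parallel> \<Delta> \<turnstile> A \<Longrightarrow> \<Delta> \<subseteq> \<Delta>' \<Longrightarrow> \<Gamma> \<parallel> \<Delta>' \<turnstile> A"
proof (induction arbitrary: \<Delta>' rule: IL_deriv.induct)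
  case (orE \<Gamma> \<Delta> A B C)
  show ?case
    by (rule IL_deriv.orE[OF orE.IH(1)[OF orE.prems] orE.IH(2)[OF insert_mono[OF orE.prems]]
        orE.IH(3)[OF insert_mono[OF orE.prems]]])
next
  case (exE \<Gamma> \<Delta> \<rho> A C)
  show ?case
    by (rule IL_deriv.exE[OF exE.IH(1)[OF exE.prems]
        exE.IH(2)[OF insert_mono[OF image_mono[OF exE.prems]]] exE.hyps(3)])
next
  case (allI \<rho> \<Gamma> \<Delta> A)
  show ?case by (rule IL_deriv.allI[OF allI.IH[OF image_mono[OF allI.prems]]])
next
  case (impI \<Gamma> A \<Delta> B)
  show ?case by (rule IL_deriv.impI[OF impI.hyps(1) impI.IH[OF insert_mono[OF impI.prems]]])
next
  case (impE \<Gamma> \<Delta> A B)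
  show ?case by (rule IL_deriv.impE[OF impE.IH(1)[OF impE.prems] impE.IH(2)[OF impE.prems]])
next
  case (andE1 \<Gamma> \<Delta> A B)
  show ?case by (rule IL_deriv.andE1[OF andE1.IH[OF andE1.prems]])
next
  case (andE2 \<Gamma> \<Delta> A B)
  show ?case by (rule IL_deriv.andE2[OF andE2.IH[OF andE2.prems]])
next
  case (allE \<Gamma> \<Delta> \<rho> A t)
  show ?case by (rule IL_deriv.allE[OF allE.IH[OF allE.prems] allE.hyps(2)])
next
  case (exI \<rho> \<Gamma> A t \<Delta>)
  show ?case by (rule IL_deriv.exI[OF exI.hyps(1,2) exI.IH[OF exI.prems]])
next
  case (botE \<Gamma> \<Delta> A)
  show ?case by (rule IL_deriv.botE[OF botE.IH[OF botE.prems] botE.hyps(2)])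
qed (auto intro: IL_deriv.axI IL_deriv.extI IL_deriv.hyp IL_deriv.orI1 IL_deriv.orI2 IL_deriv.andI)

text \<open>Lets a fact be derived once for fresh variables and used at arbitrary terms. In the
  rules that bind a variable the induction hypothesis is taken at \<open>up \<theta>\<close>, which
  commutes with the shift of the assumptions.\<close>

lemma deriv_subst:
  "\<Gamma> \<parallel> \<Delta> \<turnstile> A \<Longrightarrow> typed_subst L \<Gamma> \<Gamma>' \<theta> \<Longrightarrow> \<Gamma>' \<parallel> subst \<theta> ` \<Delta> \<turnstile> subst \<theta> A"
proof (induction arbitrary: \<Gamma>' \<theta> rule: IL_deriv.induct)
  case (axI \<Gamma> A \<Delta>)
  then show ?case by (auto intro: IL_deriv.axI IL_axiom_subst)
next
  case (extI \<Gamma> A \<Delta>)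
  then show ?case by (auto intro: IL_deriv.extI T_subst)
next
  case (orE \<Gamma> \<Delta> A B C)
  show ?case
    by (rule IL_deriv.orE[where A = "subst \<theta> A" and B = "subst \<theta> B"])
      (use orE.IH[OF orE.prems] in auto)
next
  case (impI \<Gamma> A \<Delta> B)
  then show ?case by (fastforce intro!: IL_deriv.impI wf_subst)
next
  case (allI \<rho> \<Gamma> \<Delta> A)
  have "\<rho> # \<Gamma>' \<parallel> subst (up \<theta>) ` shift 0 1 ` \<Delta> \<turnstile> subst (up \<theta>) A"
    by (rule allI.IH) (rule typed_subst_up[OF allI.prems])
  then show ?case by (auto intro!: IL_deriv.allI simp: image_image)
next
  case (allE \<Gamma> \<Delta> \<rho> A t)
  have "\<Gamma>' \<parallel> subst \<theta> ` \<Delta> \<turnstile> inst (subst_tm \<theta> t) (subst (up \<theta>) A)"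
    by (rule IL_deriv.allE[OF _ has_type_subst[OF allE.hyps(2) allE.prems]])
      (use allE.IH[OF allE.prems] in simp)
  then show ?case by (simp only: subst_inst)
next
  case (exI \<rho> \<Gamma> A t \<Delta>)
  then have "\<Gamma>' \<parallel> subst \<theta> ` \<Delta> \<turnstile> inst (subst_tm \<theta> t) (subst (up \<theta>) A)"
    by (simp only: subst_inst)
  then show ?case
    unfolding subst.simps
    by (rule IL_deriv.exI[OF wf_subst[OF exI.hyps(1) typed_subst_up[OF exI.prems]]
        has_type_subst[OF exI.hyps(2) exI.prems]])
next
  case (exE \<Gamma> \<Delta> \<rho> A C)
  have "\<rho> # \<Gamma>' \<parallel> subst (up \<theta>) ` insert A (shift 0 1 ` \<Delta>) \<turnstile> subst (up \<theta>) (shift 0 1 C)"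
    by (rule exE.IH) (rule typed_subst_up[OF exE.prems])
  then have "\<rho> # \<Gamma>' \<parallel> insert (subst (up \<theta>) A) (shift 0 1 ` subst \<theta> ` \<Delta>) \<turnstile> shift 0 1 (subst \<theta> C)"
    by (simp add: image_image)
  moreover have "\<Gamma>' \<parallel> subst \<theta> ` \<Delta> \<turnstile> Ex \<rho> (subst (up \<theta>) A)"
    using exE.IH(1)[OF exE.prems] by simp
  ultimately show ?case
    using wf_subst[OF exE.hyps(3) exE.prems] IL_deriv.exE by blast
next
  case (hyp A \<Delta> \<Gamma>)
  then show ?case by (auto intro: IL_deriv.hyp wf_subst)
next
  case (botE \<Gamma> \<Delta> A)
  then show ?case by (auto intro: IL_deriv.botE wf_subst)
next
  case (orI1 \<Gamma> \<Delta> A B)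
  then show ?case by (auto intro: IL_deriv.orI1 wf_subst)
next
  case (orI2 \<Gamma> \<Delta> B A)
  then show ?case by (auto intro: IL_deriv.orI2 wf_subst)
next
  case (andI \<Gamma> \<Delta> A B)
  then show ?case by (auto intro: IL_deriv.andI)
next
  case (andE1 \<Gamma> \<Delta> A B)
  then show ?case by (metis subst.simps(6) IL_deriv.andE1)
next
  case (andE2 \<Gamma> \<Delta> A B)
  then show ?case by (metis subst.simps(6) IL_deriv.andE2)
next
  case (impE \<Gamma> \<Delta> A B)
  then show ?case by (metis subst.simps(7) IL_deriv.impE)
qed

end

section \<open>Quantifier prefixes and instantiation of whole tuples\<close>

lemma Exs_Nil [simp]: "Exs [] A = A"
  by (simp add: Exs_def)

lemma Exs_Cons [simp]: "Exs (x # xs) A = Exs xs (Ex x A)"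
  by (simp add: Exs_def)

lemma Exs_append: "Exs (xs @ ys) A = Exs ys (Exs xs A)"
  by (simp add: Exs_def)

lemma Alls_Nil [simp]: "Alls [] A = A"
  by (simp add: Alls_def)

lemma Alls_Cons [simp]: "Alls (x # xs) A = Alls xs (All x A)"
  by (simp add: Alls_def)

lemma wf_Exs [simp]: "wf_fm L \<Gamma> (Exs xs A) \<longleftrightarrow> wf_fm L (xs @ \<Gamma>) A"
  by (induction xs arbitrary: A) auto

lemma wf_Alls [simp]: "wf_fm L \<Gamma> (Alls xs A) \<longleftrightarrow> wf_fm L (xs @ \<Gamma>) A"
  by (induction xs arbitrary: A) auto

lemma ex_free_Alls [simp]: "ex_free (Alls xs A) = ex_free A"
  by (induction xs arbitrary: A) auto

text \<open>\<open>n\<close>-fold iteration of \<^const>\<open>up\<close>.\<close>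

definition ups :: "nat \<Rightarrow> (nat \<Rightarrow> 'f tm) \<Rightarrow> nat \<Rightarrow> 'f tm" where
  "ups n \<theta> i = (if i < n then Var i else subst_tm (\<lambda>k. Var (k + n)) (\<theta> (i - n)))"

lemma ups_0 [simp]: "ups 0 \<theta> = \<theta>"
  by (auto simp: ups_def)

lemma up_ups: "up (ups n \<theta>) = ups (Suc n) \<theta>"
proof
  show "up (ups n \<theta>) i = ups (Suc n) \<theta> i" for i by (cases i) (auto simp: ups_def)
qed

lemma subst_Exs [simp]: "subst \<theta> (Exs xs A) = Exs xs (subst (ups (length xs) \<theta>) A)"
  by (induction xs arbitrary: A) (auto simp: up_ups)

lemma subst_Alls [simp]: "subst \<theta> (Alls xs A) = Alls xs (subst (ups (length xs) \<theta>) A)"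
  by (induction xs arbitrary: A) (auto simp: up_ups)

text \<open>Used to instantiate a whole prefix at once; index 0 of \<open>ts\<close> belongs to its
  innermost quantifier.\<close>

definition prepend :: "nat \<Rightarrow> (nat \<Rightarrow> 'f tm) \<Rightarrow> (nat \<Rightarrow> 'f tm) \<Rightarrow> nat \<Rightarrow> 'f tm" where
  "prepend n ts \<theta> i = (if i < n then ts i else \<theta> (i - n))"

lemma prepend_0 [simp]: "prepend 0 ts \<theta> = \<theta>"
  by (auto simp: prepend_def)

lemma typed_subst_prepend:
  "typed_subst L xs \<Gamma>' ts \<Longrightarrow> typed_subst L \<Gamma> \<Gamma>' \<theta> \<Longrightarrow> n = length xs \<Longrightarrow>
   typed_subst L (xs @ \<Gamma>) \<Gamma>' (prepend n ts \<theta>)"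
  unfolding typed_subst_append by (auto simp: typed_subst_def prepend_def)

lemma case_nat_prepend: "case_nat (ts 0) (prepend n (\<lambda>i. ts (Suc i)) \<theta>) = prepend (Suc n) ts \<theta>"
proof
  show "case_nat (ts 0) (prepend n (\<lambda>i. ts (Suc i)) \<theta>) i = prepend (Suc n) ts \<theta> i" for i
    by (cases i) (auto simp: prepend_def)
qed

text \<open>The reason for keeping substitutions pending: supplying a term for the variable bound
  above a substituted body merely extends \<open>\<theta>\<close>, and such extensions can be
  iterated over a tuple.\<close>

lemma inst_up: "inst t (subst (up \<theta>) A) = subst (case_nat t \<theta>) A"
proof -
  have "subst_tm (inst_var t) (up \<theta> i) = case_nat t \<theta> i" for i
    by (cases i) auto
  then show ?thesis by (simp only: subst_subst)
qed

section \<open>Derived rules for quantifiers and tuples\<close>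

context il_theory
begin

lemma cut: "\<Gamma> \<parallel> \<Delta> \<turnstile> A \<Longrightarrow> \<Gamma> \<parallel> insert A \<Delta> \<turnstile> C \<Longrightarrow> \<Gamma> \<parallel> \<Delta> \<turnstile> C"
  using impE impI deriv_wf by blast

lemma hyp_in: "wf_fm L \<Gamma> A \<Longrightarrow> \<Gamma> \<parallel> insert A \<Delta> \<turnstile> A"
  by (rule hyp) auto

lemma deriv_insert: "\<Gamma> \<parallel> \<Delta> \<turnstile> A \<Longrightarrow> \<Gamma> \<parallel> insert B \<Delta> \<turnstile> A"
  by (erule deriv_weaken) auto

lemma deriv_subst_empty:
  "\<Gamma> \<parallel> {} \<turnstile> C \<Longrightarrow> typed_subst L \<Gamma> \<Gamma>' \<theta> \<Longrightarrow> \<Gamma>' \<parallel> \<Delta> \<turnstile> subst \<theta> C"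
  using deriv_subst[of \<Gamma> "{}" C \<Gamma>' \<theta>] by (auto intro: deriv_weaken)

lemma deriv_subst_single:
  assumes "\<Gamma> \<parallel> {H} \<turnstile> C" "typed_subst L \<Gamma> \<Gamma>' \<theta>" "\<Gamma>' \<parallel> \<Delta> \<turnstile> subst \<theta> H"
  shows "\<Gamma>' \<parallel> \<Delta> \<turnstile> subst \<theta> C"
proof -
  have "\<Gamma>' \<parallel> insert (subst \<theta> H) \<Delta> \<turnstile> subst \<theta> C"
    using deriv_subst[OF assms(1,2)] by (auto intro: deriv_weaken)
  with assms(3) show ?thesis by (rule cut)
qed

lemma deriv_trans: "\<Gamma> \<parallel> {H} \<turnstile> C \<Longrightarrow> \<Gamma> \<parallel> \<Delta> \<turnstile> H \<Longrightarrow> \<Gamma> \<parallel> \<Delta> \<turnstile> C"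
  by (rule cut) (auto intro: deriv_weaken)

lemma deriv_shift: "\<Gamma> \<parallel> \<Delta> \<turnstile> A \<Longrightarrow> \<rho> # \<Gamma> \<parallel> shift 0 1 ` \<Delta> \<turnstile> shift 0 1 A"
  using deriv_subst[OF _ typed_subst_shift] by fastforce

lemma imp_iff: "wf_fm L \<Gamma> A \<Longrightarrow> \<Gamma> \<parallel> \<Delta> \<turnstile> Imp A B \<longleftrightarrow> \<Gamma> \<parallel> insert A \<Delta> \<turnstile> B"
  by (meson impI impE deriv_insert hyp_in)

text \<open>The converse of \<open>allI\<close> shifts the derivation into the enlarged context and
  instantiates the shifted quantifier with the new variable, which undoes the shift on the
  body.\<close>

lemma all_iff: "\<Gamma> \<parallel> \<Delta> \<turnstile> All \<rho> A \<longleftrightarrow> \<rho> # \<Gamma> \<parallel> shift 0 1 ` \<Delta> \<turnstile> A"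
proof
  assume "\<Gamma> \<parallel> \<Delta> \<turnstile> All \<rho> A"
  then have "\<rho> # \<Gamma> \<parallel> shift 0 1 ` \<Delta> \<turnstile> All \<rho> (subst (up (\<lambda>i. Var (Suc i))) A)"
    using deriv_shift by fastforce
  then have "\<rho> # \<Gamma> \<parallel> shift 0 1 ` \<Delta> \<turnstile> inst (Var 0) (subst (up (\<lambda>i. Var (Suc i))) A)"
    by (rule allE) simp
  moreover have "case_nat (Var 0) (\<lambda>i. Var (Suc i)) = (Var :: nat \<Rightarrow> 'f tm)"
    by (rule ext) (auto split: nat.splits)
  ultimately show "\<rho> # \<Gamma> \<parallel> shift 0 1 ` \<Delta> \<turnstile> A"
    by (simp only: inst_up subst_Var)
qed (rule allI)

lemma all_subst_E:
  "\<Gamma> \<parallel> \<Delta> \<turnstile> subst \<theta> (All \<rho> A) \<Longrightarrow> has_type L \<Gamma> t \<rho> \<Longrightarrow> \<Gamma> \<parallel> \<Delta> \<turnstile> subst (case_nat t \<theta>) A"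
  using allE[of L T \<Gamma> \<Delta> \<rho> "subst (up \<theta>) A" t] by (simp only: inst_up subst.simps)

lemma ex_subst_I:
  assumes "\<Gamma> \<parallel> \<Delta> \<turnstile> subst (case_nat t \<theta>) A" "has_type L \<Gamma> t \<rho>"
    "wf_fm L (\<rho> # \<Gamma>') A" "typed_subst L \<Gamma>' \<Gamma> \<theta>"
  shows "\<Gamma> \<parallel> \<Delta> \<turnstile> subst \<theta> (Ex \<rho> A)"
  unfolding subst.simps
  by (rule exI[of L \<rho> \<Gamma> _ t]) (use assms in \<open>auto simp only: inst_up intro: wf_subst typed_subst_up\<close>)

text \<open>A prefix lists its innermost quantifier first. The induction therefore uses the tail of
  \<open>ts\<close> for the outer quantifiers and leaves \<open>ts 0\<close> for the innermost
  one.\<close>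

lemma Exs_subst_I:
  assumes "\<Gamma> \<parallel> \<Delta> \<turnstile> subst (prepend n ts \<theta>) A" "typed_subst L xs \<Gamma> ts" "n = length xs"
    "wf_fm L (xs @ \<Gamma>') A" "typed_subst L \<Gamma>' \<Gamma> \<theta>"
  shows "\<Gamma> \<parallel> \<Delta> \<turnstile> subst \<theta> (Exs xs A)"
  using assms
proof (induction xs arbitrary: A n ts)
  case (Cons x xs)
  have "\<Gamma> \<parallel> \<Delta> \<turnstile> subst \<theta> (Exs xs (Ex x A))"
  proof (rule Cons.IH)
    show "\<Gamma> \<parallel> \<Delta> \<turnstile> subst (prepend (length xs) (\<lambda>i. ts (Suc i)) \<theta>) (Ex x A)"
      by (rule ex_subst_I[where \<Gamma>' = "xs @ \<Gamma>'" and t = "ts 0"])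
        (use Cons.prems in \<open>auto simp: case_nat_prepend typed_subst_Cons intro: typed_subst_prepend\<close>)
  qed (use Cons.prems in \<open>auto simp: typed_subst_Cons\<close>)
  then show ?case by (simp only: Exs_Cons)
qed simp

lemma Exs_E:
  assumes "\<Gamma> \<parallel> \<Delta> \<turnstile> Exs xs A"
    "xs @ \<Gamma> \<parallel> insert A (shift 0 (length xs) ` \<Delta>) \<turnstile> shift 0 (length xs) C" "wf_fm L \<Gamma> C"
  shows "\<Gamma> \<parallel> \<Delta> \<turnstile> C"
  using assms
proof (induction xs arbitrary: A)
  case Nil
  then show ?case by (auto intro: cut)
next
  case (Cons x xs)
  show ?case
  proof (rule Cons.IH)
    show "\<Gamma> \<parallel> \<Delta> \<turnstile> Exs xs (Ex x A)" using Cons.prems by simp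
    then have wf: "wf_fm L (xs @ \<Gamma>) (Ex x A)" by (auto dest: deriv_wf)
    \<comment> \<open>The inner elimination still carries the hypothesis \<open>Ex x A\<close>
      introduced by the outer one; weakening absorbs it.\<close>
    have "x # xs @ \<Gamma> \<parallel> insert A (shift 0 1 ` insert (Ex x A) (shift 0 (length xs) ` \<Delta>))
      \<turnstile> shift 0 1 (shift 0 (length xs) C)"
      by (rule deriv_weaken) (use Cons.prems in \<open>auto simp: image_image\<close>)
    then show "xs @ \<Gamma> \<parallel> insert (Ex x A) (shift 0 (length xs) ` \<Delta>) \<turnstile> shift 0 (length xs) C"
      by (rule exE[OF hyp_in[OF wf]])
        (use Cons.prems in \<open>auto intro: wf_subst typed_subst_shift_append\<close>)
  qed fact
qed

text \<open>When the matrix alone implies the goal, no shifted copy of \<open>\<Delta>\<close> has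
  to be carried along.\<close>

lemma Exs_E_single:
  assumes "\<Gamma> \<parallel> \<Delta> \<turnstile> Exs xs A" "xs @ \<Gamma> \<parallel> {A} \<turnstile> shift 0 (length xs) C" "wf_fm L \<Gamma> C"
  shows "\<Gamma> \<parallel> \<Delta> \<turnstile> C"
  by (rule Exs_E[OF assms(1) deriv_weaken[OF assms(2)] assms(3)]) auto

lemma Exs_mono:
  assumes "\<Gamma> \<parallel> \<Delta> \<turnstile> Exs xs A" "xs @ \<Gamma> \<parallel> {A} \<turnstile> B"
  shows "\<Gamma> \<parallel> \<Delta> \<turnstile> Exs xs B"
proof (rule Exs_E_single[OF assms(1)])
  have wf: "wf_fm L (xs @ \<Gamma>) B" using assms(2) by (rule deriv_wf)
  then show "wf_fm L \<Gamma> (Exs xs B)" by simp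
  have eq: "prepend (length xs) Var (\<lambda>i. Var (i + length xs)) = Var"
    by (auto simp: prepend_def)
  show "xs @ \<Gamma> \<parallel> {A} \<turnstile> shift 0 (length xs) (Exs xs B)"
    by (rule Exs_subst_I[where ts = Var and n = "length xs" and \<Gamma>' = \<Gamma>])
      (use assms wf in \<open>simp_all add: eq typed_subst_shift_append\<close>,
       simp add: typed_subst_def nth_append)
qed

lemma Alls_iff: "\<Gamma> \<parallel> \<Delta> \<turnstile> Alls xs A \<longleftrightarrow> xs @ \<Gamma> \<parallel> shift 0 (length xs) ` \<Delta> \<turnstile> A"
  by (induction xs arbitrary: A) (auto simp: all_iff image_image)

lemma Alls_mono:
  assumes "\<Gamma> \<parallel> \<Delta> \<turnstile> Alls xs A" "xs @ \<Gamma> \<parallel> {A} \<turnstile> B"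
  shows "\<Gamma> \<parallel> \<Delta> \<turnstile> Alls xs B"
  using assms deriv_trans by (auto simp: Alls_iff)

lemma Alls_subst_E:
  assumes "\<Gamma> \<parallel> \<Delta> \<turnstile> subst \<theta> (Alls xs A)" "typed_subst L xs \<Gamma> ts" "n = length xs"
  shows "\<Gamma> \<parallel> \<Delta> \<turnstile> subst (prepend n ts \<theta>) A"
  using assms
proof (induction xs arbitrary: A n ts)
  case (Cons x xs)
  have "\<Gamma> \<parallel> \<Delta> \<turnstile> subst (prepend (length xs) (\<lambda>i. ts (Suc i)) \<theta>) (All x A)"
    by (rule Cons.IH) (use Cons.prems in \<open>auto simp: typed_subst_Cons\<close>)
  from all_subst_E[OF this, of "ts 0"] show ?case
    using Cons.prems by (simp add: case_nat_prepend typed_subst_Cons)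
qed simp

lemma bex_iff: 
  assumes "wf_fm L \<Gamma> (BEx \<rho> t A)"
  shows "\<Gamma> \<parallel> \<Delta> \<turnstile> BEx \<rho> t A \<longleftrightarrow> \<Gamma> \<parallel> \<Delta> \<turnstile> Ex \<rho> (And (Mem \<rho> (Var 0) (shift_tm 0 1 t)) A)"
  by (meson axI[OF bex[OF assms]] andE1 andE2 impE)

lemma ball_iff: 
  assumes "wf_fm L \<Gamma> (BAll \<rho> t A)"
  shows "\<Gamma> \<parallel> \<Delta> \<turnstile> BAll \<rho> t A \<longleftrightarrow> \<Gamma> \<parallel> \<Delta> \<turnstile> All \<rho> (Imp (Mem \<rho> (Var 0) (shift_tm 0 1 t)) A)"
  by (meson axI[OF ball[OF assms]] andE1 andE2 impE)

lemma bex_E: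
  assumes "\<Gamma> \<parallel> \<Delta> \<turnstile> BEx \<rho> t A"
    "\<rho> # \<Gamma> \<parallel> insert (Mem \<rho> (Var 0) (shift_tm 0 1 t)) (insert A (shift 0 1 ` \<Delta>)) \<turnstile> shift 0 1 C"
    "wf_fm L \<Gamma> C"
  shows "\<Gamma> \<parallel> \<Delta> \<turnstile> C"
proof (rule exE)
  let ?M = "Mem \<rho> (Var 0) (shift_tm 0 1 t)" 
  have wf: "wf_fm L \<Gamma> (BEx \<rho> t A)" using assms(1) by (rule deriv_wf)
  then show ex: "\<Gamma> \<parallel> \<Delta> \<turnstile> Ex \<rho> (And ?M A)"
    using assms(1) bex_iff by blast
  let ?\<Delta> = "insert (And ?M A) (shift 0 1 ` \<Delta>)"
  have and_hyp: "\<rho> # \<Gamma> \<parallel> ?\<Delta> \<turnstile> And ?M A"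
    using deriv_wf[OF ex] by (simp add: hyp_in)
  have "\<rho> # \<Gamma> \<parallel> insert ?M (insert A ?\<Delta>) \<turnstile> shift 0 1 C"
    by (rule deriv_weaken[OF assms(2)]) auto
  then show "\<rho> # \<Gamma> \<parallel> ?\<Delta> \<turnstile> shift 0 1 C"
    by (meson and_hyp andE1 andE2 cut deriv_insert)
qed fact

lemma bex_subst_I:
  assumes "\<Gamma> \<parallel> \<Delta> \<turnstile> Mem \<rho> s (subst_tm \<theta> t)" "\<Gamma> \<parallel> \<Delta> \<turnstile> subst (case_nat s \<theta>) A"
    "wf_fm L \<Gamma>' (BEx \<rho> t A)" "typed_subst L \<Gamma>' \<Gamma> \<theta>"
  shows "\<Gamma> \<parallel> \<Delta> \<turnstile> subst \<theta> (BEx \<rho> t A)"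
proof -
  let ?M = "Mem \<rho> (Var 0) (subst_tm (\<lambda>i. Var (Suc i)) t)" 
  have "has_type L \<Gamma> s \<rho>" using deriv_wf[OF assms(1)] by simp
  moreover have "subst_tm (\<lambda>i. case_nat s \<theta> (Suc i)) t = subst_tm \<theta> t" by simp
  ultimately have "\<Gamma> \<parallel> \<Delta> \<turnstile> subst \<theta> (Ex \<rho> (And ?M A))"
    using assms by (intro ex_subst_I[where t = s and \<Gamma>' = \<Gamma>']) (auto intro: andI has_type_shift)
  moreover have "wf_fm L \<Gamma> (BEx \<rho> (subst_tm \<theta> t) (subst (up \<theta>) A))"
    using wf_subst[OF assms(3,4)] by simp
  ultimately show ?thesis by (simp add: bex_iff)
qed

lemma ball_subst_E:
  assumes "\<Gamma> \<parallel> \<Delta> \<turnstile> subst \<theta> (BAll \<rho> t A)" "\<Gamma> \<parallel> \<Delta> \<turnstile> Mem \<rho> s (subst_tm \<theta> t)"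
  shows "\<Gamma> \<parallel> \<Delta> \<turnstile> subst (case_nat s \<theta>) A"
proof -
  let ?M = "Mem \<rho> (Var 0) (subst_tm (\<lambda>i. Var (Suc i)) t)" 
  have "\<Gamma> \<parallel> \<Delta> \<turnstile> subst \<theta> (All \<rho> (Imp ?M A))"
    using assms(1) ball_iff deriv_wf[OF assms(1)] by simp
  from all_subst_E[OF this, of s] deriv_wf[OF assms(2)]
  have "\<Gamma> \<parallel> \<Delta> \<turnstile> Imp (Mem \<rho> s (subst_tm \<theta> t)) (subst (case_nat s \<theta>) A)" by simp
  then show ?thesis using assms(2) by (rule impE)
qed

lemma ball_I:
  assumes "\<rho> # \<Gamma> \<parallel> insert (Mem \<rho> (Var 0) (shift_tm 0 1 t)) (shift 0 1 ` \<Delta>) \<turnstile> A"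
    "has_type L \<Gamma> t (Star \<rho>)"
  shows "\<Gamma> \<parallel> \<Delta> \<turnstile> BAll \<rho> t A"
proof -
  have "wf_fm L \<Gamma> (BAll \<rho> t A)" using assms deriv_wf by auto
  then show ?thesis
    using assms by (simp add: ball_iff all_iff imp_iff has_type_shift)
qed

end

section \<open>Pointwise inclusion and collection\<close>

text \<open>
  Pointwise inclusion at the types \<open>\<rho>\<^sub>1 \<rightarrow> \<dots> \<rightarrow> \<rho>\<^sub>k \<rightarrow> \<sigma>*\<close> of witnesses. The clause for \<^const>\<open>G\<close> is only
  there to make the relation reflexive at all types.
\<close>

primrec Sub :: "ty \<Rightarrow> 'f tm \<Rightarrow> 'f tm \<Rightarrow> ('f, 'r) fm" where
  "Sub G t u = Eq G t u"
| "Sub (\<sigma> \<rightarrow> \<tau>) t u = All \<sigma> (Sub \<tau> (shift_tm 0 1 t \<bullet> Var 0) (shift_tm 0 1 u \<bullet> Var 0))"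
| "Sub (Star \<sigma>) t u =
     All \<sigma> (Imp (Mem \<sigma> (Var 0) (shift_tm 0 1 t)) (Mem \<sigma> (Var 0) (shift_tm 0 1 u)))"

lemma subst_Sub [simp]: "subst \<theta> (Sub \<tau> t u) = Sub \<tau> (subst_tm \<theta> t) (subst_tm \<theta> u)"
  by (induction \<tau> arbitrary: \<theta> t u) auto

text \<open>The types of the witnesses: after enough arguments a star type is reached, where unions
  can be formed.\<close>

primrec end_star :: "ty \<Rightarrow> bool" where
  "end_star G \<longleftrightarrow> False"
| "end_star (\<sigma> \<rightarrow> \<tau>) \<longleftrightarrow> end_star \<tau>"
| "end_star (Star \<sigma>) \<longleftrightarrow> True"

lemma has_type_App: "has_type L \<Gamma> t (\<sigma> \<rightarrow> \<tau>) \<Longrightarrow> has_type L \<Gamma> u \<sigma> \<Longrightarrow> has_type L \<Gamma> (t \<bullet> u) \<tau>"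
  by auto

section \<open>Equality, inclusion, and pointwise unions\<close>

context il_theory
begin

lemma eq_rewrite:
  assumes "\<Gamma> \<parallel> \<Delta> \<turnstile> Eq \<rho> x y" "\<Gamma> \<parallel> \<Delta> \<turnstile> inst x A" "atomic A" "wf_fm L (\<rho> # \<Gamma>) A"
  shows "\<Gamma> \<parallel> \<Delta> \<turnstile> inst y A"
  using impE[OF axI[OF eq_subst] andI] assms deriv_wf[OF assms(1)] by auto

lemma eq_sym: assumes "\<Gamma> \<parallel> \<Delta> \<turnstile> Eq \<rho> x y" shows "\<Gamma> \<parallel> \<Delta> \<turnstile> Eq \<rho> y x"
  using eq_rewrite[OF assms, of "Eq \<rho> (Var 0) (shift_tm 0 1 x)"] deriv_wf[OF assms]
  by (auto intro: axI eq_refl has_type_shift)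

lemma eq_trans:
  assumes "\<Gamma> \<parallel> \<Delta> \<turnstile> Eq \<rho> x y" "\<Gamma> \<parallel> \<Delta> \<turnstile> Eq \<rho> y z"
  shows "\<Gamma> \<parallel> \<Delta> \<turnstile> Eq \<rho> x z"
  using eq_rewrite[OF assms(2), of "Eq \<rho> (shift_tm 0 1 x) (Var 0)"] assms deriv_wf[OF assms(1)]
  by (auto intro: has_type_shift)

lemma eq_app:
  assumes "\<Gamma> \<parallel> \<Delta> \<turnstile> Eq (\<sigma> \<rightarrow> \<tau>) t t'" "\<Gamma> \<parallel> \<Delta> \<turnstile> Eq \<sigma> u u'"
  shows "\<Gamma> \<parallel> \<Delta> \<turnstile> Eq \<tau> (t \<bullet> u) (t' \<bullet> u')"
proof -
  have types: "has_type L \<Gamma> t (\<sigma> \<rightarrow> \<tau>)" "has_type L \<Gamma> t' (\<sigma> \<rightarrow> \<tau>)"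
    "has_type L \<Gamma> u \<sigma>" "has_type L \<Gamma> u' \<sigma>"
    using assms[THEN deriv_wf] by auto
  have "\<Gamma> \<parallel> \<Delta> \<turnstile> Eq \<tau> (t \<bullet> u) (t \<bullet> u)"
    using types by (intro axI eq_refl has_type_App)
  with assms(1) have "\<Gamma> \<parallel> \<Delta> \<turnstile> Eq \<tau> (t \<bullet> u) (t' \<bullet> u)"
    using eq_rewrite[OF assms(1), of "Eq \<tau> (shift_tm 0 1 (t \<bullet> u)) (Var 0 \<bullet> shift_tm 0 1 u)"] types
    by (auto intro: has_type_shift)
  then show ?thesis
    using eq_rewrite[OF assms(2), of "Eq \<tau> (shift_tm 0 1 (t \<bullet> u)) (shift_tm 0 1 t' \<bullet> Var 0)"] types
    by (auto intro: has_type_shift)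
qed

lemma mem_eq:
  assumes "\<Gamma> \<parallel> \<Delta> \<turnstile> Mem \<sigma> w t" "\<Gamma> \<parallel> \<Delta> \<turnstile> Eq (Star \<sigma>) t t'"
  shows "\<Gamma> \<parallel> \<Delta> \<turnstile> Mem \<sigma> w t'"
  using eq_rewrite[OF assms(2), of "Mem \<sigma> (shift_tm 0 1 w) (Var 0)"] assms deriv_wf[OF assms(1)]
  by (auto intro: has_type_shift)

lemma eq_refl': "has_type L \<Gamma> t \<rho> \<Longrightarrow> \<Gamma> \<parallel> \<Delta> \<turnstile> Eq \<rho> t t"
  by (intro axI eq_refl)

lemma deriv_shift_eq:
  "\<Gamma> \<parallel> \<Delta> \<turnstile> Eq \<tau> t u \<Longrightarrow> \<rho> # \<Gamma> \<parallel> shift 0 1 ` \<Delta> \<turnstile> Eq \<tau> (shift_tm 0 1 t) (shift_tm 0 1 u)"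
  using deriv_shift by fastforce

lemma Sub_refl: "has_type L \<Gamma> t \<tau> \<Longrightarrow> \<Gamma> \<parallel> \<Delta> \<turnstile> Sub \<tau> t t"
proof (induction \<tau> arbitrary: \<Gamma> \<Delta> t)
  case (Fun \<sigma> \<tau>)
  have "has_type L (\<sigma> # \<Gamma>) (shift_tm 0 1 t \<bullet> Var 0) \<tau>"
    using has_type_shift[OF Fun.prems] by auto
  then show ?case using Fun.IH(2) by (simp add: all_iff)
next
  case (Star \<sigma>)
  then show ?case by (simp add: all_iff imp_iff hyp_in has_type_shift)
qed (simp add: eq_refl')

lemma Sub_app:
  assumes "\<Gamma> \<parallel> \<Delta> \<turnstile> Sub (\<sigma> \<rightarrow> \<tau>) t u" "has_type L \<Gamma> s \<sigma>"
  shows "\<Gamma> \<parallel> \<Delta> \<turnstile> Sub \<tau> (t \<bullet> s) (u \<bullet> s)"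
  using allE[OF assms(1)[unfolded Sub.simps] assms(2)] by simp

lemma Sub_mem:
  assumes "\<Gamma> \<parallel> \<Delta> \<turnstile> Sub (Star \<sigma>) t u" "\<Gamma> \<parallel> \<Delta> \<turnstile> Mem \<sigma> s t"
  shows "\<Gamma> \<parallel> \<Delta> \<turnstile> Mem \<sigma> s u"
  using allE[OF assms(1)[unfolded Sub.simps], of s] deriv_wf[OF assms(2)] assms(2)
  by (auto intro: impE)

text \<open>\<open>Sub\<close> is not atomic in general, so \<open>eq_rewrite\<close> does not apply
  to it. The equation is carried through applications by \<open>eq_app\<close> until it meets an
  equation at \<open>G\<close> or a membership at a star type.\<close>

lemma Sub_eq_right:
  assumes "\<Gamma> \<parallel> \<Delta> \<turnstile> Sub \<tau> r t" "\<Gamma> \<parallel> \<Delta> \<turnstile> Eq \<tau> t t'"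
  shows "\<Gamma> \<parallel> \<Delta> \<turnstile> Sub \<tau> r t'"
  using assms
proof (induction \<tau> arbitrary: \<Gamma> \<Delta> r t t')
  case G
  then show ?case using eq_trans by auto
next
  case (Fun \<sigma> \<tau>)
  have "\<sigma> # \<Gamma> \<parallel> shift 0 1 ` \<Delta> \<turnstile> Eq \<tau> (shift_tm 0 1 t \<bullet> Var 0) (shift_tm 0 1 t' \<bullet> Var 0)"
    by (rule eq_app[OF deriv_shift_eq[OF Fun.prems(2)]]) (simp add: eq_refl')
  then show ?case
    using Fun.prems(1) Fun.IH(2) by (simp add: all_iff)
next
  case (Star \<sigma>)
  let ?M = "Mem \<sigma> (Var 0) (shift_tm 0 1 r)"
  have wf: "wf_fm L (\<sigma> # \<Gamma>) ?M" using deriv_wf[OF Star.prems(1)] by simp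
  then have "\<sigma> # \<Gamma> \<parallel> insert ?M (shift 0 1 ` \<Delta>) \<turnstile> Mem \<sigma> (Var 0) (shift_tm 0 1 t)"
    using Star.prems(1) by (simp add: all_iff imp_iff)
  then have "\<sigma> # \<Gamma> \<parallel> insert ?M (shift 0 1 ` \<Delta>) \<turnstile> Mem \<sigma> (Var 0) (shift_tm 0 1 t')"
    by (rule mem_eq) (rule deriv_insert[OF deriv_shift_eq[OF Star.prems(2)]])
  then show ?case using wf by (simp add: all_iff imp_iff)
qed

text \<open>Combinatory completeness: \<open>u\<close> is \<open>\<lambda>x\<^sup>\<rho>. t\<close>.\<close>

lemma abstraction:
  "has_type L (\<rho> # \<Gamma>) t \<tau> \<Longrightarrow>
   \<exists>u. has_type L \<Gamma> u (\<rho> \<rightarrow> \<tau>) \<and> \<rho> # \<Gamma> \<parallel> {} \<turnstile> Eq \<tau> (shift_tm 0 1 u \<bullet> Var 0) t"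
proof (induction t arbitrary: \<tau>)
  case (Var i)
  show ?case
  proof (cases i)
    case 0
    \<comment> \<open>The identity at type \<open>\<rho>\<close> is
      \<open>\<Sigma>\<Pi>\<Pi>\<close>, with the two copies of \<open>\<Pi>\<close> at different
      types.\<close>
    let ?K1 = "Con (PiC \<rho> (\<rho> \<rightarrow> \<rho>)) :: 'f tm" and ?K2 = "Con (PiC \<rho> \<rho>) :: 'f tm"
    let ?u = "Con (SigmaC \<rho> (\<rho> \<rightarrow> \<rho>) \<rho>) \<bullet> ?K1 \<bullet> ?K2"
    have \<tau>: "\<tau> = \<rho>" using Var 0 by simp
    have "\<rho> # \<Gamma> \<parallel> {} \<turnstile> Eq \<rho> (?u \<bullet> Var 0) (?K1 \<bullet> Var 0 \<bullet> (?K2 \<bullet> Var 0))"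
      by (rule axI[OF sigma]) auto
    moreover have "\<rho> # \<Gamma> \<parallel> {} \<turnstile> Eq \<rho> (?K1 \<bullet> Var 0 \<bullet> (?K2 \<bullet> Var 0)) (Var 0)"
      by (rule axI[OF pi]) auto
    ultimately have "\<rho> # \<Gamma> \<parallel> {} \<turnstile> Eq \<rho> (?u \<bullet> Var 0) (Var 0)" by (rule eq_trans)
    then show ?thesis using \<tau> 0 by (intro HOL.exI[of _ ?u]) auto
  next
    case (Suc j)
    \<comment> \<open>Any other variable gives a constant function; outside the scope of the
      abstracted variable its index drops to \<open>j\<close>.\<close>
    have "\<rho> # \<Gamma> \<parallel> {} \<turnstile> Eq \<tau> (Con (PiC \<tau> \<rho>) \<bullet> Var (Suc j) \<bullet> Var 0) (Var (Suc j))"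
      using Var Suc by (intro axI[OF pi]) auto
    then show ?thesis
      using Var Suc by (intro HOL.exI[of _ "Con (PiC \<tau> \<rho>) \<bullet> Var j"]) auto
  qed
next
  case (Con c)
  have "\<rho> # \<Gamma> \<parallel> {} \<turnstile> Eq \<tau> (Con (PiC \<tau> \<rho>) \<bullet> Con c \<bullet> Var 0) (Con c)"
    using Con by (intro axI[OF pi]) auto
  then show ?case
    using Con by (intro HOL.exI[of _ "Con (PiC \<tau> \<rho>) \<bullet> Con c"]) auto
next
  case (App t1 t2)
  then obtain \<sigma> where \<sigma>: "has_type L (\<rho> # \<Gamma>) t1 (\<sigma> \<rightarrow> \<tau>)" "has_type L (\<rho> # \<Gamma>) t2 \<sigma>" by auto
  from App.IH(1)[OF \<sigma>(1)] obtain u1 where u1: "has_type L \<Gamma> u1 (\<rho> \<rightarrow> \<sigma> \<rightarrow> \<tau>)"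
    "\<rho> # \<Gamma> \<parallel> {} \<turnstile> Eq (\<sigma> \<rightarrow> \<tau>) (shift_tm 0 1 u1 \<bullet> Var 0) t1" by auto
  from App.IH(2)[OF \<sigma>(2)] obtain u2 where u2: "has_type L \<Gamma> u2 (\<rho> \<rightarrow> \<sigma>)"
    "\<rho> # \<Gamma> \<parallel> {} \<turnstile> Eq \<sigma> (shift_tm 0 1 u2 \<bullet> Var 0) t2" by auto
  \<comment> \<open>\<open>\<Sigma>\<close> distributes the argument to both parts of an
    application.\<close>
  let ?u = "Con (SigmaC \<rho> \<sigma> \<tau>) \<bullet> u1 \<bullet> u2"
  have "\<rho> # \<Gamma> \<parallel> {} \<turnstile> Eq \<tau> (shift_tm 0 1 ?u \<bullet> Var 0)
      (shift_tm 0 1 u1 \<bullet> Var 0 \<bullet> (shift_tm 0 1 u2 \<bullet> Var 0))"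
    using axI[OF sigma[of L "\<rho> # \<Gamma>" "shift_tm 0 1 u1" \<rho> \<sigma> \<tau> "shift_tm 0 1 u2" "Var 0"]] u1 u2
    by (simp add: has_type_shift)
  then have "\<rho> # \<Gamma> \<parallel> {} \<turnstile> Eq \<tau> (shift_tm 0 1 ?u \<bullet> Var 0) (t1 \<bullet> t2)"
    by (rule eq_trans) (rule eq_app[OF u1(2) u2(2)])
  moreover have "has_type L \<Gamma> ?u (\<rho> \<rightarrow> \<tau>)" using u1 u2 by auto
  ultimately show ?case by (intro HOL.exI[of _ ?u] conjI)
qed

text \<open>
  \<open>c\<close> is the pointwise union of the \<open>t\<close> over all \<open>x \<in> w\<close>, where \<open>x\<close> is variable \<open>0\<close> of \<open>t\<close>.
\<close>

lemma collection:
  "has_type L \<Gamma> w (Star \<rho>) \<Longrightarrow> has_type L (\<rho> # \<Gamma>) t \<tau> \<Longrightarrow> end_star \<tau> \<Longrightarrow>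
   \<exists>c. has_type L \<Gamma> c \<tau> \<and>
     \<rho> # \<Gamma> \<parallel> {Mem \<rho> (Var 0) (shift_tm 0 1 w)} \<turnstile> Sub \<tau> t (shift_tm 0 1 c)"
proof (induction \<tau> arbitrary: \<Gamma> w t)
  case (Fun \<sigma> \<tau>)
  \<comment> \<open>A fresh argument of type \<open>\<sigma>\<close> is inserted behind
    \<open>x\<close> and \<open>t\<close> is applied to it; the hypothesis for \<open>\<tau>\<close>
    is then used in the context extended by this argument.\<close>
  let ?S = "shift_tm 0 1" and ?t = "shift_tm 1 1 t \<bullet> Var 1"
  have "typed_subst L (\<rho> # \<Gamma>) (\<rho> # \<sigma> # \<Gamma>) (shift_var 1 1)"
    by (auto simp: typed_subst_Cons shift_var_def) (auto simp: typed_subst_def)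
  from has_type_subst[OF Fun.prems(2) this] have "has_type L (\<rho> # \<sigma> # \<Gamma>) ?t \<tau>" by auto
  moreover have "has_type L (\<sigma> # \<Gamma>) (?S w) (Star \<rho>)"
    using has_type_shift[OF Fun.prems(1)] by simp
  moreover have "end_star \<tau>" using Fun.prems(3) by simp
  ultimately obtain c where c: "has_type L (\<sigma> # \<Gamma>) c \<tau>"
    "\<rho> # \<sigma> # \<Gamma> \<parallel> {Mem \<rho> (Var 0) (?S (?S w))} \<turnstile> Sub \<tau> ?t (?S c)"
    using Fun.IH(2) by metis
  from abstraction[OF c(1)] obtain u where u: "has_type L \<Gamma> u (\<sigma> \<rightarrow> \<tau>)"
    "\<sigma> # \<Gamma> \<parallel> {} \<turnstile> Eq \<tau> (?S u \<bullet> Var 0) c" by auto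
  \<comment> \<open>\<open>Sub\<close> at \<open>\<sigma> \<rightarrow> \<tau>\<close> binds its
    argument in front of \<open>x\<close>, whereas the induction hypothesis has \<open>x\<close> in
    front; \<open>\<pi>\<close> swaps the two.\<close>
  define \<pi> :: "nat \<Rightarrow> 'f tm" where "\<pi> = case_nat (Var 1) (case_nat (Var 0) (\<lambda>i. Var (i + 2)))"
  have \<pi>: "typed_subst L (\<rho> # \<sigma> # \<Gamma>) (\<sigma> # \<rho> # \<Gamma>) \<pi>"
    by (auto simp: typed_subst_Cons \<pi>_def) (auto simp: typed_subst_def)
  have eq1: "subst_tm \<pi> (shift_var (Suc 0) (Suc 0) i) = Var (Suc i)" for i
    by (cases i) (simp_all add: \<pi>_def shift_var_def)
  have \<pi>_simps: "\<pi> 0 = Var 1" "\<pi> (Suc 0) = Var 0" "\<pi> (Suc (Suc i)) = Var (Suc (Suc i))" for i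
    by (auto simp: \<pi>_def)
  have "\<sigma> # \<rho> # \<Gamma> \<parallel> {Mem \<rho> (Var 1) (?S (?S w))} \<turnstile> Sub \<tau> (?S t \<bullet> Var 0) (subst_tm (\<lambda>i. \<pi> (Suc i)) c)"
    using deriv_subst[OF c(2) \<pi>] by (simp add: eq1 \<pi>_simps)
  moreover have "\<sigma> # \<rho> # \<Gamma> \<parallel> {Mem \<rho> (Var 1) (?S (?S w))} \<turnstile> Eq \<tau> (subst_tm (\<lambda>i. \<pi> (Suc i)) c) (?S (?S u) \<bullet> Var 0)"
  proof -
    have "typed_subst L (\<sigma> # \<Gamma>) (\<sigma> # \<rho> # \<Gamma>) (\<lambda>i. \<pi> (Suc i))"
      using \<pi> by (simp add: typed_subst_Cons)
    from deriv_subst_empty[OF u(2) this] show ?thesis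
      by - (rule eq_sym, simp add: \<pi>_simps)
  qed
  ultimately have "\<sigma> # \<rho> # \<Gamma> \<parallel> {Mem \<rho> (Var 1) (?S (?S w))} \<turnstile> Sub \<tau> (?S t \<bullet> Var 0) (?S (?S u) \<bullet> Var 0)"
    by (rule Sub_eq_right)
  then show ?case using u(1) by (intro HOL.exI[of _ u]) (simp add: all_iff)
next
  case (Star \<sigma>)
  let ?S = "shift_tm 0 1"
  from abstraction[OF Star.prems(2)] obtain u where u: "has_type L \<Gamma> u (\<rho> \<rightarrow> Star \<sigma>)"
    "\<rho> # \<Gamma> \<parallel> {} \<turnstile> Eq (Star \<sigma>) (?S u \<bullet> Var 0) t" by auto
  \<comment> \<open>With \<open>u\<close> the abstraction of \<open>t\<close> over \<open>x\<close>,
    this is the union of all \<open>u x\<close> with \<open>x \<in> w\<close>.\<close>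
  let ?c = "Con (BigUnC \<rho> \<sigma>) \<bullet> w \<bullet> u"
  let ?\<Delta> = "{Mem \<sigma> (Var 0) (?S t), Mem \<rho> (Var 1) (?S (?S w))}"
  have types: "has_type L (\<sigma> # \<rho> # \<Gamma>) (?S t) (Star \<sigma>)" "has_type L (\<sigma> # \<rho> # \<Gamma>) (?S (?S w)) (Star \<rho>)"
    "has_type L (\<sigma> # \<rho> # \<Gamma>) (?S (?S u)) (\<rho> \<rightarrow> Star \<sigma>)"
    using Star.prems u(1) by (simp_all only: shift_var_0 has_type_shift add_0_right One_nat_def add_Suc_right)
  have "\<sigma> # \<rho> # \<Gamma> \<parallel> ?\<Delta> \<turnstile> Eq (Star \<sigma>) (?S t) (?S (?S u) \<bullet> Var 1)"
    by (rule eq_sym) (use deriv_weaken[OF deriv_shift[OF u(2), of \<sigma>], of ?\<Delta>] in simp)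
  then have "\<sigma> # \<rho> # \<Gamma> \<parallel> ?\<Delta> \<turnstile> Mem \<sigma> (Var 0) (?S (?S u) \<bullet> Var 1)"
    by (rule mem_eq[rotated]) (use types in \<open>simp add: hyp\<close>)
  moreover have "\<sigma> # \<rho> # \<Gamma> \<parallel> ?\<Delta> \<turnstile> Mem \<rho> (Var 1) (?S (?S w))"
    by (rule hyp) (use types in simp_all)
  ultimately have "\<sigma> # \<rho> # \<Gamma> \<parallel> ?\<Delta> \<turnstile> And (Mem \<rho> (Var 1) (?S (?S w))) (Mem \<sigma> (Var 0) (?S (?S u) \<bullet> Var 1))"
    by (rule andI[rotated])
  moreover have "IL_axiom L (\<sigma> # \<rho> # \<Gamma>) (Imp (And (Mem \<rho> (Var 1) (?S (?S w)))
      (Mem \<sigma> (Var 0) (?S (?S u) \<bullet> Var 1))) (Mem \<sigma> (Var 0) (?S (?S ?c))))"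
    unfolding subst_tm.simps using types by (intro bigun) auto
  ultimately have "\<sigma> # \<rho> # \<Gamma> \<parallel> ?\<Delta> \<turnstile> Mem \<sigma> (Var 0) (?S (?S ?c))"
    using impE axI by blast
  then have "\<rho> # \<Gamma> \<parallel> {Mem \<rho> (Var 0) (?S w)} \<turnstile> Sub (Star \<sigma>) t (?S ?c)"
    using types by (simp add: all_iff imp_iff)
  moreover have "has_type L \<Gamma> ?c (Star \<sigma>)" using Star.prems u(1) by auto
  ultimately show ?case by (intro HOL.exI[of _ ?c] conjI)
qed simp

text \<open>By closure under substitution, \<open>x\<close> may become any term \<open>s\<close>
  known to be in \<open>w\<close>, and \<open>\<theta>\<close> moves the situation into any context;
  this is the form needed under further binders.\<close>

lemma collectionE:
  assumes "has_type L \<Gamma> w (Star \<rho>)" "has_type L (\<rho> # \<Gamma>) t \<tau>" "end_star \<tau>"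
  obtains c where "has_type L \<Gamma> c \<tau>"
    "\<And>\<Gamma>' \<Delta> \<theta> s. typed_subst L \<Gamma> \<Gamma>' \<theta> \<Longrightarrow> \<Gamma>' \<parallel> \<Delta> \<turnstile> Mem \<rho> s (subst_tm \<theta> w) \<Longrightarrow>
       \<Gamma>' \<parallel> \<Delta> \<turnstile> Sub \<tau> (subst_tm (case_nat s \<theta>) t) (subst_tm \<theta> c)"
proof -
  from collection[OF assms] obtain c where c: "has_type L \<Gamma> c \<tau>"
    "\<rho> # \<Gamma> \<parallel> {Mem \<rho> (Var 0) (shift_tm 0 1 w)} \<turnstile> Sub \<tau> t (shift_tm 0 1 c)" by auto
  have "\<Gamma>' \<parallel> \<Delta> \<turnstile> Sub \<tau> (subst_tm (case_nat s \<theta>) t) (subst_tm \<theta> c)"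
    if "typed_subst L \<Gamma> \<Gamma>' \<theta>" "\<Gamma>' \<parallel> \<Delta> \<turnstile> Mem \<rho> s (subst_tm \<theta> w)" for \<Gamma>' \<Delta> \<theta> s
    using deriv_subst_single[OF c(2), of \<Gamma>' "case_nat s \<theta>" \<Delta>] that deriv_wf[OF that(2)]
    by (simp add: typed_subst_Cons)
  then show thesis by (rule that[OF c(1)])
qed

end

section \<open>Monotonicity\<close>

context il_theory
begin

text \<open>\<open>I\<close> holds the indices whose values may grow. Elsewhere the substitutions
  agree syntactically, so a formula without variables from \<open>I\<close> has literally the same
  instance on both sides and may stand in a premise.\<close>

definition sub_related ::
  "nat set \<Rightarrow> ty list \<Rightarrow> ty list \<Rightarrow> ('f, 'r) fm set \<Rightarrow> (nat \<Rightarrow> 'f tm) \<Rightarrow> (nat \<Rightarrow> 'f tm) \<Rightarrow> bool" where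
  "sub_related I \<Gamma> \<Gamma>' \<Delta> \<theta> \<theta>' \<longleftrightarrow> typed_subst L \<Gamma> \<Gamma>' \<theta> \<and> typed_subst L \<Gamma> \<Gamma>' \<theta>' \<and>
     (\<forall>i. i \<notin> I \<longrightarrow> \<theta> i = \<theta>' i) \<and> (\<forall>i < length \<Gamma>. \<Gamma>' \<parallel> \<Delta> \<turnstile> Sub (\<Gamma> ! i) (\<theta> i) (\<theta>' i))"

text \<open>A substitute for the syntactic notion of positive occurrence. Ranging over all contexts
  and assumptions lets it pass under binders, under hypotheses added by case distinctions, and
  through further substitutions.\<close>

definition mono_at :: "nat set \<Rightarrow> ty list \<Rightarrow> ('f, 'r) fm \<Rightarrow> bool" where
  "mono_at I \<Gamma> A \<longleftrightarrow> (\<forall>\<Gamma>' \<Delta> \<theta> \<theta>'. sub_related I \<Gamma> \<Gamma>' \<Delta> \<theta> \<theta>' \<longrightarrow>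
     \<Gamma>' \<parallel> \<Delta> \<turnstile> subst \<theta> A \<longrightarrow> \<Gamma>' \<parallel> \<Delta> \<turnstile> subst \<theta>' A)"

lemma mono_atI:
  "(\<And>\<Gamma>' \<Delta> \<theta> \<theta>'. sub_related I \<Gamma> \<Gamma>' \<Delta> \<theta> \<theta>' \<Longrightarrow> \<Gamma>' \<parallel> \<Delta> \<turnstile> subst \<theta> A \<Longrightarrow> \<Gamma>' \<parallel> \<Delta> \<turnstile> subst \<theta>' A) \<Longrightarrow>
   mono_at I \<Gamma> A"
  by (simp add: mono_at_def)

lemma mono_atD:
  "mono_at I \<Gamma> A \<Longrightarrow> sub_related I \<Gamma> \<Gamma>' \<Delta> \<theta> \<theta>' \<Longrightarrow> \<Gamma>' \<parallel> \<Delta> \<turnstile> subst \<theta> A \<Longrightarrow> \<Gamma>' \<parallel> \<Delta> \<turnstile> subst \<theta>' A"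
  by (auto simp: mono_at_def)

text \<open>Outside \<open>I\<close> both substitutions agree and reflexivity of \<open>Sub\<close>
  applies, so inclusion has to be checked on \<open>I\<close> only.\<close>

lemma sub_relatedI:
  assumes "typed_subst L \<Gamma> \<Gamma>' \<theta>" "typed_subst L \<Gamma> \<Gamma>' \<theta>'" "\<And>i. i \<notin> I \<Longrightarrow> \<theta> i = \<theta>' i"
    "\<And>i. i < length \<Gamma> \<Longrightarrow> i \<in> I \<Longrightarrow> \<Gamma>' \<parallel> \<Delta> \<turnstile> Sub (\<Gamma> ! i) (\<theta> i) (\<theta>' i)"
  shows "sub_related I \<Gamma> \<Gamma>' \<Delta> \<theta> \<theta>'"
proof -
  have "\<Gamma>' \<parallel> \<Delta> \<turnstile> Sub (\<Gamma> ! i) (\<theta> i) (\<theta>' i)" if "i < length \<Gamma>" for i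
  proof (cases "i \<in> I")
    case False
    then show ?thesis
      using Sub_refl[of \<Gamma>' "\<theta>' i" "\<Gamma> ! i" \<Delta>] that assms(2) assms(3)[of i] by (simp add: typed_subst_def)
  qed (use that assms(4) in simp)
  then show ?thesis using assms(1-3) by (auto simp: sub_related_def)
qed

lemma sub_related_weaken:
  "sub_related I \<Gamma> \<Gamma>' \<Delta> \<theta> \<theta>' \<Longrightarrow> \<Delta> \<subseteq> \<Delta>' \<Longrightarrow> sub_related I \<Gamma> \<Gamma>' \<Delta>' \<theta> \<theta>'"
  by (auto simp: sub_related_def intro: deriv_weaken)

lemma sub_related_up:
  assumes "sub_related I \<Gamma> \<Gamma>' \<Delta> \<theta> \<theta>'"
  shows "sub_related (Suc ` I) (\<rho> # \<Gamma>) (\<rho> # \<Gamma>') (shift 0 1 ` \<Delta>) (up \<theta>) (up \<theta>')"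
proof (rule sub_relatedI)
  fix i
  show "up \<theta> i = up \<theta>' i" if "i \<notin> Suc ` I"
    using that assms by (cases i) (auto simp: sub_related_def)
  show "\<rho> # \<Gamma>' \<parallel> shift 0 1 ` \<Delta> \<turnstile> Sub ((\<rho> # \<Gamma>) ! i) (up \<theta> i) (up \<theta>' i)"
    if i: "i < length (\<rho> # \<Gamma>)" "i \<in> Suc ` I"
  proof -
    obtain j where j: "i = Suc j" "j < length \<Gamma>" using i by auto
    then have "\<Gamma>' \<parallel> \<Delta> \<turnstile> Sub (\<Gamma> ! j) (\<theta> j) (\<theta>' j)" using assms by (auto simp: sub_related_def)
    from deriv_shift[OF this] show ?thesis using j by simp
  qed
qed (use assms in \<open>auto simp: sub_related_def intro: typed_subst_up\<close>)

lemma sub_related_subset: "sub_related J \<Gamma> \<Gamma>' \<Delta> \<theta> \<theta>' \<Longrightarrow> J \<subseteq> I \<Longrightarrow> sub_related I \<Gamma> \<Gamma>' \<Delta> \<theta> \<theta>'"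
  by (auto simp: sub_related_def)

lemma mono_at_subset: "mono_at I \<Gamma> A \<Longrightarrow> J \<subseteq> I \<Longrightarrow> mono_at J \<Gamma> A"
  unfolding mono_at_def using sub_related_subset by meson

text \<open>The last two assumptions say that composing \<open>\<sigma>\<close> with a pair related
  on \<open>J\<close> gives a pair related on \<open>I\<close>.\<close>

lemma mono_at_subst:
  assumes "mono_at I \<Gamma> A" "typed_subst L \<Gamma> \<Gamma>\<^sub>1 \<sigma>"
    and "\<And>\<Gamma>' \<Delta> \<theta> \<theta>' i. sub_related J \<Gamma>\<^sub>1 \<Gamma>' \<Delta> \<theta> \<theta>' \<Longrightarrow> i \<notin> I \<Longrightarrow> subst_tm \<theta> (\<sigma> i) = subst_tm \<theta>' (\<sigma> i)"
    and "\<And>\<Gamma>' \<Delta> \<theta> \<theta>' i. sub_related J \<Gamma>\<^sub>1 \<Gamma>' \<Delta> \<theta> \<theta>' \<Longrightarrow> i \<in> I \<Longrightarrow> i < length \<Gamma> \<Longrightarrow>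
      \<Gamma>' \<parallel> \<Delta> \<turnstile> Sub (\<Gamma> ! i) (subst_tm \<theta> (\<sigma> i)) (subst_tm \<theta>' (\<sigma> i))"
  shows "mono_at J \<Gamma>\<^sub>1 (subst \<sigma> A)"
proof (rule mono_atI)
  fix \<Gamma>' \<Delta> \<theta> \<theta>'
  assume rel: "sub_related J \<Gamma>\<^sub>1 \<Gamma>' \<Delta> \<theta> \<theta>'" and A: "\<Gamma>' \<parallel> \<Delta> \<turnstile> subst \<theta> (subst \<sigma> A)"
  have "typed_subst L \<Gamma>\<^sub>1 \<Gamma>' \<theta>" "typed_subst L \<Gamma>\<^sub>1 \<Gamma>' \<theta>'" using rel by (auto simp: sub_related_def)
  then have "sub_related I \<Gamma> \<Gamma>' \<Delta> (\<lambda>i. subst_tm \<theta> (\<sigma> i)) (\<lambda>i. subst_tm \<theta>' (\<sigma> i))"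
    using assms(3,4)[OF rel] by (intro sub_relatedI typed_subst_comp[OF assms(2)])
  from mono_atD[OF assms(1) this] A show "\<Gamma>' \<parallel> \<Delta> \<turnstile> subst \<theta>' (subst \<sigma> A)" by simp
qed

lemma mono_at_rename:
  assumes "mono_at I \<Gamma> A" "typed_subst L \<Gamma> \<Gamma>\<^sub>1 (\<lambda>i. Var (r i))" "\<And>i. r i \<in> J \<Longrightarrow> i \<in> I"
  shows "mono_at J \<Gamma>\<^sub>1 (subst (\<lambda>i. Var (r i)) A)"
proof (rule mono_at_subst[OF assms(1,2)])
  fix \<Gamma>' \<Delta> \<theta> \<theta>' i
  assume rel: "sub_related J \<Gamma>\<^sub>1 \<Gamma>' \<Delta> \<theta> \<theta>'"
  show "subst_tm \<theta> (Var (r i)) = subst_tm \<theta>' (Var (r i))" if "i \<notin> I"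
    using that rel assms(3)[of i] by (auto simp: sub_related_def)
  show "\<Gamma>' \<parallel> \<Delta> \<turnstile> Sub (\<Gamma> ! i) (subst_tm \<theta> (Var (r i))) (subst_tm \<theta>' (Var (r i)))" if "i < length \<Gamma>"
    using that rel assms(2) by (auto simp: sub_related_def typed_subst_def)
qed

section \<open>Monotonicity through connectives and quantifiers\<close>

lemma mono_at_Or:
  assumes "mono_at I \<Gamma> A" "mono_at I \<Gamma> B" "wf_fm L \<Gamma> A" "wf_fm L \<Gamma> B"
  shows "mono_at I \<Gamma> (Or A B)"
proof (rule mono_atI)
  fix \<Gamma>' \<Delta> \<theta> \<theta>'
  assume rel: "sub_related I \<Gamma> \<Gamma>' \<Delta> \<theta> \<theta>'" and *: "\<Gamma>' \<parallel> \<Delta> \<turnstile> subst \<theta> (Or A B)"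
  have typed: "typed_subst L \<Gamma> \<Gamma>' \<theta>" "typed_subst L \<Gamma> \<Gamma>' \<theta>'" using rel by (auto simp: sub_related_def)
  show "\<Gamma>' \<parallel> \<Delta> \<turnstile> subst \<theta>' (Or A B)"
    unfolding subst.simps
  proof (rule orE[OF *[unfolded subst.simps]])
    show "\<Gamma>' \<parallel> insert (subst \<theta> A) \<Delta> \<turnstile> Or (subst \<theta>' A) (subst \<theta>' B)"
      by (rule orI1[OF mono_atD[OF assms(1) sub_related_weaken[OF rel]]])
        (use assms typed in \<open>auto intro!: hyp_in wf_subst\<close>)
    show "\<Gamma>' \<parallel> insert (subst \<theta> B) \<Delta> \<turnstile> Or (subst \<theta>' A) (subst \<theta>' B)"
      by (rule orI2[OF mono_atD[OF assms(2) sub_related_weaken[OF rel]]])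
        (use assms typed in \<open>auto intro!: hyp_in wf_subst\<close>)
  qed
qed

lemma mono_at_And:
  assumes "mono_at I \<Gamma> A" "mono_at I \<Gamma> B"
  shows "mono_at I \<Gamma> (And A B)"
proof (rule mono_atI)
  fix \<Gamma>' \<Delta> \<theta> \<theta>'
  assume rel: "sub_related I \<Gamma> \<Gamma>' \<Delta> \<theta> \<theta>'" and "\<Gamma>' \<parallel> \<Delta> \<turnstile> subst \<theta> (And A B)"
  then have *: "\<Gamma>' \<parallel> \<Delta> \<turnstile> And (subst \<theta> A) (subst \<theta> B)" by simp
  show "\<Gamma>' \<parallel> \<Delta> \<turnstile> subst \<theta>' (And A B)"
    unfolding subst.simps
    by (rule andI[OF mono_atD[OF assms(1) rel andE1[OF *]] mono_atD[OF assms(2) rel andE2[OF *]]])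
qed

text \<open>A premise is a contravariant position. The assumption \<open>inv\<close> expresses,
  without a notion of free variable, that no index of \<open>I\<close> occurs in it, so the premise
  is the same formula for both substitutions.\<close>

lemma mono_at_Imp:
  assumes "mono_at I \<Gamma> B" "wf_fm L \<Gamma> A"
    and inv: "\<And>\<theta> \<theta>'. (\<And>i. i \<notin> I \<Longrightarrow> \<theta> i = \<theta>' i) \<Longrightarrow> subst \<theta> A = subst \<theta>' A"
  shows "mono_at I \<Gamma> (Imp A B)"
proof (rule mono_atI)
  fix \<Gamma>' \<Delta> \<theta> \<theta>'
  assume rel: "sub_related I \<Gamma> \<Gamma>' \<Delta> \<theta> \<theta>'" and *: "\<Gamma>' \<parallel> \<Delta> \<turnstile> subst \<theta> (Imp A B)"
  have eq: "subst \<theta>' A = subst \<theta> A" using inv[of \<theta> \<theta>'] rel by (auto simp: sub_related_def)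
  have wf: "wf_fm L \<Gamma>' (subst \<theta> A)" using assms(2) rel by (auto simp: sub_related_def intro: wf_subst)
  then have "\<Gamma>' \<parallel> insert (subst \<theta> A) \<Delta> \<turnstile> subst \<theta> B" using * by (simp add: imp_iff)
  from mono_atD[OF assms(1) sub_related_weaken[OF rel] this]
  show "\<Gamma>' \<parallel> \<Delta> \<turnstile> subst \<theta>' (Imp A B)" using wf by (auto simp: eq imp_iff)
qed

lemma mono_at_All: "mono_at (Suc ` I) (\<rho> # \<Gamma>) A \<Longrightarrow> mono_at I \<Gamma> (All \<rho> A)"
  by (rule mono_atI) (auto simp: all_iff dest: mono_atD sub_related_up[where \<rho> = \<rho>])

lemma mono_at_Alls: "mono_at ((+) (length xs) ` I) (xs @ \<Gamma>) A \<Longrightarrow> mono_at I \<Gamma> (Alls xs A)"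
proof (induction xs arbitrary: A)
  case (Cons x xs)
  have "(+) (length (x # xs)) ` I = Suc ` (+) (length xs) ` I" by (auto simp: image_image)
  then show ?case using Cons mono_at_All by simp
qed simp

lemma mono_at_Ex:
  assumes "mono_at (Suc ` I) (\<rho> # \<Gamma>) A" "wf_fm L (\<rho> # \<Gamma>) A"
  shows "mono_at I \<Gamma> (Ex \<rho> A)"
proof (rule mono_atI)
  fix \<Gamma>' \<Delta> \<theta> \<theta>'
  assume rel: "sub_related I \<Gamma> \<Gamma>' \<Delta> \<theta> \<theta>'" and *: "\<Gamma>' \<parallel> \<Delta> \<turnstile> subst \<theta> (Ex \<rho> A)"
  have typed: "typed_subst L \<Gamma> \<Gamma>' \<theta>" "typed_subst L \<Gamma> \<Gamma>' \<theta>'" using rel by (auto simp: sub_related_def)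
  note rel' = sub_related_weaken[OF sub_related_up[OF rel, of \<rho>], of "insert (subst (up \<theta>) A) (shift 0 1 ` \<Delta>)"]
  have "\<rho> # \<Gamma>' \<parallel> insert (subst (up \<theta>) A) (shift 0 1 ` \<Delta>) \<turnstile> subst (up \<theta>') A"
    by (rule mono_atD[OF assms(1) rel'])
      (use assms typed in \<open>auto intro!: hyp_in wf_subst typed_subst_up\<close>)
  moreover have "case_nat (Var 0) (\<lambda>i. subst_tm (\<lambda>i. Var (Suc i)) (\<theta>' i)) = up \<theta>'"
    by (rule ext) (auto simp: up_def)
  ultimately have "\<rho> # \<Gamma>' \<parallel> insert (subst (up \<theta>) A) (shift 0 1 ` \<Delta>) \<turnstile>
      subst (\<lambda>i. subst_tm (\<lambda>i. Var (Suc i)) (\<theta>' i)) (Ex \<rho> A)"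
    by (intro ex_subst_I[where \<Gamma>' = \<Gamma> and t = "Var 0"]
        typed_subst_comp[OF typed(2) typed_subst_shift] assms(2)) simp_all
  then show "\<Gamma>' \<parallel> \<Delta> \<turnstile> subst \<theta>' (Ex \<rho> A)"
    using * wf_subst[of L \<Gamma> "Ex \<rho> A", OF _ typed(2)] assms(2)
    by - (rule exE[of L T \<Gamma>' \<Delta> \<rho> "subst (up \<theta>) A"], simp_all add: up_comp)
qed

text \<open>Here the bound itself may grow, since a member of the smaller set is a member of the
  larger one. This case makes the witness \<open>Z\<close> of an unbounded quantifier
  monotone.\<close>

lemma mono_at_BEx:
  assumes "mono_at (Suc ` I) (\<rho> # \<Gamma>) A" "wf_fm L \<Gamma> (BEx \<rho> t A)"
    and "\<And>\<Gamma>' \<Delta> \<theta> \<theta>'. sub_related I \<Gamma> \<Gamma>' \<Delta> \<theta> \<theta>' \<Longrightarrow> \<Gamma>' \<parallel> \<Delta> \<turnstile> Sub (Star \<rho>) (subst_tm \<theta> t) (subst_tm \<theta>' t)"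
  shows "mono_at I \<Gamma> (BEx \<rho> t A)"
proof -
  let ?M = "Mem \<rho> (Var 0) (shift_tm 0 1 t)"
  have "mono_at (Suc ` I) (\<rho> # \<Gamma>) ?M"
  proof (rule mono_atI)
    fix \<Gamma>' \<Delta> \<theta> \<theta>'
    assume rel: "sub_related (Suc ` I) (\<rho> # \<Gamma>) \<Gamma>' \<Delta> \<theta> \<theta>'" and *: "\<Gamma>' \<parallel> \<Delta> \<turnstile> subst \<theta> ?M"
    have "sub_related I \<Gamma> \<Gamma>' \<Delta> (\<lambda>i. \<theta> (Suc i)) (\<lambda>i. \<theta>' (Suc i))"
      using rel by (auto simp: sub_related_def typed_subst_Cons)
    from Sub_mem[OF assms(3)[OF this], of "\<theta> 0"] * rel show "\<Gamma>' \<parallel> \<Delta> \<turnstile> subst \<theta>' ?M"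
      by (auto simp: sub_related_def)
  qed
  then have "mono_at I \<Gamma> (Ex \<rho> (And ?M A))"
    using assms by (intro mono_at_Ex mono_at_And) (auto intro: has_type_shift)
  moreover have "\<Gamma>' \<parallel> \<Delta> \<turnstile> subst \<theta> (BEx \<rho> t A) \<longleftrightarrow> \<Gamma>' \<parallel> \<Delta> \<turnstile> subst \<theta> (Ex \<rho> (And ?M A))"
    if "typed_subst L \<Gamma> \<Gamma>' \<theta>" for \<Gamma>' \<Delta> \<theta>
    using wf_subst[OF assms(2) that] by (simp add: bex_iff)
  ultimately show ?thesis by (auto simp: mono_at_def sub_related_def simp del: subst.simps)
qed

text \<open>Unfolding puts \<open>z \<in> t\<close> into a premise, so in contrast to
  \<open>mono_at_BEx\<close> the bound must not depend on \<open>I\<close>.\<close>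

lemma mono_at_BAll:
  assumes "mono_at (Suc ` I) (\<rho> # \<Gamma>) A" "wf_fm L \<Gamma> (BAll \<rho> t A)"
    and inv: "\<And>\<theta> \<theta>'. (\<And>i. i \<notin> I \<Longrightarrow> \<theta> i = \<theta>' i) \<Longrightarrow> subst_tm \<theta> t = subst_tm \<theta>' t"
  shows "mono_at I \<Gamma> (BAll \<rho> t A)"
proof -
  let ?M = "Mem \<rho> (Var 0) (shift_tm 0 1 t)"
  have M: "subst \<theta> ?M = subst \<theta>' ?M" if "\<And>i. i \<notin> Suc ` I \<Longrightarrow> \<theta> i = \<theta>' i" for \<theta> \<theta>'
    using inv[of "\<lambda>i. \<theta> (Suc i)" "\<lambda>i. \<theta>' (Suc i)"] that by auto
  have "mono_at I \<Gamma> (All \<rho> (Imp ?M A))"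
    by (rule mono_at_All, rule mono_at_Imp[OF assms(1) _ M]) (use assms(2) in \<open>auto intro: has_type_shift\<close>)
  moreover have "\<Gamma>' \<parallel> \<Delta> \<turnstile> subst \<theta> (BAll \<rho> t A) \<longleftrightarrow> \<Gamma>' \<parallel> \<Delta> \<turnstile> subst \<theta> (All \<rho> (Imp ?M A))"
    if "typed_subst L \<Gamma> \<Gamma>' \<theta>" for \<Gamma>' \<Delta> \<theta>
    using wf_subst[OF assms(2) that] by (simp add: ball_iff)
  ultimately show ?thesis by (auto simp: mono_at_def sub_related_def simp del: subst.simps)
qed

end

section \<open>Choice and independence of premise for tuples\<close>

text \<open>
  With \<open>Xs\<close> and \<open>Us\<close> the tuples lifted to function types, \<open>app_subst\<close> maps the context \<open>xs @ z # \<Gamma>\<close>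
  into \<open>z # Xs @ \<Gamma>\<close>, and \<open>apps_subst\<close> maps \<open>us @ xs @ \<Gamma>\<close> into \<open>xs @ Us @ \<Gamma>\<close>.
\<close>

definition app_subst :: "nat \<Rightarrow> nat \<Rightarrow> 'f tm" where
  "app_subst n i = (if i < n then Var (Suc i) \<bullet> Var 0 else if i = n then Var 0 else Var i)"

definition apps_subst :: "nat \<Rightarrow> nat \<Rightarrow> nat \<Rightarrow> 'f tm" where
  "apps_subst n m i =
     (if i < m then app_vars (Var (n + i)) n else if i < m + n then Var (i - m) else Var i)"

lemma typed_app_subst:
  "typed_subst L (xs @ \<rho> # \<Gamma>) (\<rho> # map ((\<rightarrow>) \<rho>) xs @ \<Gamma>) (app_subst (length xs))"
  unfolding typed_subst_append typed_subst_Cons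
  by (auto simp: typed_subst_def app_subst_def nth_append)

lemma rev_upt_Suc: "rev [0..<Suc n] = map Suc (rev [0..<n]) @ [0]"
  by (simp add: map_Suc_upt[symmetric] upt_conv_Cons rev_map del: upt_Suc)

lemma subst_app_vars: "subst_tm \<theta> (app_vars t n) = foldl (\<bullet>) (subst_tm \<theta> t) (map \<theta> (rev [0..<n]))"
proof -
  have "subst_tm \<theta> (foldl (\<bullet>) t us) = foldl (\<bullet>) (subst_tm \<theta> t) (map (subst_tm \<theta>) us)" for us
    by (induction us arbitrary: t) auto
  then show ?thesis by (simp add: app_vars_def comp_def)
qed

text \<open>\<open>app_vars\<close> supplies arguments from the highest index down, in agreement
  with \<open>Arrows\<close>; a new innermost variable is therefore appended as the last
  argument.\<close>

lemma app_vars_Suc: "app_vars (shift_tm 0 1 t) (Suc n) = shift_tm 0 1 (app_vars t n) \<bullet> Var 0"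
  unfolding subst_app_vars unfolding app_vars_def rev_upt_Suc by (simp add: comp_def)

lemma Arrows_Nil [simp]: "Arrows [] \<tau> = \<tau>"
  by (simp add: Arrows_def)

lemma Arrows_Cons [simp]: "Arrows (x # xs) \<tau> = Arrows xs (x \<rightarrow> \<tau>)"
  by (simp add: Arrows_def)

lemma end_star_Arrows [simp]: "end_star (Arrows xs \<tau>) = end_star \<tau>"
  by (induction xs arbitrary: \<tau>) auto

context il_theory
begin

lemma sub_relatedD:
  "sub_related I \<Gamma> \<Gamma>' \<Delta> \<theta> \<theta>' \<Longrightarrow> i < length \<Gamma> \<Longrightarrow> \<Gamma>' \<parallel> \<Delta> \<turnstile> Sub (\<Gamma> ! i) (\<theta> i) (\<theta>' i)"
  by (simp add: sub_related_def)

lemma mono_at_subst_up: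
  assumes "mono_at {0} (x # \<Gamma>) A" "typed_subst L \<Gamma> \<Gamma>\<^sub>1 \<sigma>"
  shows "mono_at {0} (x # \<Gamma>\<^sub>1) (subst (up \<sigma>) A)"
proof (rule mono_at_subst[OF assms(1) typed_subst_up[OF assms(2)]])
  fix \<Gamma>' \<Delta> \<theta> \<theta>' i
  assume rel: "sub_related {0} (x # \<Gamma>\<^sub>1) \<Gamma>' \<Delta> \<theta> \<theta>'"
  show "subst_tm \<theta> (up \<sigma> i) = subst_tm \<theta>' (up \<sigma> i)" if "i \<notin> {0}"
    using that rel by (cases i) (auto simp: sub_related_def)
  show "\<Gamma>' \<parallel> \<Delta> \<turnstile> Sub ((x # \<Gamma>) ! i) (subst_tm \<theta> (up \<sigma> i)) (subst_tm \<theta>' (up \<sigma> i))" if "i \<in> {0}"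
    using that rel by (auto simp: sub_related_def)
qed

text \<open>Inclusion of functions gives inclusion of their values at \<open>z\<close> by
  \<open>Sub_app\<close>. Monotonicity thus survives the passage from witnesses to functions of
  \<open>z\<close>, and choice can be repeated for the next universal quantifier.\<close>

lemma mono_at_subst_app:
  assumes "mono_at {..<length xs} (xs @ \<rho> # \<Gamma>) A"
  shows "mono_at {..<length xs} (map ((\<rightarrow>) \<rho>) xs @ \<Gamma>) (All \<rho> (subst (app_subst (length xs)) A))"
proof (rule mono_at_All, rule mono_at_subst[OF assms typed_app_subst])
  fix \<Gamma>' \<Delta> \<theta> \<theta>' i
  assume rel: "sub_related (Suc ` {..<length xs}) (\<rho> # map ((\<rightarrow>) \<rho>) xs @ \<Gamma>) \<Gamma>' \<Delta> \<theta> \<theta>'"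
  then have eq: "j \<notin> Suc ` {..<length xs} \<Longrightarrow> \<theta> j = \<theta>' j" for j by (auto simp: sub_related_def)
  show "subst_tm \<theta> (app_subst (length xs) i) = subst_tm \<theta>' (app_subst (length xs) i)"
    if "i \<notin> {..<length xs}"
    using that by (auto simp: app_subst_def intro!: eq)
  show "\<Gamma>' \<parallel> \<Delta> \<turnstile> Sub ((xs @ \<rho> # \<Gamma>) ! i) (subst_tm \<theta> (app_subst (length xs) i))
      (subst_tm \<theta>' (app_subst (length xs) i))" if "i \<in> {..<length xs}"
  proof -
    have i: "i < length xs" using that by simp
    have "\<Gamma>' \<parallel> \<Delta> \<turnstile> Sub ((\<rho> # map ((\<rightarrow>) \<rho>) xs @ \<Gamma>) ! Suc i) (\<theta> (Suc i)) (\<theta>' (Suc i))"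
      by (rule sub_relatedD[OF rel]) (use i in simp)
    then have "\<Gamma>' \<parallel> \<Delta> \<turnstile> Sub (\<rho> \<rightarrow> xs ! i) (\<theta> (Suc i)) (\<theta>' (Suc i))"
      using i by (simp add: nth_append del: Sub.simps)
    moreover have "has_type L \<Gamma>' (\<theta> 0) \<rho>"
      using rel by (auto simp: sub_related_def typed_subst_Cons)
    ultimately have "\<Gamma>' \<parallel> \<Delta> \<turnstile> Sub (xs ! i) (\<theta> (Suc i) \<bullet> \<theta> 0) (\<theta>' (Suc i) \<bullet> \<theta> 0)"
      by (rule Sub_app)
    then show ?thesis using i eq[of 0] by (simp add: app_subst_def nth_append)
  qed
qed

end

locale hr_theory = il_theory L T
  for L :: "('f, 'r) lang" and T +
  assumes AC_T: "AC L \<subseteq> T" and IP_T: "IP L \<subseteq> T"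
begin

text \<open>Herbrand choice gives a finite set \<open>f x\<close> containing some good
  \<open>y\<close>. The union \<open>F x\<close> of the members of \<open>f x\<close> includes this
  \<open>y\<close>, and monotonicity turns \<open>A(x, y)\<close> into
  \<open>A(x, F x)\<close>.\<close>

lemma choice_step:
  assumes prem: "\<Gamma> \<parallel> \<Delta> \<turnstile> All \<rho> (Ex x A)" and mono: "mono_at {0} (x # \<rho> # \<Gamma>) A" and x: "end_star x"
  shows "\<Gamma> \<parallel> \<Delta> \<turnstile> Ex (\<rho> \<rightarrow> x) (All \<rho> (subst (app_subst 1) A))"
proof -
  let ?S = "shift_tm 0 1" and ?fx = "Var 1 \<bullet> Var 0 :: 'f tm"
  let ?f = "\<rho> \<rightarrow> Star x" and ?B = "subst (app_subst 1) A"
  let ?H = "All \<rho> (BEx x ?fx (shift 2 1 A))"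
  have wf: "wf_fm L (x # \<rho> # \<Gamma>) A" using deriv_wf[OF prem] by simp
  then have "(\<Gamma>, Imp (All \<rho> (Ex x A)) (Ex ?f ?H)) \<in> T"
    using AC_T by (auto simp: AC_def)
  from impE[OF extI[OF this] prem] have ex: "\<Gamma> \<parallel> \<Delta> \<turnstile> Exs [?f] ?H" by simp
  let ?\<Gamma> = "\<rho> # ?f # \<Gamma>"
  \<comment> \<open>The collected term is the member itself, \<open>Var 0\<close>, so
    \<open>c\<close> is the union of the elements of \<open>f x\<close>.\<close>
  obtain c where c: "has_type L ?\<Gamma> c x"
    "\<And>\<Gamma>' \<Delta> \<theta> s. typed_subst L ?\<Gamma> \<Gamma>' \<theta> \<Longrightarrow> \<Gamma>' \<parallel> \<Delta> \<turnstile> Mem x s (subst_tm \<theta> ?fx) \<Longrightarrow>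
       \<Gamma>' \<parallel> \<Delta> \<turnstile> Sub x (subst_tm (case_nat s \<theta>) (Var 0)) (subst_tm \<theta> c)"
    by (rule collectionE[of ?\<Gamma> ?fx x "Var 0" x]) (use x in auto)
  obtain F where F: "has_type L (?f # \<Gamma>) F (\<rho> \<rightarrow> x)" "?\<Gamma> \<parallel> {} \<turnstile> Eq x (?S F \<bullet> Var 0) c"
    using abstraction[OF c(1)] by auto
  have wfB: "wf_fm L (\<rho> # (\<rho> \<rightarrow> x) # \<Gamma>) ?B"
    using wf_subst[OF wf] typed_app_subst[of L "[x]" \<rho> \<Gamma>] by simp
  \<comment> \<open>The instance \<open>y := F x\<close> in the context
    \<open>x, f, \<Gamma>\<close>. Indices from 2 on are fixed, because \<open>f\<close> makes up
    for the removed \<open>y\<close>.\<close>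
  define \<phi> where "\<phi> i = (case i of 0 \<Rightarrow> ?S F \<bullet> Var 0 | Suc 0 \<Rightarrow> Var 0 | Suc (Suc j) \<Rightarrow> Var (Suc (Suc j)))" for i
  have \<phi>: "subst (up (case_nat F (\<lambda>i. Var (Suc i)))) ?B = subst \<phi> A"
  proof -
    have "subst_tm (up (case_nat F (\<lambda>i. Var (Suc i)))) (app_subst 1 i) = \<phi> i" for i
      by (cases i; cases "i - 1") (auto simp: app_subst_def \<phi>_def)
    then show ?thesis by (simp only: subst_subst)
  qed
  have typed2: "typed_subst L (x # \<rho> # \<Gamma>) (x # ?\<Gamma>) (shift_var 2 1)"
    by (auto simp: typed_subst_Cons shift_var_def) (auto simp: typed_subst_def)
  have typed\<phi>: "typed_subst L (x # \<rho> # \<Gamma>) ?\<Gamma> \<phi>"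
    using has_type_shift[OF F(1)]
    by (auto simp: typed_subst_Cons \<phi>_def) (auto simp: typed_subst_def)
  let ?\<Delta> = "{shift 0 1 ?H}"
  have wfH: "wf_fm L (?f # \<Gamma>) ?H"
    using deriv_wf[OF ex] by simp
  have "?\<Gamma> \<parallel> ?\<Delta> \<turnstile> BEx x ?fx (shift 2 1 A)"
    using hyp_in[OF wfH, of "{}"] by (simp add: all_iff)
  then have "?\<Gamma> \<parallel> ?\<Delta> \<turnstile> subst \<phi> A"
  proof (rule bex_E)
    show "wf_fm L ?\<Gamma> (subst \<phi> A)" using wf typed\<phi> by (rule wf_subst)
    let ?M = "Mem x (Var 0) (?S ?fx)"
    let ?\<Delta>' = "insert ?M (insert (shift 2 1 A) (shift 0 1 ` ?\<Delta>))"
    have "x # ?\<Gamma> \<parallel> ?\<Delta>' \<turnstile> Sub x (Var 0) (?S c)"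
      using c(2)[of "x # ?\<Gamma>" "\<lambda>i. Var (Suc i)" ?\<Delta>' "Var 0"] by (simp add: hyp)
    moreover have "x # ?\<Gamma> \<parallel> ?\<Delta>' \<turnstile> Eq x (?S c) (?S (?S F) \<bullet> Var 1)"
      using deriv_subst_empty[OF F(2) typed_subst_shift, of x ?\<Delta>']
      by - (rule eq_sym, simp)
    ultimately have sub: "x # ?\<Gamma> \<parallel> ?\<Delta>' \<turnstile> Sub x (Var 0) (?S (?S F) \<bullet> Var 1)"
      by (rule Sub_eq_right)
    \<comment> \<open>The candidate \<open>y \<in> f x\<close> is compared with \<open>F x\<close>;
      all other variables go to the same terms.\<close>
    have "sub_related {0} (x # \<rho> # \<Gamma>) (x # ?\<Gamma>) ?\<Delta>' (shift_var 2 1) (\<lambda>i. ?S (\<phi> i))"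
    proof (rule sub_relatedI)
      show "typed_subst L (x # \<rho> # \<Gamma>) (x # ?\<Gamma>) (\<lambda>i. ?S (\<phi> i))"
        using typed_subst_comp[OF typed\<phi> typed_subst_shift] by simp
      show "shift_var 2 1 i = ?S (\<phi> i)" if "i \<notin> {0}" for i
        using that by (cases i; cases "i - 1") (auto simp: shift_var_def \<phi>_def)
    qed (use sub typed2 in \<open>auto simp: shift_var_def \<phi>_def\<close>)
    from mono_atD[OF mono this]
    have "x # ?\<Gamma> \<parallel> ?\<Delta>' \<turnstile> subst (\<lambda>i. ?S (\<phi> i)) A"
      using wf_subst[OF wf typed2] by (simp add: hyp)
    then show "x # ?\<Gamma> \<parallel> ?\<Delta>' \<turnstile> shift 0 1 (subst \<phi> A)" by simp
  qed
  then have "?f # \<Gamma> \<parallel> {?H} \<turnstile> subst (case_nat F (\<lambda>i. Var (Suc i))) (All \<rho> ?B)"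
    by (simp only: subst.simps \<phi> all_iff image_insert image_empty)
  then have *: "?f # \<Gamma> \<parallel> {?H} \<turnstile> subst (\<lambda>i. Var (Suc i)) (Ex (\<rho> \<rightarrow> x) (All \<rho> ?B))"
    by (rule ex_subst_I[where \<Gamma>' = \<Gamma>]) (use F wfB in auto)
  show ?thesis
    by (rule Exs_E_single[OF ex]) (use * wfB in auto)
qed

text \<open>As in \<open>choice_step\<close>, with \<open>c\<close> the union of the candidates in
  \<open>w\<close>: monotonicity replaces the candidate by \<open>c\<close> while the premise is
  kept as an assumption.\<close>

lemma premise_step:
  assumes prem: "\<Gamma> \<parallel> \<Delta> \<turnstile> Imp B (Ex x A)" and B: "ex_free B"
    and mono: "mono_at {0} (x # \<Gamma>) A" and x: "end_star x"
  shows "\<Gamma> \<parallel> \<Delta> \<turnstile> Ex x (Imp (shift 0 1 B) A)"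
proof -
  let ?S = "shift_tm 0 1" and ?\<Gamma> = "Star x # \<Gamma>"
  let ?H = "Imp (shift 0 1 B) (BEx x (Var 0) (shift 1 1 A))"
  have wf: "wf_fm L (x # \<Gamma>) A" "wf_fm L \<Gamma> B" using deriv_wf[OF prem] by simp_all
  then have "(\<Gamma>, Imp (Imp B (Ex x A)) (Ex (Star x) ?H)) \<in> T"
    using IP_T B unfolding IP_def by blast
  from impE[OF extI[OF this] prem] have ex: "\<Gamma> \<parallel> \<Delta> \<turnstile> Exs [Star x] ?H" by simp
  obtain c where c: "has_type L ?\<Gamma> c x"
    "\<And>\<Gamma>' \<Delta> \<theta> s. typed_subst L ?\<Gamma> \<Gamma>' \<theta> \<Longrightarrow> \<Gamma>' \<parallel> \<Delta> \<turnstile> Mem x s (subst_tm \<theta> (Var 0)) \<Longrightarrow>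
       \<Gamma>' \<parallel> \<Delta> \<turnstile> Sub x (subst_tm (case_nat s \<theta>) (Var 0)) (subst_tm \<theta> c)"
    by (rule collectionE[of ?\<Gamma> "Var 0" x "Var 0" x]) (use x in auto)
  define \<phi> where "\<phi> = case_nat c (\<lambda>i. Var (Suc i))"
  have typed\<phi>: "typed_subst L (x # \<Gamma>) ?\<Gamma> \<phi>"
    using c(1) by (auto simp: typed_subst_Cons \<phi>_def)
  have typed1: "typed_subst L (x # \<Gamma>) (x # ?\<Gamma>) (shift_var 1 1)"
    by (auto simp: typed_subst_Cons shift_var_def) (auto simp: typed_subst_def)
  have wfH: "wf_fm L ?\<Gamma> ?H" using deriv_wf[OF ex] by simp
  let ?\<Delta> = "{shift 0 1 B, ?H}"
  have wfB: "wf_fm L ?\<Gamma> (shift 0 1 B)" using wf_shift[OF wf(2)] by simp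
  have "?\<Gamma> \<parallel> ?\<Delta> \<turnstile> BEx x (Var 0) (shift 1 1 A)"
    by (rule impE[OF hyp hyp]) (use wfH wfB in auto)
  then have "?\<Gamma> \<parallel> ?\<Delta> \<turnstile> subst \<phi> A"
  proof (rule bex_E)
    show "wf_fm L ?\<Gamma> (subst \<phi> A)" using wf(1) typed\<phi> by (rule wf_subst)
    let ?M = "Mem x (Var 0) (?S (Var 0))"
    let ?\<Delta>' = "insert ?M (insert (shift 1 1 A) (shift 0 1 ` ?\<Delta>))"
    have sub: "x # ?\<Gamma> \<parallel> ?\<Delta>' \<turnstile> Sub x (Var 0) (?S c)"
      using c(2)[of "x # ?\<Gamma>" "\<lambda>i. Var (Suc i)" ?\<Delta>' "Var 0"] by (simp add: hyp)
    have "sub_related {0} (x # \<Gamma>) (x # ?\<Gamma>) ?\<Delta>' (shift_var 1 1) (\<lambda>i. ?S (\<phi> i))"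
    proof (rule sub_relatedI)
      show "typed_subst L (x # \<Gamma>) (x # ?\<Gamma>) (\<lambda>i. ?S (\<phi> i))"
        using typed_subst_comp[OF typed\<phi> typed_subst_shift] by simp
      show "shift_var 1 1 i = ?S (\<phi> i)" if "i \<notin> {0}" for i
        using that by (cases i) (auto simp: shift_var_def \<phi>_def)
    qed (use sub typed1 in \<open>auto simp: shift_var_def \<phi>_def\<close>)
    from mono_atD[OF mono this]
    have "x # ?\<Gamma> \<parallel> ?\<Delta>' \<turnstile> subst (\<lambda>i. ?S (\<phi> i)) A"
      using wf_subst[OF wf(1) typed1] by (simp add: hyp)
    then show "x # ?\<Gamma> \<parallel> ?\<Delta>' \<turnstile> shift 0 1 (subst \<phi> A)" by simp
  qed
  then have "?\<Gamma> \<parallel> {?H} \<turnstile> Imp (shift 0 1 B) (subst \<phi> A)"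
    by (rule impI[OF wfB])
  then have "?\<Gamma> \<parallel> {?H} \<turnstile> subst (case_nat c (\<lambda>i. Var (Suc i))) (Imp (shift 0 1 B) A)"
    by (simp add: \<phi>_def)
  then have *: "?\<Gamma> \<parallel> {?H} \<turnstile> subst (\<lambda>i. Var (Suc i)) (Ex x (Imp (shift 0 1 B) A))"
    by (rule ex_subst_I[where \<Gamma>' = \<Gamma>]) (use c wf wf_shift in auto)
  show ?thesis
    by (rule Exs_E_single[OF ex]) (use * wf wf_shift in auto)
qed

lemma mono_at_head: "mono_at {..<Suc n} \<Gamma> A \<Longrightarrow> mono_at {0} \<Gamma> A"
  by (erule mono_at_subset) auto

lemma mono_at_tail: "mono_at {..<Suc n} \<Gamma> A \<Longrightarrow> mono_at (Suc ` {..<n}) \<Gamma> A"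
  by (erule mono_at_subset) auto

text \<open>The induction hypothesis, applied to the body \<open>Ex x A\<close>, moves the outer
  witnesses past the universal quantifier; \<open>choice_step\<close> then moves the innermost
  one.\<close>

lemma All_Exs_choice:
  assumes "\<Gamma> \<parallel> \<Delta> \<turnstile> All \<rho> (Exs xs A)" "mono_at {..<length xs} (xs @ \<rho> # \<Gamma>) A" "\<forall>x\<in>set xs. end_star x"
  shows "\<Gamma> \<parallel> \<Delta> \<turnstile> Exs (map ((\<rightarrow>) \<rho>) xs) (All \<rho> (subst (app_subst (length xs)) A))"
  using assms
proof (induction xs arbitrary: A)
  case Nil
  have "app_subst 0 = (Var :: nat \<Rightarrow> 'f tm)" by (auto simp: app_subst_def)
  then show ?case using Nil by simp
next
  case (Cons x xs)
  let ?n = "length xs" and ?Fs = "map ((\<rightarrow>) \<rho>) xs"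
  let ?A = "subst (up (app_subst ?n)) A"
  have wf: "wf_fm L (x # xs @ \<rho> # \<Gamma>) A" using deriv_wf[OF Cons.prems(1)] by simp
  have "\<Gamma> \<parallel> \<Delta> \<turnstile> Exs ?Fs (All \<rho> (subst (app_subst ?n) (Ex x A)))"
    by (rule Cons.IH) (use Cons.prems wf in \<open>auto intro!: mono_at_Ex mono_at_tail\<close>)
  then have "\<Gamma> \<parallel> \<Delta> \<turnstile> Exs ?Fs (All \<rho> (Ex x ?A))" by simp
  moreover have "?Fs @ \<Gamma> \<parallel> {All \<rho> (Ex x ?A)} \<turnstile> Ex (\<rho> \<rightarrow> x) (All \<rho> (subst (app_subst 1) ?A))"
  proof (rule choice_step)
    show "?Fs @ \<Gamma> \<parallel> {All \<rho> (Ex x ?A)} \<turnstile> All \<rho> (Ex x ?A)"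
      by (rule hyp_in) (use wf_subst[OF wf typed_subst_up[OF typed_app_subst]] in simp)
    have "mono_at {0} (x # xs @ \<rho> # \<Gamma>) A" using Cons.prems(2) by (auto intro: mono_at_head)
    then show "mono_at {0} (x # \<rho> # ?Fs @ \<Gamma>) ?A"
      using typed_app_subst by (rule mono_at_subst_up)
  qed (use Cons.prems in simp)
  ultimately have "\<Gamma> \<parallel> \<Delta> \<turnstile> Exs ?Fs (Ex (\<rho> \<rightarrow> x) (All \<rho> (subst (app_subst 1) ?A)))"
    by (rule Exs_mono)
  \<comment> \<open>Replacing first the outer witnesses and then the innermost one by their values
    at \<open>z\<close> amounts to replacing all of them simultaneously.\<close>
  moreover have "subst (app_subst 1) ?A = subst (app_subst (Suc ?n)) A"
  proof -
    have "subst_tm (app_subst 1) (up (app_subst ?n) i) = (app_subst (Suc ?n) i :: 'f tm)" for i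
      by (cases i) (auto simp: app_subst_def)
    then show ?thesis by (simp only: subst_subst)
  qed
  ultimately show ?case by (simp del: subst_subst)
qed

text \<open>The premise is only shifted past each extracted quantifier, so it remains
  \<open>\<exists>\<close>-free for the next use of \<open>premise_step\<close>.\<close>

lemma Imp_Exs_premise:
  assumes "\<Gamma> \<parallel> \<Delta> \<turnstile> Imp B (Exs xs A)" "ex_free B" "mono_at {..<length xs} (xs @ \<Gamma>) A"
    "\<forall>x\<in>set xs. end_star x"
  shows "\<Gamma> \<parallel> \<Delta> \<turnstile> Exs xs (Imp (shift 0 (length xs) B) A)"
  using assms
proof (induction xs arbitrary: A)
  case (Cons x xs)
  let ?B = "shift 0 (length xs) B"
  have wf: "wf_fm L (x # xs @ \<Gamma>) A" "wf_fm L \<Gamma> B" using deriv_wf[OF Cons.prems(1)] by simp_all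
  have "\<Gamma> \<parallel> \<Delta> \<turnstile> Exs xs (Imp ?B (Ex x A))"
    by (rule Cons.IH) (use Cons.prems wf in \<open>auto intro!: mono_at_Ex mono_at_tail\<close>)
  moreover have "xs @ \<Gamma> \<parallel> {Imp ?B (Ex x A)} \<turnstile> Ex x (Imp (shift 0 1 ?B) A)"
  proof (rule premise_step)
    show "xs @ \<Gamma> \<parallel> {Imp ?B (Ex x A)} \<turnstile> Imp ?B (Ex x A)"
      by (rule hyp_in) (use wf wf_subst[OF wf(2) typed_subst_shift_append[OF refl]] in simp)
    show "mono_at {0} (x # xs @ \<Gamma>) A" using Cons.prems(3) by (auto intro: mono_at_head)
  qed (use Cons.prems in simp_all)
  ultimately have "\<Gamma> \<parallel> \<Delta> \<turnstile> Exs xs (Ex x (Imp (shift 0 1 ?B) A))"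
    by (rule Exs_mono)
  then show ?case by simp
qed simp

text \<open>The witnesses first become functions of the innermost variable of the prefix, then of
  the outer ones. Each step changes their types and the matrix, hence the induction is over
  arbitrary \<open>us\<close> and \<open>B\<close>.\<close>

lemma Alls_Exs_choice:
  assumes "\<Gamma> \<parallel> \<Delta> \<turnstile> Alls xs (Exs us B)" "mono_at {..<length us} (us @ xs @ \<Gamma>) B"
    "\<forall>u\<in>set us. end_star u"
  shows "\<Gamma> \<parallel> \<Delta> \<turnstile> Exs (map (Arrows xs) us) (Alls xs (subst (apps_subst (length xs) (length us)) B))"
  using assms
proof (induction xs arbitrary: us B)
  case Nil
  have "apps_subst 0 (length us) = (Var :: nat \<Rightarrow> 'f tm)" by (auto simp: apps_subst_def app_vars_def)
  then show ?case using Nil by (simp add: map_idI)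
next
  case (Cons x xs)
  let ?n = "length xs" and ?m = "length us"
  let ?us = "map ((\<rightarrow>) x) us" and ?B = "All x (subst (app_subst ?m) B)"
  have "\<Gamma> \<parallel> \<Delta> \<turnstile> Alls xs (All x (Exs us B))" using Cons.prems by simp
  moreover have "xs @ \<Gamma> \<parallel> {All x (Exs us B)} \<turnstile> Exs ?us ?B"
    by (rule All_Exs_choice[OF hyp_in]) (use Cons.prems deriv_wf[OF Cons.prems(1)] in simp_all)
  ultimately have "\<Gamma> \<parallel> \<Delta> \<turnstile> Alls xs (Exs ?us ?B)"
    by (rule Alls_mono)
  then have "\<Gamma> \<parallel> \<Delta> \<turnstile> Exs (map (Arrows xs) ?us) (Alls xs (subst (apps_subst ?n (length ?us)) ?B))"
    by (rule Cons.IH) (use Cons.prems mono_at_subst_app[of us x "xs @ \<Gamma>" B] in auto)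
  moreover have "subst (up (apps_subst ?n ?m)) (subst (app_subst ?m) B) = subst (apps_subst (Suc ?n) ?m) B"
  proof -
    have "subst_tm (up (apps_subst ?n ?m)) (app_subst ?m i) = (apps_subst (Suc ?n) ?m i :: 'f tm)" for i
    proof (cases "i < ?m")
      case True
      then show ?thesis
        using app_vars_Suc[of "Var (?n + i) :: 'f tm" ?n] by (simp add: app_subst_def apps_subst_def)
    next
      case False
      then show ?thesis by (cases i) (auto simp: app_subst_def apps_subst_def Suc_diff_le)
    qed
    then show ?thesis by (simp only: subst_subst)
  qed
  ultimately show ?case by (simp add: comp_def del: subst_subst)
qed

end

section \<open>Properties of the translation\<close>

text \<open>The substitution of the implication clause of \<open>HR\<close>, from
  \<open>us @ \<Gamma>\<close> into \<open>xs @ Us @ \<Gamma>\<close>: each \<open>u\<close> becomes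
  the corresponding \<open>U\<close> applied to all of \<open>xs\<close>.\<close>

definition imp_subst :: "nat \<Rightarrow> nat \<Rightarrow> nat \<Rightarrow> 'f tm" where
  "imp_subst n m i = (if i < m then app_vars (Var (n + i)) n else Var (n + i))"

text \<open>From \<open>xs @ z # \<Gamma>\<close> into \<open>z # xs @ Z # \<Gamma>\<close>: the
  parameters behind \<open>z\<close> move up by one because of the new \<open>Z\<close>, whereas
  \<open>rot_subst\<close> leaves them in place.\<close>

definition bex_subst :: "nat \<Rightarrow> nat \<Rightarrow> 'f tm" where
  "bex_subst n i = Var (if i = n then 0 else Suc i)"

definition rot_subst :: "nat \<Rightarrow> nat \<Rightarrow> 'f tm" where
  "rot_subst n i = Var (if i < n then Suc i else if i = n then 0 else i)"

lemma shift_var_rename: "shift_var k d = (\<lambda>i. Var (if i < k then i else i + d))"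
  by (auto simp: shift_var_def)

lemma HR_Or:
  "HR A = (xs, A') \<Longrightarrow> HR B = (us, B') \<Longrightarrow> HR (Or A B) =
     (us @ xs, Or (shift 0 (length us) A') (shift (length us) (length xs) B'))"
  by simp

lemma HR_And:
  "HR A = (xs, A') \<Longrightarrow> HR B = (us, B') \<Longrightarrow> HR (And A B) =
     (us @ xs, And (shift 0 (length us) A') (shift (length us) (length xs) B'))"
  by simp

lemma HR_Imp:
  "HR A = (xs, A') \<Longrightarrow> HR B = (us, B') \<Longrightarrow> HR (Imp A B) = (map (Arrows xs) us,
     Alls xs (Imp (shift (length xs) (length us) A') (subst (imp_subst (length xs) (length us)) B')))"
  by (simp add: Let_def imp_subst_def[abs_def])

lemma HR_All:
  "HR A = (xs, A') \<Longrightarrow>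
   HR (All \<rho> A) = (map ((\<rightarrow>) \<rho>) xs, All \<rho> (subst (app_subst (length xs)) A'))"
  by (simp add: Let_def app_subst_def[abs_def])

lemma HR_Ex:
  "HR A = (xs, A') \<Longrightarrow>
   HR (Ex \<rho> A) = (xs @ [Star \<rho>], BEx \<rho> (Var (length xs)) (subst (bex_subst (length xs)) A'))"
  by (simp add: Let_def bex_subst_def[abs_def] if_distrib[of Var])

lemma HR_BAll:
  "HR A = (xs, A') \<Longrightarrow>
   HR (BAll \<rho> t A) = (xs, BAll \<rho> (shift_tm 0 (length xs) t) (subst (rot_subst (length xs)) A'))"
  by (auto simp: Let_def rot_subst_def intro!: subst_cong)

lemma HR_BEx:
  "HR A = (xs, A') \<Longrightarrow>
   HR (BEx \<rho> t A) = (xs, BEx \<rho> (shift_tm 0 (length xs) t) (subst (rot_subst (length xs)) A'))"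
  by (auto simp: Let_def rot_subst_def intro!: subst_cong)

text \<open>Only the unbounded \<open>\<exists>\<close> adds a type, and that is a star type;
  implication and \<open>\<forall>\<close> put arguments in front, the other clauses concatenate or
  copy.\<close>

lemma HR_end_star: "HR A = (xs, A') \<Longrightarrow> x \<in> set xs \<Longrightarrow> end_star x"
  by (induction A arbitrary: xs A' x) (auto split: prod.splits simp: Let_def)

text \<open>An unbounded \<open>\<exists>\<close> leaves a bounded one in the matrix. This admits
  the matrix of a premise into independence of premise.\<close>

lemma HR_ex_free: "HR A = (xs, A') \<Longrightarrow> ex_free A'"
  by (induction A arbitrary: xs A') (auto split: prod.splits simp: Let_def)

lemma has_type_foldl_App:
  "has_type L \<Gamma> t (Arrows xs \<tau>) \<Longrightarrow> typed_subst L xs \<Gamma> \<theta> \<Longrightarrow>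
   has_type L \<Gamma> (foldl (\<bullet>) t (map \<theta> (rev [0..<length xs]))) \<tau>"
proof (induction xs arbitrary: \<tau> \<theta>)
  case (Cons x xs)
  have "has_type L \<Gamma> (foldl (\<bullet>) t (map (\<lambda>i. \<theta> (Suc i)) (rev [0..<length xs]))) (x \<rightarrow> \<tau>)"
    by (rule Cons.IH) (use Cons.prems in \<open>auto simp: typed_subst_Cons\<close>)
  then show ?case
    using Cons.prems unfolding list.size add_0_right add_Suc_right rev_upt_Suc
    by (auto simp: typed_subst_Cons comp_def)
qed simp

lemma typed_subst_Var: "typed_subst L xs (xs @ \<Gamma>) Var"
  by (auto simp: typed_subst_def nth_append)

lemma has_type_app_vars:
  "has_type L (xs @ \<Gamma>) t (Arrows xs \<tau>) \<Longrightarrow> n = length xs \<Longrightarrow> has_type L (xs @ \<Gamma>) (app_vars t n) \<tau>"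
  using has_type_foldl_App[OF _ typed_subst_Var] by (auto simp: app_vars_def)

lemma typed_imp_subst:
  "typed_subst L (us @ \<Gamma>) (xs @ map (Arrows xs) us @ \<Gamma>) (imp_subst (length xs) (length us))"
  unfolding typed_subst_append[of L us]
  by (auto simp: typed_subst_def imp_subst_def nth_append intro!: has_type_app_vars)

lemma typed_bex_subst:
  "typed_subst L (xs @ \<rho> # \<Gamma>) (\<rho> # xs @ Star \<rho> # \<Gamma>) (bex_subst (length xs))"
  unfolding typed_subst_append[of L xs] typed_subst_Cons
  by (auto simp: typed_subst_def bex_subst_def nth_append)

lemma typed_rot_subst: "typed_subst L (xs @ \<rho> # \<Gamma>) (\<rho> # xs @ \<Gamma>) (rot_subst (length xs))"
  unfolding typed_subst_append[of L xs] typed_subst_Cons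
  by (auto simp: typed_subst_def rot_subst_def nth_append)

lemma typed_shift_var:
  "typed_subst L (us @ \<Gamma>) (us @ xs @ \<Gamma>) (shift_var (length us) (length xs))"
  unfolding typed_subst_append[of L us]
  by (auto simp: typed_subst_def shift_var_def nth_append)

lemma typed_shift_var_0:
  "typed_subst L \<Gamma> (xs @ \<Gamma>) (\<lambda>i. Var (i + length xs))"
  by (simp add: typed_subst_shift_append)

lemma HR_wf: "HR A = (xs, A') \<Longrightarrow> wf_fm L \<Gamma> A \<Longrightarrow> wf_fm L (xs @ \<Gamma>) A'"
proof (induction A arbitrary: xs A' \<Gamma>)
  case (Or A B)
  obtain as A'' bs B'' where HR: "HR A = (as, A'')" "HR B = (bs, B'')" by fastforce
  then show ?case
    using Or.prems wf_subst[OF Or.IH(1)[OF HR(1)] typed_shift_var_0[of L "as @ \<Gamma>" bs]]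
      wf_subst[OF Or.IH(2)[OF HR(2)] typed_shift_var[of L bs \<Gamma> as]]
    by (auto simp: HR_Or[OF HR] simp del: HR.simps)
next
  case (And A B)
  obtain as A'' bs B'' where HR: "HR A = (as, A'')" "HR B = (bs, B'')" by fastforce
  then show ?case
    using And.prems wf_subst[OF And.IH(1)[OF HR(1)] typed_shift_var_0[of L "as @ \<Gamma>" bs]]
      wf_subst[OF And.IH(2)[OF HR(2)] typed_shift_var[of L bs \<Gamma> as]]
    by (auto simp: HR_And[OF HR] simp del: HR.simps)
next
  case (Imp A B)
  obtain as A'' bs B'' where HR: "HR A = (as, A'')" "HR B = (bs, B'')" by fastforce
  then show ?case
    using Imp.prems wf_subst[OF Imp.IH(1)[OF HR(1)] typed_shift_var[of L as \<Gamma> "map (Arrows as) bs"]]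
      wf_subst[OF Imp.IH(2)[OF HR(2)] typed_imp_subst[of L bs \<Gamma> as]]
    by (auto simp: HR_Imp[OF HR] simp del: HR.simps)
next
  case (All \<rho> A)
  obtain as A'' where HR: "HR A = (as, A'')" by fastforce
  then show ?case
    using All.prems wf_subst[OF All.IH[OF HR] typed_app_subst]
    by (auto simp: HR_All[OF HR] simp del: HR.simps)
next
  case (Ex \<rho> A)
  obtain as A'' where HR: "HR A = (as, A'')" by fastforce
  then show ?case
    using Ex.prems wf_subst[OF Ex.IH[OF HR] typed_bex_subst]
    by (auto simp: HR_Ex[OF HR] nth_append simp del: HR.simps)
next
  case (BAll \<rho> t A)
  obtain as A'' where HR: "HR A = (as, A'')" by fastforce
  then show ?case
    using BAll.prems wf_subst[OF BAll.IH[OF HR] typed_rot_subst]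
      has_type_subst[OF _ typed_shift_var_0]
    by (auto simp: HR_BAll[OF HR] simp del: HR.simps)
next
  case (BEx \<rho> t A)
  obtain as A'' where HR: "HR A = (as, A'')" by fastforce
  then show ?case
    using BEx.prems wf_subst[OF BEx.IH[OF HR] typed_rot_subst]
      has_type_subst[OF _ typed_shift_var_0]
    by (auto simp: HR_BEx[OF HR] simp del: HR.simps)
qed auto

context il_theory
begin

lemma Sub_foldl_App:
  "\<Gamma> \<parallel> \<Delta> \<turnstile> Sub (Arrows xs \<tau>) t u \<Longrightarrow> typed_subst L xs \<Gamma> \<theta> \<Longrightarrow>
   \<Gamma> \<parallel> \<Delta> \<turnstile> Sub \<tau> (foldl (\<bullet>) t (map \<theta> (rev [0..<length xs]))) (foldl (\<bullet>) u (map \<theta> (rev [0..<length xs])))"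
proof (induction xs arbitrary: \<tau> \<theta>)
  case (Cons x xs)
  let ?us = "map (\<lambda>i. \<theta> (Suc i)) (rev [0..<length xs])"
  have "\<Gamma> \<parallel> \<Delta> \<turnstile> Sub (x \<rightarrow> \<tau>) (foldl (\<bullet>) t ?us) (foldl (\<bullet>) u ?us)"
    by (rule Cons.IH) (use Cons.prems in \<open>auto simp: typed_subst_Cons\<close>)
  from Sub_app[OF this, of "\<theta> 0"] show ?case
    using Cons.prems unfolding list.size add_0_right add_Suc_right rev_upt_Suc
    by (auto simp: typed_subst_Cons comp_def)
qed simp

text \<open>The arguments \<open>xs\<close> lie outside the set of growing indices and hence are the
  same for both substitutions, so inclusion of the functions passes to their values.\<close>

lemma mono_at_subst_imp:
  assumes "mono_at {..<length us} (us @ \<Gamma>) B"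
  shows "mono_at ((+) (length xs) ` {..<length us}) (xs @ map (Arrows xs) us @ \<Gamma>)
    (subst (imp_subst (length xs) (length us)) B)"
proof (rule mono_at_subst[OF assms typed_imp_subst])
  let ?n = "length xs" and ?m = "length us"
  fix \<Gamma>' \<Delta> \<theta> \<theta>' i
  assume rel: "sub_related ((+) ?n ` {..<?m}) (xs @ map (Arrows xs) us @ \<Gamma>) \<Gamma>' \<Delta> \<theta> \<theta>'"
  then have eq: "j \<notin> (+) ?n ` {..<?m} \<Longrightarrow> \<theta> j = \<theta>' j" for j by (auto simp: sub_related_def)
  show "subst_tm \<theta> (imp_subst ?n ?m i) = subst_tm \<theta>' (imp_subst ?n ?m i)" if "i \<notin> {..<?m}"
    using that by (auto simp: imp_subst_def intro!: eq)
  show "\<Gamma>' \<parallel> \<Delta> \<turnstile> Sub ((us @ \<Gamma>) ! i) (subst_tm \<theta> (imp_subst ?n ?m i)) (subst_tm \<theta>' (imp_subst ?n ?m i))"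
    if "i \<in> {..<?m}"
  proof -
    have i: "i < ?m" using that by simp
    have "\<Gamma>' \<parallel> \<Delta> \<turnstile> Sub ((xs @ map (Arrows xs) us @ \<Gamma>) ! (?n + i)) (\<theta> (?n + i)) (\<theta>' (?n + i))"
      by (rule sub_relatedD[OF rel]) (use i in simp)
    then have "\<Gamma>' \<parallel> \<Delta> \<turnstile> Sub (Arrows xs (us ! i)) (\<theta> (?n + i)) (\<theta>' (?n + i))"
      using i by (simp add: nth_append)
    moreover have "typed_subst L xs \<Gamma>' \<theta>"
      using rel by (auto simp: sub_related_def typed_subst_append[of L xs])
    ultimately have "\<Gamma>' \<parallel> \<Delta> \<turnstile> Sub (us ! i) (foldl (\<bullet>) (\<theta> (?n + i)) (map \<theta> (rev [0..<?n])))
        (foldl (\<bullet>) (\<theta>' (?n + i)) (map \<theta> (rev [0..<?n])))"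
      by (rule Sub_foldl_App)
    moreover have "map \<theta> (rev [0..<?n]) = map \<theta>' (rev [0..<?n])"
      by (auto intro!: eq)
    ultimately show ?thesis using i by (simp add: imp_subst_def subst_app_vars nth_append del: map_eq_conv)
  qed
qed

text \<open>The first \<open>m\<close> indices may grow as well, because the shifted formula does
  not mention them. This lets both tuples of a disjunction or conjunction grow together.\<close>

lemma mono_at_shift_0:
  assumes "mono_at {..<n} (xs @ \<Gamma>) A" "m = length us" "k = m + n"
  shows "mono_at {..<k} (us @ xs @ \<Gamma>) (subst (\<lambda>i. Var (i + m)) A)"
  by (rule mono_at_rename[OF assms(1)]) (use assms(2,3) in \<open>auto intro: typed_subst_shift_append\<close>)

lemma mono_at_shift:
  assumes "mono_at {..<m} (us @ \<Gamma>) A" "m = length us" "n = length xs" "k \<le> m + n"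
  shows "mono_at {..<k} (us @ xs @ \<Gamma>) (shift m n A)"
  unfolding shift_var_rename
  by (rule mono_at_rename[OF assms(1)])
    (use assms(2-4) typed_shift_var[of L us \<Gamma> xs] in \<open>auto simp: shift_var_rename split: if_splits\<close>)

lemma mono_at_rot:
  assumes "mono_at {..<length xs} (xs @ \<rho> # \<Gamma>) A"
  shows "mono_at (Suc ` {..<length xs}) (\<rho> # xs @ \<Gamma>) (subst (rot_subst (length xs)) A)"
  unfolding rot_subst_def[abs_def]
  by (rule mono_at_rename[OF assms typed_rot_subst[unfolded rot_subst_def[abs_def]]])
    (auto split: if_splits)

lemma mono_at_empty: "mono_at {} \<Gamma> A"
proof (rule mono_atI)
  fix \<Gamma>' \<Delta> \<theta> \<theta>'
  assume "sub_related {} \<Gamma> \<Gamma>' \<Delta> \<theta> \<theta>'"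
  then have "\<theta> = \<theta>'" by (auto simp: sub_related_def)
  then show "\<Gamma>' \<parallel> \<Delta> \<turnstile> subst \<theta> A \<Longrightarrow> \<Gamma>' \<parallel> \<Delta> \<turnstile> subst \<theta>' A" by simp
qed

text \<open>Witnesses occur positively: the premise of an implication has its own ones bound by the
  universal prefix, the new \<open>Z\<close> bounds an existential quantifier, and the terms of the
  original bounded quantifiers contain no witness.\<close>

lemma HR_mono: "HR A = (xs, A') \<Longrightarrow> wf_fm L \<Gamma> A \<Longrightarrow> mono_at {..<length xs} (xs @ \<Gamma>) A'"
proof (induction A arbitrary: xs A' \<Gamma>)
  case (Or A B)
  obtain as A'' bs B'' where HR: "HR A = (as, A'')" "HR B = (bs, B'')" by fastforce
  have wf: "wf_fm L (xs @ \<Gamma>) A'" by (rule HR_wf[OF Or.prems])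
  show ?case
    using Or.prems wf mono_at_shift_0[OF Or.IH(1)[OF HR(1)], of \<Gamma> "length bs" bs]
      mono_at_shift[OF Or.IH(2)[OF HR(2)], of \<Gamma> "length as" as]
    by (auto simp: HR_Or[OF HR] simp del: HR.simps intro!: mono_at_Or)
next
  case (And A B)
  obtain as A'' bs B'' where HR: "HR A = (as, A'')" "HR B = (bs, B'')" by fastforce
  show ?case
    using And.prems mono_at_shift_0[OF And.IH(1)[OF HR(1)], of \<Gamma> "length bs" bs]
      mono_at_shift[OF And.IH(2)[OF HR(2)], of \<Gamma> "length as" as]
    by (auto simp: HR_And[OF HR] simp del: HR.simps intro!: mono_at_And)
next
  case (Imp A B)
  obtain as A'' bs B'' where HR: "HR A = (as, A'')" "HR B = (bs, B'')" by fastforce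
  let ?n = "length as" and ?m = "length bs"
  have wf: "wf_fm L (xs @ \<Gamma>) A'" by (rule HR_wf[OF Imp.prems])
  have A': "xs = map (Arrows as) bs" "A' = Alls as (Imp (shift ?n ?m A'') (subst (imp_subst ?n ?m) B''))"
    using Imp.prems(1) unfolding HR_Imp[OF HR] by auto
  \<comment> \<open>After the shift the premise skips the \<open>?m\<close> indices starting at
    \<open>?n\<close>, which are those of the functions \<open>U\<close>.\<close>
  have "subst \<theta> (shift ?n ?m A'') = subst \<theta>' (shift ?n ?m A'')"
    if "\<And>i. i \<notin> (+) ?n ` {..<?m} \<Longrightarrow> \<theta> i = \<theta>' i" for \<theta> \<theta>'
    unfolding subst_subst by (rule subst_cong) (auto simp: shift_var_def intro!: that)
  then have "mono_at ((+) ?n ` {..<?m}) (as @ map (Arrows as) bs @ \<Gamma>)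
      (Imp (shift ?n ?m A'') (subst (imp_subst ?n ?m) B''))"
    by (rule mono_at_Imp[rotated 2])
      (use Imp.prems wf mono_at_subst_imp[OF Imp.IH(2)[OF HR(2)], of \<Gamma> as] in \<open>simp_all add: A'\<close>)
  then show ?case unfolding A' by (simp add: mono_at_Alls)
next
  case (All \<rho> A)
  obtain as A'' where HR: "HR A = (as, A'')" by fastforce
  show ?case
    using All.prems mono_at_subst_app[OF All.IH[OF HR]]
    by (auto simp: HR_All[OF HR] simp del: HR.simps)
next
  case (Ex \<rho> A)
  obtain as A'' where HR: "HR A = (as, A'')" by fastforce
  let ?n = "length as"
  have wf: "wf_fm L (xs @ \<Gamma>) A'" by (rule HR_wf[OF Ex.prems])
  have A': "xs = as @ [Star \<rho>]" "A' = BEx \<rho> (Var ?n) (subst (bex_subst ?n) A'')"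
    using Ex.prems(1) unfolding HR_Ex[OF HR] by auto
  \<comment> \<open>\<open>Suc ?n\<close> includes the index \<open>?n\<close> of the new witness
    \<open>Z\<close>, which is also the bounding term.\<close>
  have "mono_at {..<Suc ?n} (as @ Star \<rho> # \<Gamma>) A'"
    unfolding A'
  proof (rule mono_at_BEx)
    have "mono_at {..<?n} (as @ \<rho> # \<Gamma>) A''" using Ex.IH[OF HR] Ex.prems by simp
    then show "mono_at (Suc ` {..<Suc ?n}) (\<rho> # as @ Star \<rho> # \<Gamma>) (subst (bex_subst ?n) A'')"
      unfolding bex_subst_def[abs_def]
      by (rule mono_at_rename[OF _ typed_bex_subst[unfolded bex_subst_def[abs_def]]])
        (auto split: if_splits)
    show "wf_fm L (as @ Star \<rho> # \<Gamma>) (BEx \<rho> (Var ?n) (subst (bex_subst ?n) A''))"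
      using wf A' by simp
    show "\<Gamma>' \<parallel> \<Delta> \<turnstile> Sub (Star \<rho>) (subst_tm \<theta> (Var ?n)) (subst_tm \<theta>' (Var ?n))"
      if "sub_related {..<Suc ?n} (as @ Star \<rho> # \<Gamma>) \<Gamma>' \<Delta> \<theta> \<theta>'" for \<Gamma>' \<Delta> \<theta> \<theta>'
      using sub_relatedD[OF that, of ?n] by simp
  qed
  then show ?case using A' by simp
next
  case (BAll \<rho> t A)
  obtain as A'' where HR: "HR A = (as, A'')" by fastforce
  have wf: "wf_fm L (xs @ \<Gamma>) A'" by (rule HR_wf[OF BAll.prems])
  have A': "xs = as" "A' = BAll \<rho> (shift_tm 0 (length as) t) (subst (rot_subst (length as)) A'')"
    using BAll.prems(1) unfolding HR_BAll[OF HR] by auto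
  show ?case
    unfolding A'
  proof (rule mono_at_BAll)
    show "mono_at (Suc ` {..<length as}) (\<rho> # as @ \<Gamma>) (subst (rot_subst (length as)) A'')"
      using BAll.IH[OF HR] BAll.prems by (intro mono_at_rot) simp
    show "subst_tm \<theta> (shift_tm 0 (length as) t) = subst_tm \<theta>' (shift_tm 0 (length as) t)"
      if "\<And>i. i \<notin> {..<length as} \<Longrightarrow> \<theta> i = \<theta>' i" for \<theta> \<theta>'
      unfolding subst_tm_subst_tm by (rule subst_tm_cong) (use that in auto)
  qed (use wf A' in simp)
next
  case (BEx \<rho> t A)
  obtain as A'' where HR: "HR A = (as, A'')" by fastforce
  have wf: "wf_fm L (xs @ \<Gamma>) A'" by (rule HR_wf[OF BEx.prems])
  have A': "xs = as" "A' = BEx \<rho> (shift_tm 0 (length as) t) (subst (rot_subst (length as)) A'')"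
    using BEx.prems(1) unfolding HR_BEx[OF HR] by auto
  show ?case
    unfolding A'
  proof (rule mono_at_BEx)
    show "mono_at (Suc ` {..<length as}) (\<rho> # as @ \<Gamma>) (subst (rot_subst (length as)) A'')"
      using BEx.IH[OF HR] BEx.prems by (intro mono_at_rot) simp
    fix \<Gamma>' \<Delta> \<theta> \<theta>'
    assume rel: "sub_related {..<length as} (as @ \<Gamma>) \<Gamma>' \<Delta> \<theta> \<theta>'"
    let ?t = "shift_tm 0 (length as) t"
    have "subst_tm \<theta> ?t = subst_tm \<theta>' ?t"
      unfolding subst_tm_subst_tm by (rule subst_tm_cong) (use rel in \<open>auto simp: sub_related_def\<close>)
    moreover have "has_type L \<Gamma>' (subst_tm \<theta> ?t) (Star \<rho>)"
      by (rule has_type_subst[of L "as @ \<Gamma>"]) (use wf A' rel in \<open>auto simp: sub_related_def\<close>)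
    ultimately show "\<Gamma>' \<parallel> \<Delta> \<turnstile> Sub (Star \<rho>) (subst_tm \<theta> ?t) (subst_tm \<theta>' ?t)"
      using Sub_refl by metis
  qed (use wf A' in simp)
qed (auto simp: mono_at_empty)

end

section \<open>Prenexing the witnesses\<close>

context il_theory
begin

lemma Or_Exs_I1:
  assumes "\<Gamma> \<parallel> \<Delta> \<turnstile> Exs xs A" "wf_fm L (us @ \<Gamma>) B" "\<And>\<tau> \<Gamma>. has_type L \<Gamma> (inh \<tau>) \<tau>"
  shows "\<Gamma> \<parallel> \<Delta> \<turnstile> Exs (us @ xs) (Or (shift 0 (length us) A) (shift (length us) (length xs) B))"
proof (rule Exs_E_single[OF assms(1)])
  let ?n = "length xs" and ?m = "length us"
  have wf: "wf_fm L (xs @ \<Gamma>) A" using deriv_wf[OF assms(1)] by simp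
  have wfM: "wf_fm L (us @ xs @ \<Gamma>) (Or (shift 0 ?m A) (shift ?m ?n B))"
    using wf_subst[OF wf typed_shift_var_0] wf_subst[OF assms(2) typed_shift_var] by simp
  then show "wf_fm L \<Gamma> (Exs (us @ xs) (Or (shift 0 ?m A) (shift ?m ?n B)))" by simp
  \<comment> \<open>The combined tuple starts with \<open>us\<close>, filled by default terms; the
    variables \<open>xs\<close> of the present context follow, counted from
    \<open>?m\<close>.\<close>
  define ts where "ts i = (if i < ?m then inh (us ! i) else Var (i - ?m))" for i
  have ts: "typed_subst L (us @ xs) (xs @ \<Gamma>) ts"
    unfolding typed_subst_append[of L us]
    using assms(3) by (auto simp: typed_subst_def ts_def nth_append)
  let ?\<theta> = "prepend (?m + ?n) ts (shift_var 0 ?n)"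
  have typed: "typed_subst L ((us @ xs) @ \<Gamma>) (xs @ \<Gamma>) ?\<theta>"
    by (rule typed_subst_prepend[OF ts]) (simp_all add: typed_shift_var_0)
  have eq: "subst ?\<theta> (shift 0 ?m A) = A"
  proof -
    have "subst ?\<theta> (shift 0 ?m A) = subst Var A"
      unfolding subst_subst by (rule subst_cong) (auto simp: prepend_def ts_def)
    then show ?thesis by simp
  qed
  show "xs @ \<Gamma> \<parallel> {A} \<turnstile> shift 0 ?n (Exs (us @ xs) (Or (shift 0 ?m A) (shift ?m ?n B)))"
  proof (rule Exs_subst_I[OF _ ts, where n = "?m + ?n" and \<Gamma>' = \<Gamma>])
    show "xs @ \<Gamma> \<parallel> {A} \<turnstile> subst ?\<theta> (Or (shift 0 ?m A) (shift ?m ?n B))"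
      unfolding subst.simps eq
      by (rule orI1[OF hyp_in[OF wf]]) (use wf_subst[OF _ typed, of "shift ?m ?n B"] wfM in simp)
  qed (use wfM in \<open>simp_all add: typed_shift_var_0\<close>)
qed

lemma Or_Exs_I2:
  assumes "\<Gamma> \<parallel> \<Delta> \<turnstile> Exs us B" "wf_fm L (xs @ \<Gamma>) A" "\<And>\<tau> \<Gamma>. has_type L \<Gamma> (inh \<tau>) \<tau>"
  shows "\<Gamma> \<parallel> \<Delta> \<turnstile> Exs (us @ xs) (Or (shift 0 (length us) A) (shift (length us) (length xs) B))"
proof (rule Exs_E_single[OF assms(1)])
  let ?n = "length xs" and ?m = "length us"
  have wf: "wf_fm L (us @ \<Gamma>) B" using deriv_wf[OF assms(1)] by simp
  have wfM: "wf_fm L (us @ xs @ \<Gamma>) (Or (shift 0 ?m A) (shift ?m ?n B))"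
    using wf_subst[OF assms(2) typed_shift_var_0] wf_subst[OF wf typed_shift_var] by simp
  then show "wf_fm L \<Gamma> (Exs (us @ xs) (Or (shift 0 ?m A) (shift ?m ?n B)))" by simp
  define ts where "ts i = (if i < ?m then Var i else inh (xs ! (i - ?m)))" for i
  have ts: "typed_subst L (us @ xs) (us @ \<Gamma>) ts"
    unfolding typed_subst_append[of L us]
    using assms(3) by (auto simp: typed_subst_def ts_def nth_append)
  let ?\<theta> = "prepend (?m + ?n) ts (shift_var 0 ?m)"
  have typed: "typed_subst L ((us @ xs) @ \<Gamma>) (us @ \<Gamma>) ?\<theta>"
    by (rule typed_subst_prepend[OF ts]) (simp_all add: typed_shift_var_0)
  have eq: "subst ?\<theta> (shift ?m ?n B) = B"
  proof -
    have "subst ?\<theta> (shift ?m ?n B) = subst Var B"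
      unfolding subst_subst by (rule subst_cong) (auto simp: prepend_def ts_def shift_var_def)
    then show ?thesis by simp
  qed
  show "us @ \<Gamma> \<parallel> {B} \<turnstile> shift 0 ?m (Exs (us @ xs) (Or (shift 0 ?m A) (shift ?m ?n B)))"
  proof (rule Exs_subst_I[OF _ ts, where n = "?m + ?n" and \<Gamma>' = \<Gamma>])
    show "us @ \<Gamma> \<parallel> {B} \<turnstile> subst ?\<theta> (Or (shift 0 ?m A) (shift ?m ?n B))"
      unfolding subst.simps eq
      by (rule orI2[OF hyp_in[OF wf]]) (use wf_subst[OF _ typed, of "shift 0 ?m A"] wfM in simp)
  qed (use wfM in \<open>simp_all add: typed_shift_var_0\<close>)
qed

text \<open>In the context of both tuples the variables \<open>xs\<close> are themselves the
  witnesses. This lemma and \<open>Exs_shift_I'\<close> serve to split a common prefix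
  again.\<close>

lemma Exs_shift_I:
  assumes "us @ xs @ \<Gamma> \<parallel> \<Delta> \<turnstile> shift 0 (length us) A" "wf_fm L (xs @ \<Gamma>) A"
  shows "us @ xs @ \<Gamma> \<parallel> \<Delta> \<turnstile> shift 0 (length us + length xs) (Exs xs A)"
proof (rule Exs_subst_I[where n = "length xs" and ts = "\<lambda>i. Var (i + length us)" and \<Gamma>' = \<Gamma>])
  have "prepend (length xs) (\<lambda>i. Var (i + length us)) (shift_var 0 (length us + length xs))
      = (shift_var 0 (length us) :: nat \<Rightarrow> 'f tm)"
    by (auto simp: prepend_def)
  then show "us @ xs @ \<Gamma> \<parallel> \<Delta> \<turnstile> subst (prepend (length xs) (\<lambda>i. Var (i + length us))
      (shift_var 0 (length us + length xs))) A"
    using assms(1) by simp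
  show "typed_subst L \<Gamma> (us @ xs @ \<Gamma>) (shift_var 0 (length us + length xs))"
    using typed_shift_var_0[of L \<Gamma> "us @ xs"] by simp
qed (use assms(2) in \<open>auto simp: typed_subst_def nth_append\<close>)

lemma Exs_shift_I':
  assumes "us @ xs @ \<Gamma> \<parallel> \<Delta> \<turnstile> shift (length us) (length xs) B" "wf_fm L (us @ \<Gamma>) B"
  shows "us @ xs @ \<Gamma> \<parallel> \<Delta> \<turnstile> shift 0 (length us + length xs) (Exs us B)"
proof (rule Exs_subst_I[where n = "length us" and ts = Var and \<Gamma>' = \<Gamma>])
  have "prepend (length us) Var (shift_var 0 (length us + length xs))
      = (shift_var (length us) (length xs) :: nat \<Rightarrow> 'f tm)"
    by (auto simp: prepend_def shift_var_def)
  then show "us @ xs @ \<Gamma> \<parallel> \<Delta> \<turnstile> subst (prepend (length us) Var (shift_var 0 (length us + length xs))) B"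
    using assms(1) by simp
  show "typed_subst L \<Gamma> (us @ xs @ \<Gamma>) (shift_var 0 (length us + length xs))"
    using typed_shift_var_0[of L \<Gamma> "us @ xs"] by simp
qed (use assms(2) in \<open>auto simp: typed_subst_def nth_append\<close>)

lemma Or_Exs_iff:
  assumes A: "wf_fm L (xs @ \<Gamma>) A" and B: "wf_fm L (us @ \<Gamma>) B"
    and inh: "\<And>\<tau> \<Gamma>. has_type L \<Gamma> (inh \<tau>) \<tau>"
  shows "\<Gamma> \<parallel> \<Delta> \<turnstile> Or (Exs xs A) (Exs us B) \<longleftrightarrow>
    \<Gamma> \<parallel> \<Delta> \<turnstile> Exs (us @ xs) (Or (shift 0 (length us) A) (shift (length us) (length xs) B))"
    (is "?l \<longleftrightarrow> \<Gamma> \<parallel> \<Delta> \<turnstile> Exs _ ?M")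
proof
  assume ?l
  then show "\<Gamma> \<parallel> \<Delta> \<turnstile> Exs (us @ xs) ?M"
    by (rule orE[OF _ Or_Exs_I1[OF hyp_in B inh] Or_Exs_I2[OF hyp_in A inh]]) (use A B in simp_all)
next
  let ?n = "length xs" and ?m = "length us"
  assume r: "\<Gamma> \<parallel> \<Delta> \<turnstile> Exs (us @ xs) ?M"
  then have wf: "wf_fm L (us @ xs @ \<Gamma>) ?M" by (auto dest: deriv_wf)
  show ?l
  proof (rule Exs_E_single[OF r])
    have wfs: "wf_fm L (us @ xs @ \<Gamma>) (shift 0 (?m + ?n) (Exs xs A))"
      "wf_fm L (us @ xs @ \<Gamma>) (shift 0 (?m + ?n) (Exs us B))"
      using wf_subst[OF _ typed_shift_var_0[of L \<Gamma> "us @ xs"]] A B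
      by (simp_all del: subst_Exs)
    have "us @ xs @ \<Gamma> \<parallel> {?M} \<turnstile> Or (shift 0 (?m + ?n) (Exs xs A)) (shift 0 (?m + ?n) (Exs us B))"
    proof (rule orE[OF hyp_in[OF wf]])
      show "us @ xs @ \<Gamma> \<parallel> insert (shift 0 ?m A) {?M} \<turnstile>
          Or (shift 0 (?m + ?n) (Exs xs A)) (shift 0 (?m + ?n) (Exs us B))"
        by (rule orI1[OF Exs_shift_I[OF hyp_in A] wfs(2)]) (use wf in simp)
      show "us @ xs @ \<Gamma> \<parallel> insert (shift ?m ?n B) {?M} \<turnstile>
          Or (shift 0 (?m + ?n) (Exs xs A)) (shift 0 (?m + ?n) (Exs us B))"
        by (rule orI2[OF Exs_shift_I'[OF hyp_in B] wfs(1)]) (use wf in simp)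
    qed
    then show "(us @ xs) @ \<Gamma> \<parallel> {?M} \<turnstile> shift 0 (length (us @ xs)) (Or (Exs xs A) (Exs us B))"
      by (simp del: subst_Exs)
  qed (use A B in simp)
qed

lemma And_Exs_iff:
  assumes A: "wf_fm L (xs @ \<Gamma>) A" and B: "wf_fm L (us @ \<Gamma>) B"
  shows "\<Gamma> \<parallel> \<Delta> \<turnstile> And (Exs xs A) (Exs us B) \<longleftrightarrow>
    \<Gamma> \<parallel> \<Delta> \<turnstile> Exs (us @ xs) (And (shift 0 (length us) A) (shift (length us) (length xs) B))"
    (is "?l \<longleftrightarrow> \<Gamma> \<parallel> \<Delta> \<turnstile> Exs _ ?M")
proof
  let ?n = "length xs" and ?m = "length us"
  assume l: ?l
  define C where "C = Exs (us @ xs) ?M"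
  have wfM: "wf_fm L (us @ xs @ \<Gamma>) ?M"
    using wf_subst[OF A typed_shift_var_0] wf_subst[OF B typed_shift_var] by simp
  then have wfC: "wf_fm L \<Gamma> C" by (simp add: C_def)
  have "\<Gamma> \<parallel> \<Delta> \<turnstile> C"
  proof (rule Exs_E[OF andE1[OF l] _ wfC])
    let ?\<Delta> = "insert A (shift 0 ?n ` \<Delta>)"
    have "ups ?m (\<lambda>i. Var (i + ?n)) = (shift_var ?m ?n :: nat \<Rightarrow> 'f tm)"
      by (auto simp: ups_def shift_var_def)
    then have B': "xs @ \<Gamma> \<parallel> ?\<Delta> \<turnstile> Exs us (shift ?m ?n B)"
      using deriv_insert[OF deriv_subst[OF andE2[OF l] typed_shift_var_0[of L \<Gamma> xs]], of A] by simp
    show "xs @ \<Gamma> \<parallel> ?\<Delta> \<turnstile> shift 0 ?n C"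
    proof (rule Exs_E[OF B'])
      show "wf_fm L (xs @ \<Gamma>) (shift 0 ?n C)"
        using wf_subst[OF wfC typed_shift_var_0] by simp
      let ?\<Delta>' = "insert (shift ?m ?n B) (shift 0 ?m ` ?\<Delta>)"
      have eq: "prepend (?m + ?n) Var (\<lambda>i. Var (i + (?m + ?n))) = (Var :: nat \<Rightarrow> 'f tm)"
        by (auto simp: prepend_def)
      have M: "us @ xs @ \<Gamma> \<parallel> ?\<Delta>' \<turnstile> ?M"
        using wfM by (intro andI hyp) auto
      have "us @ xs @ \<Gamma> \<parallel> ?\<Delta>' \<turnstile> subst (\<lambda>i. Var (i + (?m + ?n))) C"
        unfolding C_def
        by (rule Exs_subst_I[where n = "?m + ?n" and ts = Var and \<Gamma>' = \<Gamma>])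
          (use M wfM typed_subst_Var[of L "us @ xs" \<Gamma>] typed_shift_var_0[of L \<Gamma> "us @ xs"]
            in \<open>simp_all add: eq\<close>)
      then show "us @ xs @ \<Gamma> \<parallel> ?\<Delta>' \<turnstile> shift 0 ?m (shift 0 ?n C)" by (simp add: ac_simps)
    qed
  qed
  then show "\<Gamma> \<parallel> \<Delta> \<turnstile> Exs (us @ xs) ?M" by (simp add: C_def)
next
  let ?n = "length xs" and ?m = "length us"
  assume r: "\<Gamma> \<parallel> \<Delta> \<turnstile> Exs (us @ xs) ?M"
  then have wf: "wf_fm L (us @ xs @ \<Gamma>) ?M" by (auto dest: deriv_wf)
  show ?l
  proof (rule Exs_E_single[OF r])
    have "us @ xs @ \<Gamma> \<parallel> {?M} \<turnstile> And (shift 0 (?m + ?n) (Exs xs A)) (shift 0 (?m + ?n) (Exs us B))"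
      by (rule andI[OF Exs_shift_I[OF andE1 A] Exs_shift_I'[OF andE2 B]]; rule hyp_in[OF wf])
    then show "(us @ xs) @ \<Gamma> \<parallel> {?M} \<turnstile> shift 0 (length (us @ xs)) (And (Exs xs A) (Exs us B))"
      by (simp del: subst_Exs)
  qed (use A B in simp)
qed

text \<open>For an actual \<open>z\<close> its singleton serves as \<open>Z\<close>; conversely a
  \<open>z \<in> Z\<close> satisfying the matrix is a witness, and its membership is
  forgotten.\<close>

lemma Ex_Exs_iff:
  assumes A: "wf_fm L (xs @ \<rho> # \<Gamma>) A"
  shows "\<Gamma> \<parallel> \<Delta> \<turnstile> Ex \<rho> (Exs xs A) \<longleftrightarrow>
    \<Gamma> \<parallel> \<Delta> \<turnstile> Exs (xs @ [Star \<rho>]) (BEx \<rho> (Var (length xs)) (subst (bex_subst (length xs)) A))"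
    (is "?l \<longleftrightarrow> \<Gamma> \<parallel> \<Delta> \<turnstile> Exs _ ?M")
proof
  let ?n = "length xs"
  have wfM: "wf_fm L ((xs @ [Star \<rho>]) @ \<Gamma>) ?M"
    using wf_subst[OF A typed_bex_subst] by (simp add: nth_append)
  assume ?l
  then have l: "\<Gamma> \<parallel> \<Delta> \<turnstile> Exs (xs @ [\<rho>]) A" by (simp add: Exs_append)
  show "\<Gamma> \<parallel> \<Delta> \<turnstile> Exs (xs @ [Star \<rho>]) ?M"
  proof (rule Exs_E_single[OF l])
    let ?\<Gamma> = "(xs @ [\<rho>]) @ \<Gamma>"
    \<comment> \<open>Index \<open>?n\<close> is \<open>z\<close> in the present context and
      \<open>Z\<close> in the prefix to be proved, so \<open>Z\<close> receives the singleton of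
      \<open>Var ?n\<close>.\<close>
    define ts :: "nat \<Rightarrow> 'f tm" where "ts i = (if i < ?n then Var i else Con (SingC \<rho>) \<bullet> Var ?n)" for i
    let ?S = "shift_var 0 (length (xs @ [\<rho>]))"
    let ?\<theta> = "prepend (Suc ?n) ts ?S"
    have ts: "typed_subst L (xs @ [Star \<rho>]) ?\<Gamma> ts"
      unfolding typed_subst_append[of L xs]
      by (auto simp: typed_subst_def ts_def nth_append)
    have S: "typed_subst L \<Gamma> ?\<Gamma> ?S" using typed_shift_var_0[of L \<Gamma> "xs @ [\<rho>]"] by simp
    show "?\<Gamma> \<parallel> {A} \<turnstile> subst ?S (Exs (xs @ [Star \<rho>]) ?M)"
    proof (rule Exs_subst_I[OF _ ts _ wfM S])
      show "?\<Gamma> \<parallel> {A} \<turnstile> subst ?\<theta> ?M"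
      proof (rule bex_subst_I[OF _ _ wfM typed_subst_prepend[OF ts S]])
        have n: "has_type L ?\<Gamma> (Var ?n) \<rho>" by (simp add: nth_append)
        have "?\<Gamma> \<parallel> {A} \<turnstile> Mem \<rho> (Var ?n) (Con (SingC \<rho>) \<bullet> Var ?n)"
          by (rule impE[OF andE2[OF axI[OF sing[OF n n]]] axI[OF eq_refl[OF n]]])
        then show "?\<Gamma> \<parallel> {A} \<turnstile> Mem \<rho> (Var ?n) (subst_tm ?\<theta> (Var ?n))"
          by (simp add: prepend_def ts_def)
        have "subst (case_nat (Var ?n) ?\<theta>) (subst (bex_subst ?n) A) = subst Var A"
          unfolding subst_subst
          by (rule subst_cong) (auto simp: bex_subst_def prepend_def ts_def)
        then show "?\<Gamma> \<parallel> {A} \<turnstile> subst (case_nat (Var ?n) ?\<theta>) (subst (bex_subst ?n) A)"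
          using A by (simp add: hyp_in)
      qed simp
    qed simp
  qed (use wfM in simp)
next
  let ?n = "length xs"
  assume r: "\<Gamma> \<parallel> \<Delta> \<turnstile> Exs (xs @ [Star \<rho>]) ?M"
  then have wf: "wf_fm L (xs @ Star \<rho> # \<Gamma>) ?M" by (auto dest: deriv_wf)
  define C where "C = Exs (xs @ [\<rho>]) A"
  have wfC: "wf_fm L \<Gamma> C" using A by (simp add: C_def)
  have "\<Gamma> \<parallel> \<Delta> \<turnstile> C"
  proof (rule Exs_E_single[OF r _ wfC])
    let ?\<Gamma> = "xs @ Star \<rho> # \<Gamma>"
    \<comment> \<open>The parameters are moved past \<open>xs\<close>, past \<open>Z\<close> and
      past the member \<open>z\<close>, hence \<open>?n + 2\<close>.\<close>
    let ?S = "\<lambda>i. Var (i + (?n + 2)) :: 'f tm"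
    have "?\<Gamma> \<parallel> {?M} \<turnstile> subst (\<lambda>i. Var (i + Suc ?n)) C"
    proof (rule bex_E[OF hyp_in[OF wf]])
      let ?\<Delta> = "insert (Mem \<rho> (Var 0) (shift_tm 0 1 (Var ?n)))
        (insert (subst (bex_subst ?n) A) (shift 0 1 ` {?M}))"
      define ts :: "nat \<Rightarrow> 'f tm" where "ts i = (if i = ?n then Var 0 else Var (Suc i))" for i
      have eq: "prepend (Suc ?n) ts ?S = bex_subst ?n"
        by (auto simp: prepend_def ts_def bex_subst_def)
      have wfA: "wf_fm L (\<rho> # ?\<Gamma>) (subst (bex_subst ?n) A)" using wf by simp
      have ts: "typed_subst L (xs @ [\<rho>]) (\<rho> # ?\<Gamma>) ts"
        unfolding typed_subst_append[of L xs]
        by (auto simp: typed_subst_def ts_def nth_append)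
      have "\<rho> # ?\<Gamma> \<parallel> ?\<Delta> \<turnstile> subst ?S C"
        unfolding C_def
      proof (rule Exs_subst_I[OF _ ts])
        show "\<rho> # ?\<Gamma> \<parallel> ?\<Delta> \<turnstile> subst (prepend (Suc ?n) ts ?S) A"
          unfolding eq by (rule hyp) (use wfA in auto)
        show "typed_subst L \<Gamma> (\<rho> # ?\<Gamma>) ?S"
          using typed_shift_var_0[of L \<Gamma> "\<rho> # xs @ [Star \<rho>]"] by simp
      qed (use A in simp_all)
      then show "\<rho> # ?\<Gamma> \<parallel> ?\<Delta> \<turnstile> shift 0 1 (subst (\<lambda>i. Var (i + Suc ?n)) C)" by simp
    qed (use wf_subst[OF wfC typed_shift_var_0[of L \<Gamma> "xs @ [Star \<rho>]"]] in simp)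
    then show "(xs @ [Star \<rho>]) @ \<Gamma> \<parallel> {?M} \<turnstile> shift 0 (length (xs @ [Star \<rho>])) C" by simp
  qed
  then show ?l by (simp add: C_def Exs_append)
qed

text \<open>The bound \<open>t\<close> does not contain \<open>xs\<close>, so both directions merely
  interchange existential quantifiers.\<close>

lemma BEx_Exs_iff:
  assumes t: "has_type L \<Gamma> t (Star \<rho>)" and A: "wf_fm L (xs @ \<rho> # \<Gamma>) A"
  shows "\<Gamma> \<parallel> \<Delta> \<turnstile> BEx \<rho> t (Exs xs A) \<longleftrightarrow>
    \<Gamma> \<parallel> \<Delta> \<turnstile> Exs xs (BEx \<rho> (shift_tm 0 (length xs) t) (subst (rot_subst (length xs)) A))"
    (is "?l \<longleftrightarrow> \<Gamma> \<parallel> \<Delta> \<turnstile> Exs _ ?M")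
proof
  let ?n = "length xs"
  have wfM: "wf_fm L (xs @ \<Gamma>) ?M"
    using wf_subst[OF A typed_rot_subst] has_type_subst[OF t typed_shift_var_0] by simp
  define C where "C = Exs xs ?M"
  have wfC: "wf_fm L \<Gamma> C" using wfM by (simp add: C_def)
  assume ?l
  then have "\<Gamma> \<parallel> \<Delta> \<turnstile> C"
  proof (rule bex_E[OF _ _ wfC])
    let ?\<Delta> = "insert (Mem \<rho> (Var 0) (shift_tm 0 1 t)) (insert (Exs xs A) (shift 0 1 ` \<Delta>))"
    have ex: "\<rho> # \<Gamma> \<parallel> ?\<Delta> \<turnstile> Exs xs A" by (rule hyp) (use A in simp_all)
    show "\<rho> # \<Gamma> \<parallel> ?\<Delta> \<turnstile> shift 0 1 C"
    proof (rule Exs_E[OF ex])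
      let ?\<Gamma> = "xs @ \<rho> # \<Gamma>" and ?\<Delta>' = "insert A (shift 0 ?n ` ?\<Delta>)"
      let ?S = "\<lambda>i. Var (i + Suc ?n)"
      let ?\<theta> = "prepend ?n Var ?S"
      have S: "typed_subst L \<Gamma> ?\<Gamma> ?S" using typed_shift_var_0[of L \<Gamma> "xs @ [\<rho>]"] by simp
      have "?\<Gamma> \<parallel> ?\<Delta>' \<turnstile> subst ?S C"
        unfolding C_def
      proof (rule Exs_subst_I[OF _ typed_subst_Var _ wfM S])
        show "?\<Gamma> \<parallel> ?\<Delta>' \<turnstile> subst ?\<theta> ?M"
        proof (rule bex_subst_I[OF _ _ wfM typed_subst_prepend[OF typed_subst_Var S]])
          have "?\<Gamma> \<parallel> ?\<Delta>' \<turnstile> Mem \<rho> (Var ?n) (subst_tm ?S t)"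
            using has_type_subst[OF t S] by (intro hyp) (auto simp: nth_append)
          then show "?\<Gamma> \<parallel> ?\<Delta>' \<turnstile> Mem \<rho> (Var ?n) (subst_tm ?\<theta> (shift_tm 0 ?n t))"
            by (simp add: prepend_def)
          have "subst (case_nat (Var ?n) ?\<theta>) (subst (rot_subst ?n) A) = subst Var A"
            unfolding subst_subst
            by (rule subst_cong) (auto simp: rot_subst_def prepend_def split: nat.splits)
          then show "?\<Gamma> \<parallel> ?\<Delta>' \<turnstile> subst (case_nat (Var ?n) ?\<theta>) (subst (rot_subst ?n) A)"
            using A by (simp add: hyp_in)
        qed simp
      qed simp
      then show "?\<Gamma> \<parallel> ?\<Delta>' \<turnstile> shift 0 ?n (shift 0 1 C)" by simp
    qed (use wf_shift[OF wfC] in simp)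
  qed
  then show "\<Gamma> \<parallel> \<Delta> \<turnstile> Exs xs ?M" by (simp add: C_def)
next
  let ?n = "length xs"
  assume r: "\<Gamma> \<parallel> \<Delta> \<turnstile> Exs xs ?M"
  then have wf: "wf_fm L (xs @ \<Gamma>) ?M" by (auto dest: deriv_wf)
  define C where "C = BEx \<rho> t (Exs xs A)"
  have wfC: "wf_fm L \<Gamma> C" using A t by (simp add: C_def)
  have "\<Gamma> \<parallel> \<Delta> \<turnstile> C"
  proof (rule Exs_E_single[OF r _ wfC])
    let ?\<Gamma> = "xs @ \<Gamma>"
    show "?\<Gamma> \<parallel> {?M} \<turnstile> shift 0 ?n C"
    proof (rule bex_E[OF hyp_in[OF wf]])
      let ?\<Delta> = "insert (Mem \<rho> (Var 0) (shift_tm 0 1 (shift_tm 0 ?n t)))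
        (insert (subst (rot_subst ?n) A) (shift 0 1 ` {?M}))"
      let ?S = "\<lambda>i. Var (i + Suc ?n) :: 'f tm" and ?ts = "\<lambda>i. Var (Suc i) :: 'f tm"
      have S: "typed_subst L \<Gamma> (\<rho> # ?\<Gamma>) ?S" using typed_shift_var_0[of L \<Gamma> "\<rho> # xs"] by simp
      have "\<rho> # ?\<Gamma> \<parallel> ?\<Delta> \<turnstile> subst ?S C"
        unfolding C_def
      proof (rule bex_subst_I[OF _ _ wfC[unfolded C_def] S])
        show "\<rho> # ?\<Gamma> \<parallel> ?\<Delta> \<turnstile> Mem \<rho> (Var 0) (subst_tm ?S t)"
          using has_type_subst[OF t S] by (intro hyp) auto
        have eq: "prepend ?n ?ts (case_nat (Var 0) ?S) = rot_subst ?n"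
          by (rule ext) (auto simp: prepend_def rot_subst_def split: nat.splits)
        show "\<rho> # ?\<Gamma> \<parallel> ?\<Delta> \<turnstile> subst (case_nat (Var 0) ?S) (Exs xs A)"
        proof (rule Exs_subst_I[OF _ _ refl A])
          show "\<rho> # ?\<Gamma> \<parallel> ?\<Delta> \<turnstile> subst (prepend ?n ?ts (case_nat (Var 0) ?S)) A"
            unfolding eq by (rule hyp) (use wf in auto)
          show "typed_subst L xs (\<rho> # ?\<Gamma>) ?ts"
            by (auto simp: typed_subst_def nth_append)
          show "typed_subst L (\<rho> # \<Gamma>) (\<rho> # ?\<Gamma>) (case_nat (Var 0) ?S)"
            using S by (simp add: typed_subst_Cons)
        qed
      qed
      then show "\<rho> # ?\<Gamma> \<parallel> ?\<Delta> \<turnstile> shift 0 1 (shift 0 ?n C)" by simp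
    qed (use wf_subst[OF wfC typed_shift_var_0] in simp)
  qed
  then show ?l by (simp add: C_def)
qed

end

context hr_theory
begin

text \<open>Pure logic turns the witnesses of the premise into a universal prefix; independence of
  premise then moves those of the conclusion out of the implication, and choice moves them in front
  of the prefix. Conversely, the functions applied to \<open>xs\<close> witness the
  conclusion.\<close>

lemma Imp_Exs_iff:
  assumes A: "wf_fm L (xs @ \<Gamma>) A" "ex_free A"
    and B: "wf_fm L (us @ \<Gamma>) B" "mono_at {..<length us} (us @ \<Gamma>) B" "\<forall>u\<in>set us. end_star u"
  shows "\<Gamma> \<parallel> \<Delta> \<turnstile> Imp (Exs xs A) (Exs us B) \<longleftrightarrow>
    \<Gamma> \<parallel> \<Delta> \<turnstile> Exs (map (Arrows xs) us) (Alls xs (Imp (shift (length xs) (length us) A)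
      (subst (imp_subst (length xs) (length us)) B)))"
    (is "?l \<longleftrightarrow> \<Gamma> \<parallel> \<Delta> \<turnstile> Exs ?us (Alls xs ?M)")
proof
  let ?n = "length xs" and ?m = "length us"
  let ?A = "shift 0 ?m A" and ?B = "shift ?m ?n B"
  assume l: ?l
  define A\<^sub>E B\<^sub>E where "A\<^sub>E = Exs xs A" and "B\<^sub>E = Exs us B"
  \<comment> \<open>Under the assumption \<open>A\<close> the variables \<open>xs\<close> themselves
    witness the premise.\<close>
  have "xs @ \<Gamma> \<parallel> insert A (shift 0 ?n ` \<Delta>) \<turnstile> shift 0 ?n B\<^sub>E"
  proof (rule impE)
    show "xs @ \<Gamma> \<parallel> insert A (shift 0 ?n ` \<Delta>) \<turnstile> Imp (shift 0 ?n A\<^sub>E) (shift 0 ?n B\<^sub>E)"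
      using deriv_insert[OF deriv_subst[OF l typed_shift_var_0[of L \<Gamma> xs]]]
      by (simp add: A\<^sub>E_def B\<^sub>E_def del: subst_Exs)
    show "xs @ \<Gamma> \<parallel> insert A (shift 0 ?n ` \<Delta>) \<turnstile> shift 0 ?n A\<^sub>E"
      using Exs_shift_I[of "[]" xs \<Gamma> _ A] hyp_in[OF A(1)] A(1) by (simp add: A\<^sub>E_def del: subst_Exs)
  qed
  moreover have "ups ?m (\<lambda>i. Var (i + ?n)) = (shift_var ?m ?n :: nat \<Rightarrow> 'f tm)"
    by (auto simp: ups_def shift_var_def)
  ultimately have prem: "\<Gamma> \<parallel> \<Delta> \<turnstile> Alls xs (Imp A (Exs us ?B))"
    using A(1) by (simp add: Alls_iff imp_iff B\<^sub>E_def)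
  have monoB: "mono_at {..<?m} (us @ xs @ \<Gamma>) ?B"
    by (rule mono_at_shift[OF B(2)]) simp_all
  have wfB: "wf_fm L (us @ xs @ \<Gamma>) ?B"
    using wf_subst[OF B(1) typed_shift_var] .
  have "\<Gamma> \<parallel> \<Delta> \<turnstile> Alls xs (Exs us (Imp ?A ?B))"
    by (rule Alls_mono[OF prem Imp_Exs_premise[OF hyp_in]]) (use A B(3) monoB wfB in simp_all)
  \<comment> \<open>Choice asks for monotonicity of the whole implication; its premise has been
    shifted past \<open>us\<close> and does not mention them.\<close>
  moreover have "mono_at {..<?m} (us @ xs @ \<Gamma>) (Imp ?A ?B)"
  proof (rule mono_at_Imp[OF monoB])
    show "wf_fm L (us @ xs @ \<Gamma>) ?A" using wf_subst[OF A(1) typed_shift_var_0] by simp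
    show "subst \<theta> ?A = subst \<theta>' ?A" if "\<And>i. i \<notin> {..<?m} \<Longrightarrow> \<theta> i = \<theta>' i" for \<theta> \<theta>'
      unfolding subst_subst by (rule subst_cong) (use that in auto)
  qed
  ultimately have "\<Gamma> \<parallel> \<Delta> \<turnstile> Exs ?us (Alls xs (subst (apps_subst ?n ?m) (Imp ?A ?B)))"
    by (rule Alls_Exs_choice[OF _ _ B(3)])
  moreover have "subst (apps_subst ?n ?m) ?A = shift ?n ?m A"
    unfolding subst_subst by (rule subst_cong) (auto simp: apps_subst_def shift_var_def)
  moreover have "subst (apps_subst ?n ?m) ?B = subst (imp_subst ?n ?m) B"
    unfolding subst_subst by (rule subst_cong) (auto simp: apps_subst_def shift_var_def imp_subst_def)
  ultimately show "\<Gamma> \<parallel> \<Delta> \<turnstile> Exs ?us (Alls xs ?M)" by (simp only: subst.simps)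
next
  let ?n = "length xs" and ?m = "length us"
  assume r: "\<Gamma> \<parallel> \<Delta> \<turnstile> Exs ?us (Alls xs ?M)"
  then have wfM: "wf_fm L (xs @ ?us @ \<Gamma>) ?M" by (auto dest: deriv_wf)
  define A\<^sub>E B\<^sub>E where "A\<^sub>E = Exs xs A" and "B\<^sub>E = Exs us B"
  define C where "C = Alls xs ?M"
  have wfE: "wf_fm L \<Gamma> A\<^sub>E" "wf_fm L \<Gamma> B\<^sub>E" using A B by (simp_all add: A\<^sub>E_def B\<^sub>E_def)
  have S: "typed_subst L \<Gamma> (?us @ \<Gamma>) (\<lambda>i. Var (i + ?m))"
    using typed_shift_var_0[of L \<Gamma> ?us] by simp
  have wfA\<^sub>E: "wf_fm L (?us @ \<Gamma>) (shift 0 ?m A\<^sub>E)" using wf_subst[OF wfE(1) S] by simp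
  have "\<Gamma> \<parallel> \<Delta> \<turnstile> Imp A\<^sub>E B\<^sub>E"
  proof (rule Exs_E_single[OF r])
    have "?us @ \<Gamma> \<parallel> insert (shift 0 ?m A\<^sub>E) {C} \<turnstile> shift 0 ?m B\<^sub>E"
    proof (rule Exs_E)
      have "ups ?n (\<lambda>i. Var (i + ?m)) = (shift_var ?n ?m :: nat \<Rightarrow> 'f tm)"
        by (auto simp: ups_def shift_var_def)
      then show "?us @ \<Gamma> \<parallel> insert (shift 0 ?m A\<^sub>E) {C} \<turnstile> Exs xs (shift ?n ?m A)"
        using hyp_in[OF wfA\<^sub>E, of "{C}"] by (simp add: A\<^sub>E_def)
      show "wf_fm L (?us @ \<Gamma>) (shift 0 ?m B\<^sub>E)" using wf_subst[OF wfE(2) S] by simp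
      let ?\<Gamma> = "xs @ ?us @ \<Gamma>"
      let ?\<Delta> = "insert (shift ?n ?m A) (shift 0 ?n ` insert (shift 0 ?m A\<^sub>E) {C})"
      let ?ts = "\<lambda>i. app_vars (Var (?n + i)) ?n" and ?\<theta> = "\<lambda>i. Var (i + (?n + ?m))"
      have wfC: "wf_fm L ?\<Gamma> (shift 0 ?n C)"
        using wf_subst[OF _ typed_shift_var_0[of L "?us @ \<Gamma>" xs], of C] wfM by (simp add: C_def)
      have "?\<Gamma> \<parallel> ?\<Delta> \<turnstile> shift 0 ?n C" by (rule hyp) (use wfC in auto)
      \<comment> \<open>Instantiating the prefix by its own variables recovers the matrix, since the
        resulting substitution is the identity.\<close>
      from Alls_subst_E[of ?\<Gamma> ?\<Delta> "shift_var 0 ?n" xs ?M Var ?n, folded C_def, OF this typed_subst_Var refl]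
      have "?\<Gamma> \<parallel> ?\<Delta> \<turnstile> subst (prepend ?n Var (shift_var 0 ?n)) ?M" .
      moreover have "prepend ?n Var (shift_var 0 ?n) = (Var :: nat \<Rightarrow> 'f tm)"
        by (auto simp: prepend_def)
      ultimately have "?\<Gamma> \<parallel> ?\<Delta> \<turnstile> ?M" by (simp only: subst_Var)
      then have B': "?\<Gamma> \<parallel> ?\<Delta> \<turnstile> subst (imp_subst ?n ?m) B"
        by (rule impE) (rule hyp_in, use wfM in simp)
      have eq: "prepend ?m ?ts ?\<theta> = (imp_subst ?n ?m :: nat \<Rightarrow> 'f tm)"
        by (auto simp: prepend_def imp_subst_def)
      have "?\<Gamma> \<parallel> ?\<Delta> \<turnstile> subst ?\<theta> B\<^sub>E"
        unfolding B\<^sub>E_def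
      proof (rule Exs_subst_I[OF _ _ refl B(1)])
        show "?\<Gamma> \<parallel> ?\<Delta> \<turnstile> subst (prepend ?m ?ts ?\<theta>) B" using B' unfolding eq .
        show "typed_subst L us ?\<Gamma> ?ts"
          by (auto simp: typed_subst_def nth_append intro!: has_type_app_vars)
        show "typed_subst L \<Gamma> ?\<Gamma> ?\<theta>" using typed_shift_var_0[of L \<Gamma> "xs @ ?us"] by simp
      qed
      then show "?\<Gamma> \<parallel> ?\<Delta> \<turnstile> shift 0 ?n (shift 0 ?m B\<^sub>E)" by (simp add: ac_simps)
    qed
    then have "?us @ \<Gamma> \<parallel> {C} \<turnstile> shift 0 (length ?us) (Imp A\<^sub>E B\<^sub>E)"
      using wfA\<^sub>E by (simp add: imp_iff)
    then show "?us @ \<Gamma> \<parallel> {Alls xs ?M} \<turnstile> shift 0 (length ?us) (Imp A\<^sub>E B\<^sub>E)"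
      by (simp only: C_def)
  qed (use wfE in simp)
  then show ?l by (simp add: A\<^sub>E_def B\<^sub>E_def)
qed

lemma All_Exs_iff:
  assumes A: "wf_fm L (xs @ \<rho> # \<Gamma>) A" "mono_at {..<length xs} (xs @ \<rho> # \<Gamma>) A" "\<forall>x\<in>set xs. end_star x"
  shows "\<Gamma> \<parallel> \<Delta> \<turnstile> All \<rho> (Exs xs A) \<longleftrightarrow>
    \<Gamma> \<parallel> \<Delta> \<turnstile> Exs (map ((\<rightarrow>) \<rho>) xs) (All \<rho> (subst (app_subst (length xs)) A))"
    (is "?l \<longleftrightarrow> \<Gamma> \<parallel> \<Delta> \<turnstile> Exs ?xs ?M")
proof
  show "?l \<Longrightarrow> \<Gamma> \<parallel> \<Delta> \<turnstile> Exs ?xs ?M" by (rule All_Exs_choice[OF _ A(2,3)])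
next
  let ?n = "length xs"
  assume r: "\<Gamma> \<parallel> \<Delta> \<turnstile> Exs ?xs ?M"
  then have wfM: "wf_fm L (?xs @ \<Gamma>) ?M" by (auto dest: deriv_wf)
  show ?l
  proof (rule Exs_E_single[OF r])
    let ?\<Gamma> = "\<rho> # ?xs @ \<Gamma>"
    let ?S = "\<lambda>i. Var (i + ?n) :: 'f tm" and ?ts = "\<lambda>i. Var (Suc i) \<bullet> Var 0 :: 'f tm"
    have M: "?\<Gamma> \<parallel> shift 0 1 ` {?M} \<turnstile> subst (app_subst ?n) A"
      using hyp_in[OF wfM, of "{}"] by (simp only: all_iff)
    have S: "typed_subst L \<Gamma> (?xs @ \<Gamma>) ?S" using typed_shift_var_0[of L \<Gamma> ?xs] by simp
    have eq: "prepend ?n ?ts (up ?S) = app_subst ?n"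
    proof
      show "prepend ?n ?ts (up ?S) i = app_subst ?n i" for i
        by (cases "i - ?n") (auto simp: prepend_def app_subst_def)
    qed
    have "?\<Gamma> \<parallel> shift 0 1 ` {?M} \<turnstile> subst (up ?S) (Exs xs A)"
    proof (rule Exs_subst_I[OF _ _ refl A(1) typed_subst_up[OF S]])
      show "?\<Gamma> \<parallel> shift 0 1 ` {?M} \<turnstile> subst (prepend ?n ?ts (up ?S)) A" using M unfolding eq .
    qed (auto simp: typed_subst_def nth_append)
    then have "?xs @ \<Gamma> \<parallel> {?M} \<turnstile> subst ?S (All \<rho> (Exs xs A))"
      by (simp only: all_iff subst.simps)
    then show "?xs @ \<Gamma> \<parallel> {?M} \<turnstile> shift 0 (length ?xs) (All \<rho> (Exs xs A))" by simp
  qed (use A in simp)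
qed

text \<open>Independence of premise for \<open>z \<in> t\<close>, followed by choice, gives
  witnesses \<open>X z\<close>. Their pointwise union over \<open>z \<in> t\<close> no longer
  depends on \<open>z\<close> and, by monotonicity, serves for every such \<open>z\<close>. The
  converse is pure logic.\<close>

lemma BAll_Exs_iff:
  assumes t: "has_type L \<Gamma> t (Star \<rho>)"
    and A: "wf_fm L (xs @ \<rho> # \<Gamma>) A" "mono_at {..<length xs} (xs @ \<rho> # \<Gamma>) A" "\<forall>x\<in>set xs. end_star x"
  shows "\<Gamma> \<parallel> \<Delta> \<turnstile> BAll \<rho> t (Exs xs A) \<longleftrightarrow>
    \<Gamma> \<parallel> \<Delta> \<turnstile> Exs xs (BAll \<rho> (shift_tm 0 (length xs) t) (subst (rot_subst (length xs)) A))"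
    (is "?l \<longleftrightarrow> \<Gamma> \<parallel> \<Delta> \<turnstile> Exs _ ?M")
proof
  let ?n = "length xs" and ?xs = "map ((\<rightarrow>) \<rho>) xs"
  let ?E = "Mem \<rho> (Var 0) (shift_tm 0 1 t) :: ('f, 'r) fm"
  let ?E' = "Mem \<rho> (Var 0) (shift_tm 0 1 (shift_tm 0 ?n t)) :: ('f, 'r) fm"
  have wfM: "wf_fm L (xs @ \<Gamma>) ?M"
    using wf_subst[OF A(1) typed_rot_subst] has_type_subst[OF t typed_shift_var_0] by simp
  have S: "typed_subst L \<Gamma> (?xs @ \<Gamma>) (\<lambda>i. Var (i + ?n))"
    using typed_shift_var_0[of L \<Gamma> ?xs] by simp
  have wfE: "wf_fm L (\<rho> # \<Gamma>) ?E" using has_type_shift[OF t] by simp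
  have t': "has_type L (?xs @ \<Gamma>) (shift_tm 0 ?n t) (Star \<rho>)"
    using has_type_subst[OF t S] by simp
  have wfE': "wf_fm L (\<rho> # ?xs @ \<Gamma>) ?E'" using has_type_shift[OF t'] by simp
  assume ?l
  then have "\<Gamma> \<parallel> \<Delta> \<turnstile> All \<rho> (Imp ?E (Exs xs A))"
    using t A(1) by (simp add: ball_iff)
  then have "\<rho> # \<Gamma> \<parallel> shift 0 1 ` \<Delta> \<turnstile> Imp ?E (Exs xs A)" by (simp only: all_iff)
  then have "\<rho> # \<Gamma> \<parallel> shift 0 1 ` \<Delta> \<turnstile> Exs xs (Imp (shift 0 ?n ?E) A)"
    using A by (intro Imp_Exs_premise) simp_all
  then have "\<Gamma> \<parallel> \<Delta> \<turnstile> All \<rho> (Exs xs (Imp (shift 0 ?n ?E) A))" by (simp only: all_iff)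
  moreover have "mono_at {..<?n} (xs @ \<rho> # \<Gamma>) (Imp (shift 0 ?n ?E) A)"
  proof (rule mono_at_Imp[OF A(2)])
    show "wf_fm L (xs @ \<rho> # \<Gamma>) (shift 0 ?n ?E)"
      using wf_subst[OF wfE typed_shift_var_0[of L "\<rho> # \<Gamma>" xs]] by simp
    show "subst \<theta> (shift 0 ?n ?E) = subst \<theta>' (shift 0 ?n ?E)"
      if "\<And>i. i \<notin> {..<?n} \<Longrightarrow> \<theta> i = \<theta>' i" for \<theta> \<theta>'
      unfolding subst_subst by (rule subst_cong) (use that in auto)
  qed
  ultimately have "\<Gamma> \<parallel> \<Delta> \<turnstile> Exs ?xs (All \<rho> (subst (app_subst ?n) (Imp (shift 0 ?n ?E) A)))"
    using A(3) by (rule All_Exs_choice)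
  moreover have "subst (app_subst ?n) (shift 0 ?n ?E) = ?E'"
    by (auto simp: app_subst_def intro!: subst_tm_cong)
  ultimately have ex: "\<Gamma> \<parallel> \<Delta> \<turnstile> Exs ?xs (All \<rho> (Imp ?E' (subst (app_subst ?n) A)))"
    (is "\<Gamma> \<parallel> \<Delta> \<turnstile> Exs ?xs ?H")
    by (simp only: subst.simps)
  \<comment> \<open>Each component of the tuple is collected separately over
    \<open>z \<in> t\<close>; the result \<open>c\<close> lives outside the scope of
    \<open>z\<close>.\<close>
  have "\<exists>c. has_type L (?xs @ \<Gamma>) c (xs ! i) \<and>
      \<rho> # ?xs @ \<Gamma> \<parallel> {?E'} \<turnstile> Sub (xs ! i) (Var (Suc i) \<bullet> Var 0) (shift_tm 0 1 c)" if "i < ?n" for i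
    by (rule collection[OF t']) (use that A(3) in \<open>auto simp: nth_append\<close>)
  then obtain c where c: "\<And>i. i < ?n \<Longrightarrow> has_type L (?xs @ \<Gamma>) (c i) (xs ! i)"
    "\<And>i. i < ?n \<Longrightarrow>
      \<rho> # ?xs @ \<Gamma> \<parallel> {?E'} \<turnstile> Sub (xs ! i) (Var (Suc i) \<bullet> Var 0) (shift_tm 0 1 (c i))"
    by metis
  have c_typed: "typed_subst L xs (?xs @ \<Gamma>) c" using c(1) by (simp add: typed_subst_def)
  define C where "C = Exs xs ?M"
  have "\<Gamma> \<parallel> \<Delta> \<turnstile> C"
  proof (rule Exs_E_single[OF ex])
    show "wf_fm L \<Gamma> C" using wfM by (simp add: C_def)
    let ?\<Gamma> = "\<rho> # ?xs @ \<Gamma>" and ?\<Delta> = "insert ?E' (shift 0 1 ` {?H})"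
    have wfH: "wf_fm L (?xs @ \<Gamma>) ?H" using deriv_wf[OF ex] by simp
    have "?\<Gamma> \<parallel> shift 0 1 ` {?H} \<turnstile> Imp ?E' (subst (app_subst ?n) A)"
      using hyp_in[OF wfH, of "{}"] by (simp only: all_iff)
    then have app: "?\<Gamma> \<parallel> ?\<Delta> \<turnstile> subst (app_subst ?n) A"
      using wfE' by (simp only: imp_iff)
    let ?\<theta> = "prepend ?n c (\<lambda>i. Var (i + ?n))"
    \<comment> \<open>\<open>\<psi>\<close> sends the witnesses to the uniform terms
      \<open>c\<close>, where \<open>app_subst\<close> sends them to \<open>X z\<close>; on all
      other indices the two agree.\<close>
    define \<psi> where "\<psi> i = subst_tm (up ?\<theta>) (rot_subst ?n i)" for i
    have \<psi>: "\<psi> i = (if i < ?n then shift_tm 0 1 (c i) else if i = ?n then Var 0 else Var i)" for i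
      by (cases i) (auto simp: \<psi>_def rot_subst_def prepend_def)
    have \<theta>: "typed_subst L (xs @ \<Gamma>) (?xs @ \<Gamma>) ?\<theta>"
      by (rule typed_subst_prepend[OF c_typed S refl])
    have "sub_related {..<?n} (xs @ \<rho> # \<Gamma>) ?\<Gamma> ?\<Delta> (app_subst ?n) \<psi>"
    proof (rule sub_relatedI[OF typed_app_subst])
      show "typed_subst L (xs @ \<rho> # \<Gamma>) ?\<Gamma> \<psi>"
        unfolding \<psi>_def[abs_def] by (rule typed_subst_comp[OF typed_rot_subst typed_subst_up[OF \<theta>]])
      show "app_subst ?n i = \<psi> i" if "i \<notin> {..<?n}" for i
        using that by (simp add: app_subst_def \<psi>)
      show "?\<Gamma> \<parallel> ?\<Delta> \<turnstile> Sub ((xs @ \<rho> # \<Gamma>) ! i) (app_subst ?n i) (\<psi> i)" if "i \<in> {..<?n}" for i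
        using that deriv_weaken[OF c(2)[of i], of ?\<Delta>] by (simp add: app_subst_def \<psi> nth_append)
    qed
    from mono_atD[OF A(2) this app]
    have "?\<Gamma> \<parallel> ?\<Delta> \<turnstile> subst (up ?\<theta>) (subst (rot_subst ?n) A)"
      by (simp add: \<psi>_def[abs_def])
    from ball_I[OF this t']
    have "?xs @ \<Gamma> \<parallel> {?H} \<turnstile> BAll \<rho> (shift_tm 0 ?n t) (subst (up ?\<theta>) (subst (rot_subst ?n) A))" .
    moreover have "subst_tm ?\<theta> (shift_tm 0 ?n t) = shift_tm 0 ?n t"
      by (auto simp: prepend_def intro!: subst_tm_cong)
    ultimately have "?xs @ \<Gamma> \<parallel> {?H} \<turnstile> subst ?\<theta> ?M"
      by (simp only: subst.simps)
    from Exs_subst_I[OF this c_typed refl wfM S]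
    show "?xs @ \<Gamma> \<parallel> {?H} \<turnstile> shift 0 (length ?xs) C"
      by (simp add: C_def)
  qed
  then show "\<Gamma> \<parallel> \<Delta> \<turnstile> Exs xs ?M" by (simp add: C_def)
next
  let ?n = "length xs"
  assume r: "\<Gamma> \<parallel> \<Delta> \<turnstile> Exs xs ?M"
  then have wfM: "wf_fm L (xs @ \<Gamma>) ?M" by (auto dest: deriv_wf)
  show ?l
  proof (rule Exs_E_single[OF r])
    let ?\<Gamma> = "\<rho> # xs @ \<Gamma>"
    let ?S = "\<lambda>i. Var (i + ?n) :: 'f tm" and ?ts = "\<lambda>i. Var (Suc i) :: 'f tm"
    let ?\<Delta> = "insert (Mem \<rho> (Var 0) (shift_tm 0 1 (subst_tm ?S t))) (shift 0 1 ` {?M})"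
    have S: "typed_subst L \<Gamma> (xs @ \<Gamma>) ?S" by (rule typed_shift_var_0)
    have "?\<Gamma> \<parallel> ?\<Delta> \<turnstile> subst (\<lambda>i. Var (Suc i)) ?M"
      by (rule hyp) (use wf_shift[OF wfM] in auto)
    then have "?\<Gamma> \<parallel> ?\<Delta> \<turnstile> subst (case_nat (Var 0) (\<lambda>i. Var (Suc i))) (subst (rot_subst ?n) A)"
      by (rule ball_subst_E) (use has_type_shift[OF has_type_subst[OF t S]] in \<open>auto intro!: hyp\<close>)
    moreover have "case_nat (Var 0) (\<lambda>i. Var (Suc i)) = (Var :: nat \<Rightarrow> 'f tm)"
      by (rule ext) (auto split: nat.splits)
    ultimately have M: "?\<Gamma> \<parallel> ?\<Delta> \<turnstile> subst (rot_subst ?n) A"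
      by (simp only: subst_Var)
    have eq: "prepend ?n ?ts (up ?S) = rot_subst ?n"
    proof
      show "prepend ?n ?ts (up ?S) i = rot_subst ?n i" for i
        by (cases "i - ?n") (auto simp: prepend_def rot_subst_def)
    qed
    have "?\<Gamma> \<parallel> ?\<Delta> \<turnstile> subst (up ?S) (Exs xs A)"
    proof (rule Exs_subst_I[OF _ _ refl A(1) typed_subst_up[OF S]])
      show "?\<Gamma> \<parallel> ?\<Delta> \<turnstile> subst (prepend ?n ?ts (up ?S)) A" using M unfolding eq .
    qed (auto simp: typed_subst_def nth_append)
    from ball_I[OF this has_type_subst[OF t S]]
    show "xs @ \<Gamma> \<parallel> {?M} \<turnstile> shift 0 ?n (BAll \<rho> t (Exs xs A))" by simp
  qed (use A t in simp)
qed

end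

section \<open>The characterization theorem\<close>

context il_theory
begin

text \<open>Interderivability from every set of assumptions chains without handling derivations. For
  well-formed \<open>A\<close>, a derivation of \<open>Iff A B\<close> is recovered by taking each
  side as assumption for the other.\<close>

definition equivalent :: "ty list \<Rightarrow> ('f, 'r) fm \<Rightarrow> ('f, 'r) fm \<Rightarrow> bool" where
  "equivalent \<Gamma> A B \<longleftrightarrow> (\<forall>\<Delta>. \<Gamma> \<parallel> \<Delta> \<turnstile> A \<longleftrightarrow> \<Gamma> \<parallel> \<Delta> \<turnstile> B)"

lemma equivalentI: "(\<And>\<Delta>. \<Gamma> \<parallel> \<Delta> \<turnstile> A \<longleftrightarrow> \<Gamma> \<parallel> \<Delta> \<turnstile> B) \<Longrightarrow> equivalent \<Gamma> A B"
  by (simp add: equivalent_def)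

lemma equivalent_sym: "equivalent \<Gamma> A B \<Longrightarrow> equivalent \<Gamma> B A"
  by (simp add: equivalent_def)

lemma equivalent_trans: "equivalent \<Gamma> A B \<Longrightarrow> equivalent \<Gamma> B C \<Longrightarrow> equivalent \<Gamma> A C"
  by (simp add: equivalent_def)

lemma equivalent_deriv: "equivalent \<Gamma> A B \<Longrightarrow> \<Gamma> \<parallel> \<Delta> \<turnstile> A \<Longrightarrow> \<Gamma> \<parallel> \<Delta> \<turnstile> B"
  by (simp add: equivalent_def)

lemma equivalent_wf: "equivalent \<Gamma> A B \<Longrightarrow> wf_fm L \<Gamma> A \<Longrightarrow> wf_fm L \<Gamma> B"
  by (rule deriv_wf[OF equivalent_deriv[OF _ hyp_in]])

text \<open>Since \<open>equivalent\<close> is symmetric, one direction proved for arbitrary pairs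
  suffices.\<close>

lemma equivalent_by_mono:
  assumes "equivalent \<Gamma> A A'"
    and "\<And>\<Delta> A A'. equivalent \<Gamma> A A' \<Longrightarrow> \<Gamma>\<^sub>0 \<parallel> \<Delta> \<turnstile> F A \<Longrightarrow> \<Gamma>\<^sub>0 \<parallel> \<Delta> \<turnstile> F A'"
  shows "equivalent \<Gamma>\<^sub>0 (F A) (F A')"
  by (rule equivalentI) (rule iffI; erule assms(2)[OF assms(1)] assms(2)[OF equivalent_sym[OF assms(1)]])

lemma equivalent_Or:
  assumes "equivalent \<Gamma> A A'" "equivalent \<Gamma> B B'"
  shows "equivalent \<Gamma> (Or A B) (Or A' B')"
proof -
  have mono: "\<Gamma> \<parallel> \<Delta> \<turnstile> Or A' B'"
    if eq: "equivalent \<Gamma> A A'" "equivalent \<Gamma> B B'" and or: "\<Gamma> \<parallel> \<Delta> \<turnstile> Or A B" for A B A' B' \<Delta>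
  proof (rule orE[OF or])
    have wf: "wf_fm L \<Gamma> A" "wf_fm L \<Gamma> B" using deriv_wf[OF or] by auto
    show "\<Gamma> \<parallel> insert A \<Delta> \<turnstile> Or A' B'"
      by (rule orI1[OF equivalent_deriv[OF eq(1) hyp_in[OF wf(1)]] equivalent_wf[OF eq(2) wf(2)]])
    show "\<Gamma> \<parallel> insert B \<Delta> \<turnstile> Or A' B'"
      by (rule orI2[OF equivalent_deriv[OF eq(2) hyp_in[OF wf(2)]] equivalent_wf[OF eq(1) wf(1)]])
  qed
  show ?thesis
    by (rule equivalentI) (rule iffI; erule mono[OF assms] mono[OF assms[THEN equivalent_sym]])
qed

lemma equivalent_And:
  assumes "equivalent \<Gamma> A A'" "equivalent \<Gamma> B B'"
  shows "equivalent \<Gamma> (And A B) (And A' B')"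
proof -
  have mono: "\<Gamma> \<parallel> \<Delta> \<turnstile> And A' B'"
    if eq: "equivalent \<Gamma> A A'" "equivalent \<Gamma> B B'" and "and": "\<Gamma> \<parallel> \<Delta> \<turnstile> And A B" for A B A' B' \<Delta>
    by (rule andI[OF equivalent_deriv[OF eq(1) andE1[OF "and"]] equivalent_deriv[OF eq(2) andE2[OF "and"]]])
  show ?thesis
    by (rule equivalentI) (rule iffI; erule mono[OF assms] mono[OF assms[THEN equivalent_sym]])
qed

lemma equivalent_Imp:
  assumes "equivalent \<Gamma> A A'" "equivalent \<Gamma> B B'"
  shows "equivalent \<Gamma> (Imp A B) (Imp A' B')"
proof -
  have mono: "\<Gamma> \<parallel> \<Delta> \<turnstile> Imp A' B'"
    if eq: "equivalent \<Gamma> A A'" "equivalent \<Gamma> B B'" and imp: "\<Gamma> \<parallel> \<Delta> \<turnstile> Imp A B" for A B A' B' \<Delta>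
  proof (rule impI)
    have "wf_fm L \<Gamma> A" using deriv_wf[OF imp] by auto
    then show wf: "wf_fm L \<Gamma> A'" by (rule equivalent_wf[OF eq(1)])
    show "\<Gamma> \<parallel> insert A' \<Delta> \<turnstile> B'"
      by (rule equivalent_deriv[OF eq(2) impE[OF deriv_insert[OF imp]
            equivalent_deriv[OF equivalent_sym[OF eq(1)] hyp_in[OF wf]]]])
  qed
  show ?thesis
    by (rule equivalentI) (rule iffI; erule mono[OF assms] mono[OF assms[THEN equivalent_sym]])
qed

lemma equivalent_All: "equivalent (\<rho> # \<Gamma>) A A' \<Longrightarrow> equivalent \<Gamma> (All \<rho> A) (All \<rho> A')"
  by (simp add: equivalent_def all_iff)

lemma equivalent_Ex:
  assumes "equivalent (\<rho> # \<Gamma>) A A'"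
  shows "equivalent \<Gamma> (Ex \<rho> A) (Ex \<rho> A')"
  using assms
proof (rule equivalent_by_mono)
  show "\<Gamma> \<parallel> \<Delta> \<turnstile> Ex \<rho> A'" if eq: "equivalent (\<rho> # \<Gamma>) A A'" and ex: "\<Gamma> \<parallel> \<Delta> \<turnstile> Ex \<rho> A" for \<Delta> A A'
    using Exs_mono[of \<Gamma> \<Delta> "[\<rho>]" A A'] equivalent_deriv[OF eq hyp_in] deriv_wf[OF ex] ex by simp
qed

lemma equivalent_BAll:
  assumes "equivalent (\<rho> # \<Gamma>) A A'"
  shows "equivalent \<Gamma> (BAll \<rho> t A) (BAll \<rho> t A')"
  using assms
proof (rule equivalent_by_mono)
  show "\<Gamma> \<parallel> \<Delta> \<turnstile> BAll \<rho> t A'" if eq: "equivalent (\<rho> # \<Gamma>) A A'" and all: "\<Gamma> \<parallel> \<Delta> \<turnstile> BAll \<rho> t A" for \<Delta> A A'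
  proof (rule ball_I[OF equivalent_deriv[OF eq]])
    have wf: "wf_fm L \<Gamma> (BAll \<rho> t A)" by (rule deriv_wf[OF all])
    then show "has_type L \<Gamma> t (Star \<rho>)" by simp
    then show "\<rho> # \<Gamma> \<parallel> insert (Mem \<rho> (Var 0) (shift_tm 0 1 t)) (shift 0 1 ` \<Delta>) \<turnstile> A"
      using all wf by (simp add: ball_iff all_iff imp_iff has_type_shift)
  qed
qed

lemma equivalent_BEx:
  assumes "equivalent (\<rho> # \<Gamma>) A A'" "wf_fm L \<Gamma> (BEx \<rho> t A)"
  shows "equivalent \<Gamma> (BEx \<rho> t A) (BEx \<rho> t A')"
proof -
  let ?M = "Mem \<rho> (Var 0) (shift_tm 0 1 t)"
  have wf: "wf_fm L \<Gamma> (BEx \<rho> t A')" using assms equivalent_wf by auto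
  have "equivalent (\<rho> # \<Gamma>) ?M ?M" by (simp add: equivalent_def)
  from equivalent_Ex[OF equivalent_And[OF this assms(1)]] show ?thesis
    unfolding equivalent_def bex_iff[OF wf] bex_iff[OF assms(2)] .
qed

end

text \<open>A constant symbol inhabits \<open>G\<close>, constant functions inhabit arrow types, and
  singletons inhabit star types. The terms are closed, hence typed in every context.\<close>

lemma inhabited:
  fixes L :: "('f, 'r) lang"
  assumes "funs L c = Some 0"
  shows "\<exists>inh. \<forall>\<tau> \<Gamma>. has_type L \<Gamma> (inh \<tau>) \<tau>"
proof -
  have "\<exists>t. \<forall>\<Gamma>. has_type L \<Gamma> t \<tau>" for \<tau>
  proof (induction \<tau>)
    case G
    have "\<forall>\<Gamma>. has_type L \<Gamma> (Con (Fn c)) G" using assms by simp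
    then show ?case by blast
  next
    case (Fun \<sigma> \<tau>)
    then obtain t where "\<forall>\<Gamma>. has_type L \<Gamma> t \<tau>" by blast
    then have "\<forall>\<Gamma>. has_type L \<Gamma> (Con (PiC \<tau> \<sigma>) \<bullet> t) (\<sigma> \<rightarrow> \<tau>)" by auto
    then show ?case by blast
  next
    case (Star \<sigma>)
    then obtain t where "\<forall>\<Gamma>. has_type L \<Gamma> t \<sigma>" by blast
    then have "\<forall>\<Gamma>. has_type L \<Gamma> (Con (SingC \<sigma>) \<bullet> t) (Star \<sigma>)" by auto
    then show ?case by blast
  qed
  then show ?thesis by (intro choice HOL.allI)
qed

context hr_theory
begin

text \<open>Each compound case replaces the immediate subformulas by their translations, by
  congruence of \<open>equivalent\<close>, and then applies the prenexing equivalence whose right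
  side is the clause of \<open>HR\<close>.\<close>

theorem HR_equivalent:
  assumes inh: "\<And>\<tau> \<Gamma>. has_type L \<Gamma> (inh \<tau>) \<tau>"
  shows "wf_fm L \<Gamma> A \<Longrightarrow> equivalent \<Gamma> A (HR_fm A)"
proof (induction A arbitrary: \<Gamma>)
  case (Or A B)
  obtain xs A' us B' where HR: "HR A = (xs, A')" "HR B = (us, B')" by fastforce
  have wf: "wf_fm L \<Gamma> A" "wf_fm L \<Gamma> B" using Or.prems by simp_all
  have "equivalent \<Gamma> (Or A B) (Or (Exs xs A') (Exs us B'))"
    using equivalent_Or[OF Or.IH(1)[OF wf(1)] Or.IH(2)[OF wf(2)]] by (simp add: HR_fm_def HR)
  moreover note equivalentI[OF Or_Exs_iff[OF HR_wf[OF HR(1) wf(1)] HR_wf[OF HR(2) wf(2)] inh]]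
  ultimately show ?case
    unfolding HR_fm_def HR_Or[OF HR] prod.case by (rule equivalent_trans)
next
  case (And A B)
  obtain xs A' us B' where HR: "HR A = (xs, A')" "HR B = (us, B')" by fastforce
  have wf: "wf_fm L \<Gamma> A" "wf_fm L \<Gamma> B" using And.prems by simp_all
  have "equivalent \<Gamma> (And A B) (And (Exs xs A') (Exs us B'))"
    using equivalent_And[OF And.IH(1)[OF wf(1)] And.IH(2)[OF wf(2)]] by (simp add: HR_fm_def HR)
  moreover note equivalentI[OF And_Exs_iff[OF HR_wf[OF HR(1) wf(1)] HR_wf[OF HR(2) wf(2)]]]
  ultimately show ?case
    unfolding HR_fm_def HR_And[OF HR] prod.case by (rule equivalent_trans)
next
  case (Imp A B)
  obtain xs A' us B' where HR: "HR A = (xs, A')" "HR B = (us, B')" by fastforce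
  have wf: "wf_fm L \<Gamma> A" "wf_fm L \<Gamma> B" using Imp.prems by simp_all
  have "equivalent \<Gamma> (Imp A B) (Imp (Exs xs A') (Exs us B'))"
    using equivalent_Imp[OF Imp.IH(1)[OF wf(1)] Imp.IH(2)[OF wf(2)]] by (simp add: HR_fm_def HR)
  moreover note equivalentI[OF Imp_Exs_iff[OF HR_wf[OF HR(1) wf(1)] HR_ex_free[OF HR(1)]
        HR_wf[OF HR(2) wf(2)] HR_mono[OF HR(2) wf(2)] ballI[OF HR_end_star[OF HR(2)]]]]
  ultimately show ?case
    unfolding HR_fm_def HR_Imp[OF HR] prod.case by (rule equivalent_trans)
next
  case (All \<rho> A)
  obtain xs A' where HR: "HR A = (xs, A')" by fastforce
  have wf: "wf_fm L (\<rho> # \<Gamma>) A" using All.prems by simp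
  have "equivalent \<Gamma> (All \<rho> A) (All \<rho> (Exs xs A'))"
    using equivalent_All[OF All.IH[OF wf]] by (simp add: HR_fm_def HR)
  moreover note equivalentI[OF All_Exs_iff[OF HR_wf[OF HR wf] HR_mono[OF HR wf]
        ballI[OF HR_end_star[OF HR]]]]
  ultimately show ?case
    unfolding HR_fm_def HR_All[OF HR] prod.case by (rule equivalent_trans)
next
  case (Ex \<rho> A)
  obtain xs A' where HR: "HR A = (xs, A')" by fastforce
  have wf: "wf_fm L (\<rho> # \<Gamma>) A" using Ex.prems by simp
  have "equivalent \<Gamma> (Ex \<rho> A) (Ex \<rho> (Exs xs A'))"
    using equivalent_Ex[OF Ex.IH[OF wf]] by (simp add: HR_fm_def HR)
  moreover note equivalentI[OF Ex_Exs_iff[OF HR_wf[OF HR wf]]]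
  ultimately show ?case
    unfolding HR_fm_def HR_Ex[OF HR] prod.case by (rule equivalent_trans)
next
  case (BAll \<rho> t A)
  obtain xs A' where HR: "HR A = (xs, A')" by fastforce
  have wf: "has_type L \<Gamma> t (Star \<rho>)" "wf_fm L (\<rho> # \<Gamma>) A" using BAll.prems by simp_all
  have "equivalent \<Gamma> (BAll \<rho> t A) (BAll \<rho> t (Exs xs A'))"
    using equivalent_BAll[OF BAll.IH[OF wf(2)]] by (simp add: HR_fm_def HR)
  moreover note equivalentI[OF BAll_Exs_iff[OF wf(1) HR_wf[OF HR wf(2)] HR_mono[OF HR wf(2)]
        ballI[OF HR_end_star[OF HR]]]]
  ultimately show ?case
    unfolding HR_fm_def HR_BAll[OF HR] prod.case by (rule equivalent_trans)
next
  case (BEx \<rho> t A)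
  obtain xs A' where HR: "HR A = (xs, A')" by fastforce
  have wf: "has_type L \<Gamma> t (Star \<rho>)" "wf_fm L (\<rho> # \<Gamma>) A" using BEx.prems by simp_all
  have "equivalent \<Gamma> (BEx \<rho> t A) (BEx \<rho> t (Exs xs A'))"
    using equivalent_BEx[OF BEx.IH[OF wf(2)] BEx.prems] by (simp add: HR_fm_def HR)
  moreover note equivalentI[OF BEx_Exs_iff[OF wf(1) HR_wf[OF HR wf(2)]]]
  ultimately show ?case
    unfolding HR_fm_def HR_BEx[OF HR] prod.case by (rule equivalent_trans)
qed (simp_all add: HR_fm_def equivalent_def)

end

section \<open>Well-formedness and substitution closure of choice and independence of
  premise\<close>

lemma AC_wf: "(\<Gamma>, A) \<in> AC L \<Longrightarrow> wf_fm L \<Gamma> A"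
proof -
  assume "(\<Gamma>, A) \<in> AC L"
  then obtain \<rho> \<sigma> B where A: "A = Imp (All \<rho> (Ex \<sigma> B))
      (Ex (\<rho> \<rightarrow> Star \<sigma>) (All \<rho> (BEx \<sigma> (Var 1 \<bullet> Var 0) (shift 2 1 B))))"
    and B: "wf_fm L (\<sigma> # \<rho> # \<Gamma>) B"
    by (auto simp: AC_def)
  have "wf_fm L (\<sigma> # \<rho> # (\<rho> \<rightarrow> Star \<sigma>) # \<Gamma>) (shift 2 1 B)"
    using wf_subst[OF B] typed_shift_var[of L "[\<sigma>, \<rho>]" \<Gamma> "[\<rho> \<rightarrow> Star \<sigma>]"]
    by (simp add: numeral_2_eq_2)
  then show ?thesis using B by (simp add: A)
qed

lemma IP_wf: "(\<Gamma>, A) \<in> IP L \<Longrightarrow> wf_fm L \<Gamma> A"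
proof -
  assume "(\<Gamma>, A) \<in> IP L"
  then obtain \<sigma> B C where A: "A = Imp (Imp B (Ex \<sigma> C))
      (Ex (Star \<sigma>) (Imp (shift 0 1 B) (BEx \<sigma> (Var 0) (shift 1 1 C))))"
    and B: "wf_fm L \<Gamma> B" and C: "wf_fm L (\<sigma> # \<Gamma>) C"
    by (auto simp: IP_def)
  have "wf_fm L (\<sigma> # Star \<sigma> # \<Gamma>) (shift 1 1 C)"
    using wf_subst[OF C] typed_shift_var[of L "[\<sigma>]" \<Gamma> "[Star \<sigma>]"] by simp
  then show ?thesis using B C wf_shift[OF B] by (simp add: A)
qed

text \<open>A substitution in the parameters leads to the instance for
  \<open>subst (up (up \<theta>)) B\<close>, because lifting \<open>\<theta>\<close> once more
  commutes with inserting \<open>f\<close> behind the two front variables.\<close>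

lemma AC_subst:
  assumes "(\<Gamma>, A) \<in> AC L" and \<theta>: "typed_subst L \<Gamma> \<Gamma>' \<theta>"
  shows "(\<Gamma>', subst \<theta> A) \<in> AC L"
proof -
  obtain \<rho> \<sigma> B where A: "A = Imp (All \<rho> (Ex \<sigma> B))
      (Ex (\<rho> \<rightarrow> Star \<sigma>) (All \<rho> (BEx \<sigma> (Var 1 \<bullet> Var 0) (shift 2 1 B))))"
    and B: "wf_fm L (\<sigma> # \<rho> # \<Gamma>) B"
    using assms(1) by (auto simp: AC_def)
  let ?B = "subst (up (up \<theta>)) B"
  have "wf_fm L (\<sigma> # \<rho> # \<Gamma>') ?B"
    using wf_subst[OF B typed_subst_up[OF typed_subst_up[OF \<theta>]]] .
  moreover have eq: "subst (up (up (up \<theta>))) (shift 2 1 B) = shift 2 1 ?B"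
    unfolding subst_subst
  proof (rule subst_cong)
    show "subst_tm (up (up (up \<theta>))) (shift_var 2 1 i) = subst_tm (shift_var 2 1) (up (up \<theta>) i)" for i
      by (cases i; cases "i - 1") (auto simp: shift_var_def intro!: subst_tm_cong)
  qed
  have "subst \<theta> A = Imp (All \<rho> (Ex \<sigma> ?B))
      (Ex (\<rho> \<rightarrow> Star \<sigma>) (All \<rho> (BEx \<sigma> (Var 1 \<bullet> Var 0) (shift 2 1 ?B))))"
    unfolding A by (simp add: eq del: subst_subst) (use eq in simp)
  ultimately show ?thesis unfolding AC_def by blast
qed

lemma IP_subst:
  assumes "(\<Gamma>, A) \<in> IP L" and \<theta>: "typed_subst L \<Gamma> \<Gamma>' \<theta>"
  shows "(\<Gamma>', subst \<theta> A) \<in> IP L"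
proof -
  obtain \<sigma> B C where A: "A = Imp (Imp B (Ex \<sigma> C))
      (Ex (Star \<sigma>) (Imp (shift 0 1 B) (BEx \<sigma> (Var 0) (shift 1 1 C))))"
    and B: "wf_fm L \<Gamma> B" "ex_free B" and C: "wf_fm L (\<sigma> # \<Gamma>) C"
    using assms(1) by (auto simp: IP_def)
  let ?B = "subst \<theta> B" and ?C = "subst (up \<theta>) C"
  have "wf_fm L \<Gamma>' ?B" "ex_free ?B" "wf_fm L (\<sigma> # \<Gamma>') ?C"
    using wf_subst[OF B(1) \<theta>] wf_subst[OF C typed_subst_up[OF \<theta>]] B(2) by simp_all
  moreover have eqC: "subst (up (up \<theta>)) (shift 1 1 C) = shift 1 1 ?C"
    unfolding subst_subst
  proof (rule subst_cong)
    show "subst_tm (up (up \<theta>)) (shift_var 1 1 i) = subst_tm (shift_var 1 1) (up \<theta> i)" for i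
      by (cases i) (auto simp: shift_var_def intro!: subst_tm_cong)
  qed
  have eqB: "subst (up \<theta>) (shift 0 1 B) = shift 0 1 ?B" by simp
  have "subst \<theta> A = Imp (Imp ?B (Ex \<sigma> ?C))
      (Ex (Star \<sigma>) (Imp (shift 0 1 ?B) (BEx \<sigma> (Var 0) (shift 1 1 ?C))))"
    unfolding A subst.simps eqB eqC by simp
  ultimately show ?thesis unfolding IP_def by blast
qed

lemma hr_theory_AC_IP: "hr_theory L (AC L \<union> IP L)"
  by unfold_locales (auto dest: AC_wf IP_wf intro: AC_subst IP_subst)

theorem theorem7:
  fixes L :: "('f, 'r) lang" and \<Gamma> :: "ty list" and A :: "('f, 'r) fm"
  assumes "\<exists>c. funs L c = Some 0"
    and "wf_fm L \<Gamma> A"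
  shows "IL_deriv L (AC L \<union> IP L) \<Gamma> {} (Iff A (HR_fm A))"
proof -
  interpret hr_theory L "AC L \<union> IP L" by (rule hr_theory_AC_IP)
  obtain c where "funs L c = Some 0" using assms(1) ..
  from inhabited[OF this] obtain inh where "\<forall>\<tau> \<Gamma>. has_type L \<Gamma> (inh \<tau>) \<tau>" ..
  then have inh: "has_type L \<Gamma> (inh \<tau>) \<tau>" for \<tau> \<Gamma> by simp
  from HR_equivalent[OF inh assms(2)] have eq: "equivalent \<Gamma> A (HR_fm A)" .
  have wf: "wf_fm L \<Gamma> (HR_fm A)" by (rule equivalent_wf[OF eq assms(2)])
  show ?thesis
    by (rule andI[OF impI[OF assms(2) equivalent_deriv[OF eq hyp_in[OF assms(2)]]]
          impI[OF wf equivalent_deriv[OF equivalent_sym[OF eq] hyp_in[OF wf]]]])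
qed

end
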